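(* Let $\rho:\mathbb R\to\mathbb R$ be an increasing diffeomorphism whose extension $\tilde\rho:S^1\to S^1$ to $S^1=\mathbb R\cup\{\infty\}$ is a smooth diffeomorphism. Then there exists a unique complex structure on $\mathbb C=\overline{\mathbb H}\cup_\rho\overline{\mathbb H}^*$ such that, for every open $U$, a function $f:U\to\mathbb C$ is analytic if and only if $f_{|\overline{\mathbb H}}$ and $f_{|\overline{\mathbb H}^*}$ are smooth (up to the boundary) and, away from $\mathbb R$, analytic. In particular, the image of the real axis under any conformal chart of this complex structure is smooth.
   Context: $\overline{\mathbb H}$ and $\overline{\mathbb H}^*$ are the closed upper and lower half planes in $\mathbb C$ with their standard smooth structures (as manifolds with boundary) and standard complex structures. $\overline{\mathbb H}\cup_\rho\overline{\mathbb H}^*$ is the topological surface obtained by gluing, identifying the boundary point $x\in\mathbb R=\partial\overline{\mathbb H}$ with $\rho(x)\in\mathbb R=\partial\overline{\mathbb H}^*$; it is homeomorphic to $\mathbb C$. The common image of the two boundaries is called the real axis $\mathbb R$. For $U$ open in the glued surface, $f_{|\overline{\mathbb H}}$ means the restriction of $f$ to $U\cap\overline{\mathbb H}$, and similarly for $\overline{\mathbb H}^*$. *)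

theory Defs
  imports "HOL-Analysis.Analysis"
begin

section \<open>Smooth functions\<close>

text \<open>
  Real differentiability of class \<open>C\<^sup>k\<close> on an open set; it is only used for open subsets of
  \<^typ>\<open>real\<close> and \<^typ>\<open>complex\<close>, the latter regarded as the real plane.
\<close>

primrec Ck_on ::
  "nat \<Rightarrow> 'a::real_normed_vector set \<Rightarrow> ('a \<Rightarrow> 'b::real_normed_vector) \<Rightarrow> bool" where
  "Ck_on 0 S f \<longleftrightarrow> continuous_on S f"
| "Ck_on (Suc k) S f \<longleftrightarrow>
     (\<forall>x\<in>S. f differentiable (at x)) \<and>
     (\<forall>v. Ck_on k S (\<lambda>x. frechet_derivative f (at x) v))"

definition smooth_on ::
  "'a::real_normed_vector set \<Rightarrow> ('a \<Rightarrow> 'b::real_normed_vector) \<Rightarrow> bool" where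
  "smooth_on S f \<longleftrightarrow> (\<forall>k. Ck_on k S f)"

text \<open>
  Smoothness on a set that need not be open, by local smooth extension. On a relatively open subset
  of a closed half plane this is smoothness up to the boundary.
\<close>

definition smooth_up_to_boundary ::
  "'a::real_normed_vector set \<Rightarrow> ('a \<Rightarrow> 'b::real_normed_vector) \<Rightarrow> bool" where
  "smooth_up_to_boundary A f \<longleftrightarrow>
     (\<forall>p\<in>A. \<exists>W g. open W \<and> p \<in> W \<and> smooth_on W g \<and> (\<forall>z\<in>A \<inter> W. g z = f z))"

definition diffeomorphism_of_reals :: "(real \<Rightarrow> real) \<Rightarrow> bool" where
  "diffeomorphism_of_reals \<rho> \<longleftrightarrow>
     bij \<rho> \<and> smooth_on UNIV \<rho> \<and> smooth_on UNIV (inv \<rho>)"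

text \<open>
  Smooth curves in the plane, as embedded one-dimensional submanifolds: locally the set is
  straightened to the real axis by a diffeomorphism of open sets. The set need not be closed.
\<close>

definition smooth_curve :: "complex set \<Rightarrow> bool" where
  "smooth_curve C \<longleftrightarrow>
     (\<forall>p\<in>C. \<exists>W (W' :: complex set) \<Phi> \<Psi>. open W \<and> open W' \<and> p \<in> W \<and>
        homeomorphism W W' \<Phi> \<Psi> \<and> smooth_on W \<Phi> \<and> smooth_on W' \<Psi> \<and>
        \<Phi> ` (C \<inter> W) = W' \<inter> \<real>)"


section \<open>The circle as the real line with a point at infinity\<close>

text \<open>
  \<^term>\<open>None\<close> is the point at infinity. The smooth structure is given by the two charts \<open>x\<close> and
  \<open>1 / x\<close>, each of which maps its domain onto the whole of \<^typ>\<open>real\<close>.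
\<close>

definition circle_charts :: "(real option set \<times> (real option \<Rightarrow> real)) set" where
  "circle_charts =
     {(- {None}, the),
      (- {Some 0}, \<lambda>p. case p of None \<Rightarrow> 0 | Some x \<Rightarrow> 1 / x)}"

definition smooth_circle_map :: "(real option \<Rightarrow> real option) \<Rightarrow> bool" where
  "smooth_circle_map F \<longleftrightarrow>
     (\<forall>p. \<exists>(U, c)\<in>circle_charts. \<exists>(V, d)\<in>circle_charts. \<exists>W.
        p \<in> U \<and> F p \<in> V \<and> open W \<and> c p \<in> W \<and>
        F ` (inv_into U c ` W) \<subseteq> V \<and> smooth_on W (d \<circ> F \<circ> inv_into U c))"

definition circle_diffeomorphism :: "(real option \<Rightarrow> real option) \<Rightarrow> bool" where
  "circle_diffeomorphism F \<longleftrightarrow> bij F \<and> smooth_circle_map F \<and> smooth_circle_map (inv F)"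

text \<open>The extension of a self-map of the line fixing the point at infinity.\<close>

definition circle_extension :: "(real \<Rightarrow> real) \<Rightarrow> real option \<Rightarrow> real option" where
  "circle_extension \<rho> = map_option \<rho>"


section \<open>The glued surface\<close>

definition quotient_topology :: "'a topology \<Rightarrow> ('a \<times> 'a) set \<Rightarrow> 'a set topology" where
  "quotient_topology X r =
     topology (\<lambda>U. U \<subseteq> topspace X // r \<and> openin X {x \<in> topspace X. r `` {x} \<in> U})"

lemma openin_quotient_topology:
  "openin (quotient_topology X r) U \<longleftrightarrow>
     U \<subseteq> topspace X // r \<and> openin X {x \<in> topspace X. r `` {x} \<in> U}"
proof -
  have 1: "{x \<in> topspace X. r `` {x} \<in> S \<inter> T} =
      {x \<in> topspace X. r `` {x} \<in> S} \<inter> {x \<in> topspace X. r `` {x} \<in> T}" for S T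
    by auto
  have 2: "{x \<in> topspace X. r `` {x} \<in> \<Union>\<K>} = (\<Union>K\<in>\<K>. {x \<in> topspace X. r `` {x} \<in> K})" for \<K>
    by auto
  have "istopology (\<lambda>U. U \<subseteq> topspace X // r \<and> openin X {x \<in> topspace X. r `` {x} \<in> U})"
    unfolding istopology_def 1 2 by blast
  then show ?thesis
    by (simp add: quotient_topology_def)
qed

lemma topspace_quotient_topology [simp]: "topspace (quotient_topology X r) = topspace X // r"
proof
  show "topspace (quotient_topology X r) \<subseteq> topspace X // r"
    using openin_quotient_topology[of X r "topspace (quotient_topology X r)"] by simp
  have "{x \<in> topspace X. r `` {x} \<in> topspace X // r} = topspace X"
    by (auto intro: quotientI)
  then have "openin (quotient_topology X r) (topspace X // r)"
    by (simp add: openin_quotient_topology)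
  then show "topspace X // r \<subseteq> topspace (quotient_topology X r)"
    by (rule openin_subset)
qed

lemma quotient_map_quotient_topology:
  "quotient_map X (quotient_topology X r) (\<lambda>x. r `` {x})"
  unfolding quotient_map_def by (auto simp: openin_quotient_topology quotient_def)

datatype side = Upper | Lower

primrec half_plane :: "side \<Rightarrow> complex set" where
  "half_plane Upper = {z. Im z \<ge> 0}"
| "half_plane Lower = {z. Im z \<le> 0}"

definition half_planes :: "(side \<times> complex) topology" where
  "half_planes = sum_topology (\<lambda>s. top_of_set (half_plane s)) UNIV"

definition gluing :: "(real \<Rightarrow> real) \<Rightarrow> ((side \<times> complex) \<times> (side \<times> complex)) set" where
  "gluing \<rho> =
     Id_on (topspace half_planes) \<union>
     {((Upper, of_real x), (Lower, of_real (\<rho> x))) |x. True} \<union>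
     {((Lower, of_real (\<rho> x)), (Upper, of_real x)) |x. True}"

lemma equiv_gluing:
  assumes "inj \<rho>"
  shows "equiv (topspace half_planes) (gluing \<rho>)"
proof (rule equivI)
  show "gluing \<rho> \<subseteq> topspace half_planes \<times> topspace half_planes"
    by (auto simp: gluing_def half_planes_def)
  show "refl_on (topspace half_planes) (gluing \<rho>)"
    by (auto simp: gluing_def refl_on_def)
  show "sym (gluing \<rho>)"
    by (auto simp: gluing_def sym_def)
  show "trans (gluing \<rho>)"
    using inj_eq[OF assms] by (auto simp: gluing_def trans_def half_planes_def Id_on_iff)
qed

definition glued_surface :: "(real \<Rightarrow> real) \<Rightarrow> (side \<times> complex) set topology" where
  "glued_surface \<rho> = quotient_topology half_planes (gluing \<rho>)"

definition half_plane_map :: "(real \<Rightarrow> real) \<Rightarrow> side \<Rightarrow> complex \<Rightarrow> (side \<times> complex) set" where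
  "half_plane_map \<rho> s z = gluing \<rho> `` {(s, z)}"

definition real_axis :: "(real \<Rightarrow> real) \<Rightarrow> (side \<times> complex) set set" where
  "real_axis \<rho> = half_plane_map \<rho> Upper ` \<real>"


section \<open>Complex structures on a topological surface\<close>

text \<open>
  A chart is an open set with a homeomorphism onto an open subset of the plane. Values outside the
  domain are fixed by \<^const>\<open>extensional\<close>, so that equality of maximal atlases is equality of
  complex structures.
\<close>

definition complex_chart :: "'a topology \<Rightarrow> 'a set \<times> ('a \<Rightarrow> complex) \<Rightarrow> bool" where
  "complex_chart X = (\<lambda>(U, \<phi>).
     openin X U \<and> \<phi> \<in> extensional U \<and> open (\<phi> ` U) \<and>
     homeomorphic_map (subtopology X U) (top_of_set (\<phi> ` U)) \<phi>)"

definition compatible_charts ::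
  "'a set \<times> ('a \<Rightarrow> complex) \<Rightarrow> 'a set \<times> ('a \<Rightarrow> complex) \<Rightarrow> bool" where
  "compatible_charts = (\<lambda>(U, \<phi>) (V, \<psi>).
     (\<psi> \<circ> inv_into U \<phi>) holomorphic_on (\<phi> ` (U \<inter> V)) \<and>
     (\<phi> \<circ> inv_into V \<psi>) holomorphic_on (\<psi> ` (U \<inter> V)))"

definition complex_structure :: "'a topology \<Rightarrow> ('a set \<times> ('a \<Rightarrow> complex)) set \<Rightarrow> bool" where
  "complex_structure X \<A> \<longleftrightarrow>
     (\<forall>c\<in>\<A>. complex_chart X c) \<and>
     \<Union>(fst ` \<A>) = topspace X \<and>
     (\<forall>c\<in>\<A>. \<forall>d\<in>\<A>. compatible_charts c d) \<and>
     (\<forall>c. complex_chart X c \<and> (\<forall>d\<in>\<A>. compatible_charts c d) \<longrightarrow> c \<in> \<A>)"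

definition analytic_wrt ::
  "('a set \<times> ('a \<Rightarrow> complex)) set \<Rightarrow> 'a set \<Rightarrow> ('a \<Rightarrow> complex) \<Rightarrow> bool" where
  "analytic_wrt \<A> U f \<longleftrightarrow>
     (\<forall>(V, \<phi>)\<in>\<A>. (f \<circ> inv_into V \<phi>) holomorphic_on (\<phi> ` (U \<inter> V)))"

definition piecewise_analytic ::
  "(real \<Rightarrow> real) \<Rightarrow> (side \<times> complex) set set \<Rightarrow> ((side \<times> complex) set \<Rightarrow> complex) \<Rightarrow> bool" where
  "piecewise_analytic \<rho> U f \<longleftrightarrow>
     (\<forall>s. smooth_up_to_boundary {z \<in> half_plane s. half_plane_map \<rho> s z \<in> U}
            (f \<circ> half_plane_map \<rho> s) \<and>
          (f \<circ> half_plane_map \<rho> s) holomorphic_on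
            {z \<in> half_plane s - \<real>. half_plane_map \<rho> s z \<in> U})"

definition welding_structure ::
  "(real \<Rightarrow> real) \<Rightarrow> ((side \<times> complex) set set \<times> ((side \<times> complex) set \<Rightarrow> complex)) set \<Rightarrow> bool"
  where
  "welding_structure \<rho> \<A> \<longleftrightarrow>
     complex_structure (glued_surface \<rho>) \<A> \<and>
     (\<forall>U f. openin (glued_surface \<rho>) U \<longrightarrow> (analytic_wrt \<A> U f \<longleftrightarrow> piecewise_analytic \<rho> U f))"

end

(*
  The charts away from the axis are the two half planes. At a point of the axis one must solve a
  welding problem: find F+ and F-, holomorphic in the upper and the lower half plane, smooth up to
  the boundary and with nonzero derivative, such that F+ = F- o R near 0, where R is rho rescaled
  around the point. Being local, the problem may be replaced by one in which R(t) = t + delta(t) for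
  a small smooth periodic function delta. Writing F+ = z + u and F- = w + v with u a power series in
  exp(i z) and v a power series in exp(-i w) without constant term, the equation is u - v o R = delta.
  Its unknown v o R is the fixed point of a contraction, because the matrix coefficients of v |-> v o R
  between frequencies of opposite sign are oscillatory integrals without stationary points: they decay
  rapidly in both frequencies, so the corresponding operator is smoothing and small.

  Across the axis, a piecewise analytic function has two one-sided complex derivatives in such a chart,
  and they coincide because the derivatives along the axis do; hence it is holomorphic. This determines
  the maximal atlas as the set of all charts that are piecewise analytic.
*)
theory Submission
  imports Defs "HOL-Complex_Analysis.Complex_Analysis"
begin

section \<open>Smooth functions\<close>

text \<open>A complex atlas is a local object, so welding is needed only near each point of the
  axis; magnification there is what provides smallness. Two obstacles shape the analysis. The
  constants of the oscillatory estimates must not depend on the magnification, which is itself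
  chosen from them; hence the estimates are made for families, uniformly in parameters, and all
  matrix coefficients are expressed by the single family of phases k (t + l \<delta>(t)) with 0
  \<le> l \<le> 1. Moreover, the fixed point equation is a priori only a necessary condition: it
  does not say that its solution has the form v o R. The part W of the solution with nonnegative
  R-frequencies is shown to vanish by a second smallness argument, using the leak from nonnegative
  R-frequencies to negative t-frequencies. The fixed point is sought among bounded continuous
  functions; its smoothness is automatic, as the operator is smoothing. On the geometric side,
  smoothness up to the axis means having smooth extensions past it. These are complex differentiable
  up to the axis but in general not beyond, so real inverse function arguments are used
  there.\<close>

lemma Ck_on_cong:
  assumes "open S" "\<And>x. x \<in> S \<Longrightarrow> f x = g x"
  shows "Ck_on k S f \<longleftrightarrow> Ck_on k S g"
proof -
  have "Ck_on k S g" if "Ck_on k S f" "\<And>x. x \<in> S \<Longrightarrow> f x = g x" for f g :: "'a \<Rightarrow> 'b"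
    using that
  proof (induction k arbitrary: f g)
    case 0
    then show ?case by (auto cong: continuous_on_cong)
  next
    case (Suc k)
    have g: "(g has_derivative frechet_derivative f (at x)) (at x)" if "x \<in> S" for x
    proof -
      have "(f has_derivative frechet_derivative f (at x)) (at x)"
        using Suc.prems(1) that by (simp add: frechet_derivative_works)
      then show ?thesis
        by (rule has_derivative_transform_within_open[OF _ assms(1) that Suc.prems(2)])
    qed
    then have "frechet_derivative g (at x) = frechet_derivative f (at x)" if "x \<in> S" for x
      using frechet_derivative_at[OF g[OF that]] by simp
    then have "Ck_on k S (\<lambda>x. frechet_derivative g (at x) v)" for v
      using Suc.IH[of "\<lambda>x. frechet_derivative f (at x) v" "\<lambda>x. frechet_derivative g (at x) v"] Suc.prems(1)
      by simp
    then show ?case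
      using g by (auto simp: differentiable_def)
  qed
  from this[of f g] this[of g f] show ?thesis
    using assms(2) by auto
qed

text \<open>\<open>frechet_derivative\<close> is a choice operator; uniqueness of derivatives lets
  any explicit formula \<open>D\<close> replace it on an open set. Most regularity inductions below
  pass through this rule.\<close>

lemma Ck_on_SucI:
  assumes "open S" "\<And>x. x \<in> S \<Longrightarrow> (f has_derivative D x) (at x)" "\<And>v. Ck_on k S (\<lambda>x. D x v)"
  shows "Ck_on (Suc k) S f"
proof -
  have "frechet_derivative f (at x) = D x" if "x \<in> S" for x
    using frechet_derivative_at[OF assms(2)[OF that]] by simp
  then have "Ck_on k S (\<lambda>x. frechet_derivative f (at x) v)" for v
    using Ck_on_cong[OF assms(1), of "\<lambda>x. frechet_derivative f (at x) v" "\<lambda>x. D x v"] assms(3) by simp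
  then show ?thesis
    using assms(2) by (auto simp: differentiable_def)
qed

lemma Ck_on_SucD:
  assumes "Ck_on (Suc k) S f" "x \<in> S"
  shows "(f has_derivative frechet_derivative f (at x)) (at x)"
  using assms by (simp add: frechet_derivative_works)

lemma Ck_on_continuous: "Ck_on k S f \<Longrightarrow> continuous_on S f"
  by (cases k) (simp_all add: continuous_at_imp_continuous_on differentiable_imp_continuous_within)

lemma Ck_on_Suc_imp: "Ck_on (Suc k) S f \<Longrightarrow> Ck_on k S f"
proof (induction k arbitrary: f)
  case 0
  then show ?case using Ck_on_continuous Ck_on.simps(1) by blast
qed (simp del: Ck_on.simps(1))

lemma Ck_on_subset: "Ck_on k S f \<Longrightarrow> T \<subseteq> S \<Longrightarrow> Ck_on k T f"
  by (induction k arbitrary: f) (auto intro: continuous_on_subset)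

lemma Ck_on_const: "open S \<Longrightarrow> Ck_on k S (\<lambda>x. c)"
proof (induction k arbitrary: c)
  case (Suc k)
  show ?case
    by (rule Ck_on_SucI[where D = "\<lambda>x v. 0"]) (use Suc in auto)
qed auto

lemma Ck_on_bounded_linear_compose:
  assumes "open S" "bounded_linear L" "Ck_on k S f"
  shows "Ck_on k S (\<lambda>x. L (f x))"
  using assms(3)
proof (induction k arbitrary: f)
  case 0
  then show ?case
    using assms(2) by (simp add: bounded_linear.continuous_on)
next
  case (Suc k)
  show ?case
    by (rule Ck_on_SucI[OF assms(1) bounded_linear.has_derivative[OF assms(2) Ck_on_SucD[OF Suc.prems]]])
       (use Suc in auto)
qed

lemma Ck_on_linear:
  assumes "open S" "bounded_linear L"
  shows "Ck_on k S L"
proof (cases k)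
  case 0
  then show ?thesis
    using assms(2) by (simp add: linear_continuous_on)
next
  case (Suc l)
  show ?thesis
    unfolding Suc using assms
    by (intro Ck_on_SucI[where D = "\<lambda>x. L"] Ck_on_const bounded_linear_imp_has_derivative) auto
qed

lemma Ck_on_add:
  assumes "open S" "Ck_on k S f" "Ck_on k S g"
  shows "Ck_on k S (\<lambda>x. f x + g x)"
  using assms(2,3)
proof (induction k arbitrary: f g)
  case 0
  then show ?case by (simp add: continuous_on_add)
next
  case (Suc k)
  show ?case
    by (rule Ck_on_SucI[OF assms(1) has_derivative_add[OF Ck_on_SucD[OF Suc.prems(1)] Ck_on_SucD[OF Suc.prems(2)]]])
       (use Suc in auto)
qed

lemma Ck_on_minus: "open S \<Longrightarrow> Ck_on k S f \<Longrightarrow> Ck_on k S (\<lambda>x. - f x)"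
  by (rule Ck_on_bounded_linear_compose[OF _ bounded_linear_minus[OF bounded_linear_ident]])

lemma Ck_on_diff:
  "open S \<Longrightarrow> Ck_on k S f \<Longrightarrow> Ck_on k S g \<Longrightarrow> Ck_on k S (\<lambda>x. f x - g x)"
  using Ck_on_add[of S k f "\<lambda>x. - g x"] Ck_on_minus[of S k g] by simp

lemma Ck_on_sum:
  "open S \<Longrightarrow> (\<And>i. i \<in> I \<Longrightarrow> Ck_on k S (f i)) \<Longrightarrow> Ck_on k S (\<lambda>x. \<Sum>i\<in>I. f i x)"
  by (induction I rule: infinite_finite_induct) (simp_all add: Ck_on_const Ck_on_add)

text \<open>The product rule yields two terms of the same bilinear shape, each with one factor
  differentiated, so the induction runs over both factors at once.\<close>

lemma Ck_on_bilinear: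
  assumes "open S" "bounded_bilinear B" "Ck_on k S f" "Ck_on k S g"
  shows "Ck_on k S (\<lambda>x. B (f x) (g x))"
  using assms(3,4)
proof (induction k arbitrary: f g)
  case 0
  then show ?case using bounded_bilinear.continuous_on[OF assms(2)] by simp
next
  case (Suc k)
  have "Ck_on k S f" "Ck_on k S g"
    using Suc.prems Ck_on_Suc_imp by blast+
  then have *: "Ck_on k S (\<lambda>x. B (f x) (frechet_derivative g (at x) v) + B (frechet_derivative f (at x) v) (g x))" for v
    using Suc.prems by (intro Ck_on_add[OF assms(1)] Suc.IH) simp_all
  show ?case
    by (rule Ck_on_SucI[OF assms(1) bounded_bilinear.FDERIV[OF assms(2) Ck_on_SucD[OF Suc.prems(1)]
            Ck_on_SucD[OF Suc.prems(2)]]]) (simp_all only: *)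
qed

lemmas Ck_on_mult = Ck_on_bilinear[OF _ bounded_bilinear_mult]
lemmas Ck_on_scaleR = Ck_on_bilinear[OF _ bounded_bilinear_scaleR]

text \<open>The induction hypothesis covers derivatives in fixed directions only, whereas the chain
  rule produces the moving direction Df(x)v. Expanding that vector in \<open>Basis\<close> leaves
  fixed directions with scalar coefficients, hence the Euclidean middle space.\<close>

lemma Ck_on_compose:
  fixes f :: "'a::real_normed_vector \<Rightarrow> 'b::euclidean_space" and g :: "'b \<Rightarrow> 'c::real_normed_vector"
  assumes "open S" "open T" "f ` S \<subseteq> T" "Ck_on k S f" "Ck_on k T g"
  shows "Ck_on k S (\<lambda>x. g (f x))"
  using assms(4,5)
proof (induction k arbitrary: g)
  case 0
  then show ?case
    using continuous_on_compose2[of T g S f] assms(3) by auto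
next
  case (Suc k)
  have lin: "linear (frechet_derivative g (at y))" if "y \<in> T" for y
    using Ck_on_SucD[OF Suc.prems(2) that] has_derivative_linear by blast
  have "((\<lambda>x. g (f x)) has_derivative
      (\<lambda>v. \<Sum>b\<in>Basis. (frechet_derivative f (at x) v \<bullet> b) *\<^sub>R frechet_derivative g (at (f x)) b)) (at x)"
    if "x \<in> S" for x
  proof -
    have fx: "f x \<in> T" using assms(3) that by auto
    have "((\<lambda>x. g (f x)) has_derivative (\<lambda>v. frechet_derivative g (at (f x)) (frechet_derivative f (at x) v))) (at x)"
      by (rule has_derivative_compose[OF Ck_on_SucD[OF Suc.prems(1) that] Ck_on_SucD[OF Suc.prems(2) fx]])
    moreover have "frechet_derivative g (at (f x)) w = (\<Sum>b\<in>Basis. (w \<bullet> b) *\<^sub>R frechet_derivative g (at (f x)) b)" for w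
    proof -
      have "frechet_derivative g (at (f x)) w = frechet_derivative g (at (f x)) (\<Sum>b\<in>Basis. (w \<bullet> b) *\<^sub>R b)"
        by (simp add: euclidean_representation)
      also have "\<dots> = (\<Sum>b\<in>Basis. (w \<bullet> b) *\<^sub>R frechet_derivative g (at (f x)) b)"
        by (simp add: linear_sum[OF lin[OF fx]] linear_cmul[OF lin[OF fx]])
      finally show ?thesis .
    qed
    then have "(\<lambda>v. frechet_derivative g (at (f x)) (frechet_derivative f (at x) v)) =
      (\<lambda>v. \<Sum>b\<in>Basis. (frechet_derivative f (at x) v \<bullet> b) *\<^sub>R frechet_derivative g (at (f x)) b)"
      by (intro ext) blast
    ultimately show ?thesis by simp
  qed
  moreover have "Ck_on k S (\<lambda>x. \<Sum>b\<in>Basis. (frechet_derivative f (at x) v \<bullet> b) *\<^sub>R frechet_derivative g (at (f x)) b)" for v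
  proof (intro Ck_on_sum Ck_on_scaleR assms(1))
    fix b :: 'b
    show "Ck_on k S (\<lambda>x. frechet_derivative f (at x) v \<bullet> b)"
      by (rule Ck_on_bounded_linear_compose[OF assms(1) bounded_linear_inner_left]) (use Suc.prems in auto)
    show "Ck_on k S (\<lambda>x. frechet_derivative g (at (f x)) b)"
      by (rule Suc.IH[OF Ck_on_Suc_imp[OF Suc.prems(1)]]) (use Suc.prems in auto)
  qed
  ultimately show ?case
    by (rule Ck_on_SucI[OF assms(1)])
qed

text \<open>The real derivative is multiplication by \<open>deriv f x\<close>, and
  \<open>deriv f\<close> is again holomorphic.\<close>

lemma Ck_on_holomorphic:
  assumes "open S" "f holomorphic_on S"
  shows "Ck_on k S f"
  using assms(2)
proof (induction k arbitrary: f)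
  case 0
  then show ?case by (simp add: holomorphic_on_imp_continuous_on)
next
  case (Suc k)
  show ?case
  proof (rule Ck_on_SucI[OF assms(1), where D = "\<lambda>x v. deriv f x * v"])
    fix x assume "x \<in> S"
    then have "(f has_field_derivative deriv f x) (at x)"
      using Suc.prems assms(1) holomorphic_derivI by blast
    then show "(f has_derivative (*) (deriv f x)) (at x)"
      by (rule has_field_derivative_imp_has_derivative)
  next
    fix v
    show "Ck_on k S (\<lambda>x. deriv f x * v)"
      by (intro Ck_on_mult Ck_on_const assms(1) Suc.IH holomorphic_deriv Suc.prems)
  qed
qed

lemma smooth_onI: "(\<And>k. Ck_on k S f) \<Longrightarrow> smooth_on S f"
  and smooth_onD: "smooth_on S f \<Longrightarrow> Ck_on k S f"
  by (auto simp: smooth_on_def)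

lemma smooth_on_has_derivative:
  "smooth_on S f \<Longrightarrow> x \<in> S \<Longrightarrow> (f has_derivative frechet_derivative f (at x)) (at x)"
  using Ck_on_SucD smooth_onD by blast

lemma smooth_on_frechet_derivative:
  "smooth_on S f \<Longrightarrow> smooth_on S (\<lambda>x. frechet_derivative f (at x) v)"
  using smooth_onD[of S f "Suc _"] by (intro smooth_onI) simp

lemma smooth_on_cong:
  "open S \<Longrightarrow> (\<And>x. x \<in> S \<Longrightarrow> f x = g x) \<Longrightarrow> smooth_on S f \<longleftrightarrow> smooth_on S g"
  unfolding smooth_on_def using Ck_on_cong[of S f g] by blast

lemma smooth_on_subset: "smooth_on S f \<Longrightarrow> T \<subseteq> S \<Longrightarrow> smooth_on T f"
  unfolding smooth_on_def using Ck_on_subset[of _ S f T] by blast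

lemma smooth_on_continuous: "smooth_on S f \<Longrightarrow> continuous_on S f"
  using Ck_on_continuous smooth_onD by blast

lemma smooth_on_const: "open S \<Longrightarrow> smooth_on S (\<lambda>x. c)"
  by (intro smooth_onI Ck_on_const)

lemma smooth_on_linear: "open S \<Longrightarrow> bounded_linear L \<Longrightarrow> smooth_on S L"
  by (intro smooth_onI Ck_on_linear)

lemma smooth_on_linear_compose:
  assumes "open S" "bounded_linear L" "smooth_on S f"
  shows "smooth_on S (\<lambda>x. L (f x))"
  by (intro smooth_onI Ck_on_bounded_linear_compose[OF assms(1,2) smooth_onD[OF assms(3)]])

lemma smooth_on_add:
  assumes "open S" "smooth_on S f" "smooth_on S g"
  shows "smooth_on S (\<lambda>x. f x + g x)"
  by (intro smooth_onI Ck_on_add[OF assms(1) smooth_onD[OF assms(2)] smooth_onD[OF assms(3)]])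

lemma smooth_on_diff:
  assumes "open S" "smooth_on S f" "smooth_on S g"
  shows "smooth_on S (\<lambda>x. f x - g x)"
  by (intro smooth_onI Ck_on_diff[OF assms(1) smooth_onD[OF assms(2)] smooth_onD[OF assms(3)]])

lemma smooth_on_bilinear:
  assumes "open S" "bounded_bilinear B" "smooth_on S f" "smooth_on S g"
  shows "smooth_on S (\<lambda>x. B (f x) (g x))"
  by (intro smooth_onI Ck_on_bilinear[OF assms(1,2) smooth_onD[OF assms(3)] smooth_onD[OF assms(4)]])

lemmas smooth_on_mult = smooth_on_bilinear[OF _ bounded_bilinear_mult]

lemma smooth_on_compose:
  fixes f :: "'a::real_normed_vector \<Rightarrow> 'b::euclidean_space"
  shows "open S \<Longrightarrow> open T \<Longrightarrow> f ` S \<subseteq> T \<Longrightarrow> smooth_on S f \<Longrightarrow> smooth_on T g \<Longrightarrow> smooth_on S (\<lambda>x. g (f x))"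
  unfolding smooth_on_def using Ck_on_compose[of S T f _ g] by blast

lemma smooth_on_holomorphic: "open S \<Longrightarrow> f holomorphic_on S \<Longrightarrow> smooth_on S f"
  unfolding smooth_on_def using Ck_on_holomorphic[of S f] by blast

lemma smooth_on_local:
  assumes "\<And>x. x \<in> S \<Longrightarrow> \<exists>T. open T \<and> x \<in> T \<and> smooth_on T f"
  shows "smooth_on S f"
proof -
  have *: "Ck_on k S f" if "\<And>x. x \<in> S \<Longrightarrow> \<exists>T. open T \<and> x \<in> T \<and> Ck_on k T f" for k
    using that
  proof (induction k arbitrary: f)
    case 0
    show ?case
      unfolding Ck_on.simps
    proof (rule continuous_at_imp_continuous_on, rule ballI)
      fix x assume "x \<in> S"
      then obtain T where "open T" "x \<in> T" "continuous_on T f"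
        using 0 by auto
      then show "isCont f x"
        using continuous_on_eq_continuous_at by blast
    qed
  next
    case (Suc k)
    show ?case
      unfolding Ck_on.simps
    proof (intro conjI ballI allI)
      fix x assume "x \<in> S"
      then obtain T where "x \<in> T" "Ck_on (Suc k) T f"
        using Suc.prems by blast
      then show "f differentiable (at x)"
        by simp
    next
      fix v
      show "Ck_on k S (\<lambda>x. frechet_derivative f (at x) v)"
      proof (rule Suc.IH)
        fix x assume "x \<in> S"
        then obtain T where "open T" "x \<in> T" "Ck_on (Suc k) T f"
          using Suc.prems by blast
        then show "\<exists>T. open T \<and> x \<in> T \<and> Ck_on k T (\<lambda>x. frechet_derivative f (at x) v)"
          by auto
      qed
    qed
  qed
  show ?thesis
  proof (intro smooth_onI *)
    fix k x assume "x \<in> S"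
    then show "\<exists>T. open T \<and> x \<in> T \<and> Ck_on k T f"
      using assms smooth_onD by blast
  qed
qed

text \<open>A coinduction principle: a class of functions that is stable under directional
  differentiation consists of smooth functions. It reduces the smoothness of a concrete function to
  guessing such a class of closed formulas.\<close>

lemma smooth_onI_deriv_closed:
  assumes "open S" "P f" "\<And>f. P f \<Longrightarrow> \<exists>D. (\<forall>x\<in>S. (f has_derivative D x) (at x)) \<and> (\<forall>v. P (\<lambda>x. D x v))"
  shows "smooth_on S f"
proof (rule smooth_onI)
  show "Ck_on k S f" for k
    using assms(2)
  proof (induction k arbitrary: f)
    case 0
    then obtain D where "\<forall>x\<in>S. (f has_derivative D x) (at x)"
      using assms(3) by blast
    then show ?case
      by (auto intro!: continuous_at_imp_continuous_on has_derivative_continuous)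
  next
    case (Suc k)
    then obtain D where "\<forall>x\<in>S. (f has_derivative D x) (at x)" "\<forall>v. P (\<lambda>x. D x v)"
      using assms(3) by blast
    then show ?case
      using Suc.IH by (intro Ck_on_SucI[OF assms(1), where D = D]) auto
  qed
qed

abbreviation rderiv :: "(real \<Rightarrow> 'b::real_normed_vector) \<Rightarrow> real \<Rightarrow> 'b" where
  "rderiv f x \<equiv> frechet_derivative f (at x) 1"

lemma smooth_on_has_vector_derivative:
  assumes "smooth_on S f" "x \<in> S"
  shows "(f has_vector_derivative rderiv f x) (at x)"
proof -
  have *: "(f has_derivative frechet_derivative f (at x)) (at x)"
    using smooth_on_has_derivative[OF assms] .
  then have "linear (frechet_derivative f (at x))"
    by (rule has_derivative_linear)
  then have "frechet_derivative f (at x) = (\<lambda>h. h *\<^sub>R rderiv f x)"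
    by (metis linear_cmul real_scaleR_def mult.right_neutral)
  then show ?thesis
    using * by (simp add: has_vector_derivative_def)
qed

text \<open>In one variable the derivative in direction \<open>v\<close> is \<open>v\<close> times
  the ordinary one, so the class has to absorb scalar factors.\<close>

lemma smooth_on_realI:
  fixes f :: "real \<Rightarrow> 'b::real_normed_vector"
  assumes "open S" "P f" "\<And>f. P f \<Longrightarrow> \<exists>f'. (\<forall>x\<in>S. (f has_vector_derivative f' x) (at x)) \<and> (\<forall>v. P (\<lambda>x. v *\<^sub>R f' x))"
  shows "smooth_on S f"
proof (rule smooth_onI_deriv_closed[where P = P, OF assms(1,2)])
  fix f :: "real \<Rightarrow> 'b" assume "P f"
  then obtain f' where "\<forall>x\<in>S. (f has_vector_derivative f' x) (at x)" "\<forall>v. P (\<lambda>x. v *\<^sub>R f' x)"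
    using assms(3) by blast
  then show "\<exists>D. (\<forall>x\<in>S. (f has_derivative D x) (at x)) \<and> (\<forall>v. P (\<lambda>x. D x v))"
    by (intro exI[where x = "\<lambda>x h. h *\<^sub>R f' x"]) (auto simp: has_vector_derivative_def)
qed

section \<open>Cutoff functions\<close>

definition flat :: "real \<Rightarrow> real" where
  "flat x = (if x > 0 then exp (- 1 / x) else 0)"

lemma tendsto_poly_mult_exp_neg: "((\<lambda>t. poly p t * exp (- t)) \<longlongrightarrow> (0::real)) at_top"
proof -
  have "((\<lambda>t. \<Sum>i\<le>degree p. coeff p i * (t ^ i / exp t)) \<longlongrightarrow> (\<Sum>i\<le>degree p. coeff p i * 0)) at_top"
    by (intro tendsto_intros tendsto_power_div_exp_0)
  then show ?thesis
    by (simp add: poly_altdef exp_minus divide_inverse sum_distrib_right mult.assoc)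
qed

text \<open>The class P(1/x) exp(-1/x), with P a polynomial, is stable: in terms of y = 1/x,
  differentiation replaces P by y^2 (P - P'). At 0 the exponential beats every power of y.\<close>

lemma smooth_on_flat: "smooth_on UNIV flat"
proof (rule smooth_on_realI[where P = "\<lambda>f. \<exists>p. f = (\<lambda>x. if x > 0 then poly p (1 / x) * exp (- 1 / x) else 0)"])
  show "\<exists>p. flat = (\<lambda>x. if x > 0 then poly p (1 / x) * exp (- 1 / x) else 0)"
    by (rule exI[of _ 1]) (auto simp: flat_def)
next
  fix f :: "real \<Rightarrow> real"
  assume "\<exists>p. f = (\<lambda>x. if x > 0 then poly p (1 / x) * exp (- 1 / x) else 0)"
  then obtain p where f: "f = (\<lambda>x. if x > 0 then poly p (1 / x) * exp (- 1 / x) else 0)" by blast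
  define q where "q = monom 1 2 * (p - pderiv p)"
  let ?f' = "\<lambda>x. if x > 0 then poly q (1 / x) * exp (- 1 / x) else 0"
  have "(f has_real_derivative ?f' x) (at x)" for x
  proof (cases x "0::real" rule: linorder_cases)
    case greater
    have "((\<lambda>x. poly p (1 / x) * exp (- 1 / x)) has_real_derivative ?f' x) (at x)"
      using greater
      by (auto intro!: derivative_eq_intros DERIV_chain2[OF poly_DERIV]
          simp: q_def poly_monom field_simps power2_eq_square)
    moreover have ev: "eventually (\<lambda>y. poly p (1 / y) * exp (- 1 / y) = f y) (nhds x)"
      using eventually_nhds_in_open[of "{0<..}" x] greater by (auto elim!: eventually_mono simp: f)
    ultimately show ?thesis
      using DERIV_cong_ev[OF refl ev refl] by simp
  next
    case less
    have "eventually (\<lambda>y. 0 = f y) (nhds x)"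
      using eventually_nhds_in_open[of "{..<0}" x] less by (auto elim!: eventually_mono simp: f)
    then show ?thesis
      using DERIV_cong_ev[OF refl, of "\<lambda>y. 0" f x 0 0] less by simp
  next
    case equal
    have "((\<lambda>y. (f y - f 0) / (y - 0)) \<longlongrightarrow> 0) (at_right 0)"
    proof -
      \<comment> \<open>In terms of Y = 1/y the difference quotient at 0 is Y P(Y) exp(-Y); the
        extra factor Y is the \<open>pCons 0\<close>.\<close>
      have "((\<lambda>y. poly (pCons 0 p) (inverse y) * exp (- (inverse y))) \<longlongrightarrow> 0) (at_right 0)"
        by (rule filterlim_compose[OF tendsto_poly_mult_exp_neg filterlim_inverse_at_top_right])
      moreover have "eventually (\<lambda>y. poly (pCons 0 p) (inverse y) * exp (- (inverse y)) = (f y - f 0) / (y - 0)) (at_right (0::real))"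
        unfolding eventually_at_filter
        by (auto intro!: always_eventually simp: f divide_inverse)
      ultimately show ?thesis
        by (rule Lim_transform_eventually)
    qed
    moreover have "((\<lambda>y. (f y - f 0) / (y - 0)) \<longlongrightarrow> 0) (at_left 0)"
    proof -
      have "eventually (\<lambda>y. 0 = (f y - f 0) / (y - 0)) (at_left (0::real))"
        unfolding eventually_at_filter
        by (auto intro!: always_eventually simp: f)
      then show ?thesis
        by (rule Lim_transform_eventually[OF tendsto_const])
    qed
    ultimately have "(f has_real_derivative 0) (at 0)"
      unfolding has_field_derivative_iff by (simp add: filterlim_split_at)
    then show ?thesis using equal by simp
  qed
  moreover have "\<exists>p. (\<lambda>x. v *\<^sub>R ?f' x) = (\<lambda>x. if x > 0 then poly p (1 / x) * exp (- 1 / x) else 0)" for v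
    by (rule exI[of _ "smult v q"]) auto
  ultimately show "\<exists>f'. (\<forall>x\<in>UNIV. (f has_vector_derivative f' x) (at x)) \<and>
      (\<forall>v. \<exists>p. (\<lambda>x. v *\<^sub>R f' x) = (\<lambda>x. if x > 0 then poly p (1 / x) * exp (- 1 / x) else 0))"
    by (intro exI[of _ ?f']) (simp add: has_real_derivative_iff_has_vector_derivative)
qed simp

lemma smooth_on_inverse_real: "smooth_on {0<..} (inverse :: real \<Rightarrow> real)"
proof (rule smooth_on_realI[where P = "\<lambda>f. \<exists>c n. f = (\<lambda>x. c * inverse x ^ n)"])
  show "\<exists>c n. (inverse :: real \<Rightarrow> real) = (\<lambda>x. c * inverse x ^ n)"
    by (rule exI[of _ 1], rule exI[of _ 1]) auto
next
  fix f :: "real \<Rightarrow> real" assume "\<exists>c n. f = (\<lambda>x. c * inverse x ^ n)"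
  then obtain c n where f: "f = (\<lambda>x. c * inverse x ^ n)" by blast
  have "(f has_real_derivative (- c * real n) * inverse x ^ (n + 1)) (at x)" if "x > 0" for x
  proof (cases n)
    case (Suc m)
    have "((\<lambda>x. inverse x ^ n) has_real_derivative
        of_nat n * (- (inverse x ^ Suc (Suc 0)) * inverse x ^ (n - Suc 0))) (at x)"
      using that by (intro DERIV_power DERIV_inverse) auto
    from DERIV_cmult[OF this, of c] show ?thesis
      using Suc by (simp add: f mult_ac)
  qed (simp add: f)
  moreover have "\<exists>c' m. (\<lambda>x. v *\<^sub>R ((- c * real n) * inverse x ^ (n + 1))) = (\<lambda>x. c' * inverse x ^ m)" for v
    by (rule exI[of _ "v * (- c * real n)"], rule exI[of _ "n + 1"]) (simp add: mult.assoc del: power_Suc)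
  ultimately show "\<exists>f'. (\<forall>x\<in>{0<..}. (f has_vector_derivative f' x) (at x)) \<and>
      (\<forall>v. \<exists>c n. (\<lambda>x. v *\<^sub>R f' x) = (\<lambda>x. c * inverse x ^ n))"
    by (intro exI[of _ "\<lambda>x. (- c * real n) * inverse x ^ (n + 1)"])
      (auto simp: has_real_derivative_iff_has_vector_derivative)
qed simp

lemma smooth_on_affine:
  fixes c d :: real
  shows "smooth_on UNIV (\<lambda>x. c * x + d)"
proof -
  have "bounded_linear (\<lambda>x. c * x)" by (simp add: bounded_linear_mult_right)
  then show ?thesis
    by (intro smooth_on_add smooth_on_linear smooth_on_const) auto
qed

text \<open>The standard smooth step from 0 to 1 on the unit interval; \<open>x\<close> and
  \<open>1 - x\<close> are never both nonpositive, so the denominator stays positive.\<close>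

definition step :: "real \<Rightarrow> real" where
  "step x = flat x * inverse (flat x + flat (1 - x))"

lemma step_eq_0: "x \<le> 0 \<Longrightarrow> step x = 0"
  and step_eq_1: "x \<ge> 1 \<Longrightarrow> step x = 1"
  by (auto simp: step_def flat_def)

lemma smooth_on_step: "smooth_on UNIV step"
proof -
  have 1: "smooth_on UNIV (\<lambda>x. flat (1 - x))"
    using smooth_on_compose[OF _ _ _ smooth_on_affine[of "-1" 1] smooth_on_flat] by simp
  have "flat x + flat (1 - x) > 0" for x
    by (auto simp: flat_def add_pos_nonneg)
  then have "smooth_on UNIV (\<lambda>x. inverse (flat x + flat (1 - x)))"
    by (intro smooth_on_compose[OF _ _ _ _ smooth_on_inverse_real] smooth_on_add smooth_on_flat 1) auto
  then have "smooth_on UNIV (\<lambda>x. flat x * inverse (flat x + flat (1 - x)))"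
    by (intro smooth_on_mult smooth_on_flat) auto
  then show ?thesis
    unfolding step_def .
qed

section \<open>A smooth periodic function that coincides with the coordinate near 0\<close>

lemma smooth_on_cos: "smooth_on UNIV (cos :: real \<Rightarrow> real)"
proof (rule smooth_on_realI[where P = "\<lambda>f. \<exists>c d. f = (\<lambda>x. c * cos x + d * sin x)"])
  show "\<exists>c d. (cos :: real \<Rightarrow> real) = (\<lambda>x. c * cos x + d * sin x)"
    by (rule exI[of _ 1], rule exI[of _ 0]) auto
next
  fix f :: "real \<Rightarrow> real" assume "\<exists>c d. f = (\<lambda>x. c * cos x + d * sin x)"
  then obtain c d where f: "f = (\<lambda>x. c * cos x + d * sin x)" by blast
  have "(f has_real_derivative d * cos x + (- c) * sin x) (at x)" for x
    unfolding f by (auto intro!: derivative_eq_intros)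
  moreover have "\<exists>c' d'. (\<lambda>x. v *\<^sub>R (d * cos x + (- c) * sin x)) = (\<lambda>x. c' * cos x + d' * sin x)" for v
    by (rule exI[of _ "v * d"], rule exI[of _ "v * (- c)"]) (simp add: algebra_simps)
  ultimately show "\<exists>f'. (\<forall>x\<in>UNIV. (f has_vector_derivative f' x) (at x)) \<and>
      (\<forall>v. \<exists>c d. (\<lambda>x. v *\<^sub>R f' x) = (\<lambda>x. c * cos x + d * sin x))"
    by (intro exI[of _ "\<lambda>x. d * cos x + (- c) * sin x"]) (simp add: has_real_derivative_iff_has_vector_derivative)
qed simp

text \<open>\<open>arctan (tan t)\<close> is the sawtooth equal to t near 0, with jumps where cos t
  = 0. The cutoff vanishes for (cos t)^2 \<le> 1/4, which removes the jumps, and equals 1 for (cos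
  t)^2 \<ge> 1/2, which includes |t| \<le> pi/4.\<close>

definition kappa :: "real \<Rightarrow> real" where
  "kappa t = step (4 * (cos t)\<^sup>2 - 1) * arctan (tan t)"

text \<open>The sawtooth has slope 1 off its jumps, so affine expressions in it form a class stable
  under differentiation.\<close>

lemma smooth_on_arctan_tan: "smooth_on {t. cos t \<noteq> 0} (\<lambda>t. arctan (tan t))"
proof (rule smooth_on_realI[where P = "\<lambda>f. \<exists>c d. f = (\<lambda>t. c * arctan (tan t) + d)"])
  show "open {t::real. cos t \<noteq> 0}"
    by (intro open_Collect_neq continuous_intros)
  show "\<exists>c d. (\<lambda>t. arctan (tan t)) = (\<lambda>t. c * arctan (tan t) + d)"
    by (rule exI[of _ 1], rule exI[of _ 0]) auto
next
  fix f :: "real \<Rightarrow> real" assume "\<exists>c d. f = (\<lambda>t. c * arctan (tan t) + d)"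
  then obtain c d where f: "f = (\<lambda>t. c * arctan (tan t) + d)" by blast
  have "(f has_real_derivative c) (at t)" if "cos t \<noteq> 0" for t
  proof -
    have "inverse (1 + (tan t)\<^sup>2) * inverse ((cos t)\<^sup>2) = 1"
      using that by (simp add: tan_sec power_inverse)
    then show ?thesis
      unfolding f using that DERIV_chain2[OF DERIV_arctan DERIV_tan[OF that]]
      by (auto intro!: derivative_eq_intros)
  qed
  moreover have "\<exists>c' d'. (\<lambda>t. v *\<^sub>R c) = (\<lambda>t. c' * arctan (tan t) + d')" for v
    by (rule exI[of _ 0]) auto
  ultimately show "\<exists>f'. (\<forall>x\<in>{t. cos t \<noteq> 0}. (f has_vector_derivative f' x) (at x)) \<and>
      (\<forall>v. \<exists>c d. (\<lambda>x. v *\<^sub>R f' x) = (\<lambda>t. c * arctan (tan t) + d))"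
    by (intro exI[of _ "\<lambda>t. c"]) (simp add: has_real_derivative_iff_has_vector_derivative)
qed

lemma smooth_on_kappa: "smooth_on UNIV kappa"
proof (rule smooth_on_local)
  fix t :: real
  show "\<exists>T. open T \<and> t \<in> T \<and> smooth_on T kappa"
  proof (cases "cos t = 0")
    case False
    have 1: "smooth_on UNIV (\<lambda>t::real. cos t * cos t)"
      by (intro smooth_on_mult smooth_on_cos open_UNIV)
    have 2: "smooth_on UNIV (\<lambda>t::real. 4 * (cos t * cos t) + (-1))"
      by (rule smooth_on_compose[OF _ _ _ 1 smooth_on_affine[of 4 "-1"]]) auto
    have "smooth_on UNIV (\<lambda>t::real. step (4 * (cos t * cos t) + (-1)))"
      by (rule smooth_on_compose[OF _ _ _ 2 smooth_on_step]) auto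
    then have 3: "smooth_on {t. cos t \<noteq> 0} (\<lambda>t. step (4 * (cos t)\<^sup>2 - 1))"
      by (auto simp: power2_eq_square elim!: smooth_on_subset)
    have "open {t::real. cos t \<noteq> 0}"
      by (intro open_Collect_neq continuous_intros)
    from smooth_on_mult[OF this 3 smooth_on_arctan_tan] have "smooth_on {t. cos t \<noteq> 0} kappa"
      by (simp add: kappa_def[abs_def])
    then show ?thesis
      using False by (intro exI[of _ "{t. cos t \<noteq> 0}"]) (auto intro!: open_Collect_neq continuous_intros)
  next
    case True
    let ?T = "{t::real. (cos t)\<^sup>2 < 1/4}"
    have o: "open ?T"
      by (intro open_Collect_less continuous_intros)
    have "smooth_on ?T kappa \<longleftrightarrow> smooth_on ?T (\<lambda>t. 0 :: real)"
      by (rule smooth_on_cong[OF o]) (auto simp: kappa_def step_eq_0)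
    then show ?thesis
      using o True smooth_on_const[OF o, of "0::real"] by (intro exI[of _ ?T]) simp
  qed
qed

lemma kappa_periodic: "kappa (t + 2 * pi) = kappa t"
  by (simp add: kappa_def tan_def)

lemma kappa_eq:
  assumes "\<bar>t\<bar> \<le> pi / 4"
  shows "kappa t = t"
proof -
  have "cos (pi / 4) \<le> cos \<bar>t\<bar>"
    using assms by (intro cos_monotone_0_pi_le) auto
  then have "(sqrt 2 / 2)\<^sup>2 \<le> (cos t)\<^sup>2"
    by (intro power_mono) (auto simp: cos_45)
  then have "4 * (cos t)\<^sup>2 - 1 \<ge> 1"
    by (simp add: power_divide)
  moreover have "arctan (tan t) = t"
    using assms pi_gt_zero by (intro arctan_tan) linarith+
  ultimately show ?thesis
    by (simp add: kappa_def step_eq_1)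
qed

lemma periodic_of_int:
  fixes f :: "real \<Rightarrow> 'a"
  assumes "\<And>t. f (t + p) = f t"
  shows "f (t + of_int k * p) = f t"
proof -
  have n: "f (t + real n * p) = f t" for t n
  proof (induction n)
    case (Suc n)
    have "f (t + real (Suc n) * p) = f ((t + real n * p) + p)" by (simp add: algebra_simps)
    then show ?case using assms Suc by simp
  qed simp
  show ?thesis
  proof (cases k)
    case (nonneg n)
    then show ?thesis using n by simp
  next
    case (neg n)
    then have "real_of_int k = - real (Suc n)" by simp
    then have "(real_of_int k + real (Suc n)) * p = 0" by simp
    then have "t + of_int k * p + real (Suc n) * p = t" by (simp only: distrib_right)
    then show ?thesis using n[of "t + of_int k * p" "Suc n"] by metis
  qed
qed

lemma continuous_periodic_bounded:
  fixes f :: "real \<Rightarrow> 'a::real_normed_vector"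
  assumes "continuous_on UNIV f" "p > 0" "\<And>t. f (t + p) = f t"
  obtains B where "\<And>t. norm (f t) \<le> B"
proof -
  have "compact (f ` {0..p})"
    using assms(1) by (intro compact_continuous_image) (auto intro: continuous_on_subset)
  then obtain B where B: "\<And>t. t \<in> {0..p} \<Longrightarrow> norm (f t) \<le> B"
    using compact_imp_bounded[of "f ` {0..p}"] unfolding bounded_iff by blast
  have "norm (f t) \<le> B" for t
  proof -
    define k where "k = \<lfloor>t / p\<rfloor>"
    have "of_int k \<le> t / p" "t / p < of_int k + 1"
      unfolding k_def by linarith+
    then have "t + of_int (- k) * p \<in> {0..p}"
      using \<open>p > 0\<close> by (simp add: field_simps)
    then show ?thesis
      using B[of "t + of_int (- k) * p"] periodic_of_int[of f p t "- k"] assms(3) by simp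
  qed
  then show ?thesis using that by blast
qed

section \<open>Rapidly converging exponential series\<close>

text \<open>Termwise differentiation by the M-test: the derivatives are dominated on the whole
  space, and the tails of \<open>M\<close> give the uniform convergence.\<close>

lemma has_derivative_suminf:
  fixes f :: "nat \<Rightarrow> 'a::real_normed_vector \<Rightarrow> 'b::banach"
  assumes der: "\<And>n x. (f n has_derivative f' n x) (at x)"
    and M: "\<And>n x h. norm (f' n x h) \<le> M n * norm h" "summable M"
    and sf: "\<And>x. summable (\<lambda>n. f n x)"
  shows "((\<lambda>x. \<Sum>n. f n x) has_derivative (\<lambda>h. \<Sum>n. f' n x h)) (at x)"
proof -
  have s': "summable (\<lambda>n. f' n x h)" for x h
    by (rule summable_comparison_test[OF _ summable_mult2[OF M(2), of "norm h"]]) (use M(1) in auto)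
  have "\<exists>g. \<forall>x\<in>UNIV. (\<lambda>n. f n x) sums g x \<and> (g has_derivative (\<lambda>h. \<Sum>n. f' n x h)) (at x within UNIV)"
  proof (rule has_derivative_series[where l = "\<Sum>n. f n x" and x = x and f' = f'])
    show "(\<lambda>n. f n x) sums (\<Sum>n. f n x)"
      using sf by (rule summable_sums)
    fix e :: real assume "e > 0"
    then obtain N where N: "\<And>n. n \<ge> N \<Longrightarrow> norm (\<Sum>i. M (i + n)) < e"
      using suminf_exist_split[OF _ M(2)] by blast
    show "\<forall>\<^sub>F n in sequentially. \<forall>x\<in>UNIV. \<forall>h. norm ((\<Sum>i<n. f' i x h) - (\<Sum>n. f' n x h)) \<le> e * norm h"
      unfolding eventually_sequentially
    proof (intro exI[of _ N] allI impI ballI)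
      fix n x h assume n: "N \<le> n"
      have "(\<Sum>n. f' n x h) = (\<Sum>i. f' (i + n) x h) + (\<Sum>i<n. f' i x h)"
        by (rule suminf_split_initial_segment[OF s'])
      then have "norm ((\<Sum>i<n. f' i x h) - (\<Sum>n. f' n x h)) = norm (\<Sum>i. f' (i + n) x h)"
        by (simp add: norm_minus_commute)
      also have "\<dots> \<le> (\<Sum>i. M (i + n) * norm h)"
        using M summable_ignore_initial_segment[OF M(2), of n]
        by (intro norm_suminf_le summable_mult2) auto
      also have "\<dots> = (\<Sum>i. M (i + n)) * norm h"
        by (rule suminf_mult2[symmetric]) (use summable_ignore_initial_segment[OF M(2)] in auto)
      also have "\<dots> \<le> e * norm h"
        using N[OF n] by (intro mult_right_mono) auto
      finally show "norm ((\<Sum>i<n. f' i x h) - (\<Sum>n. f' n x h)) \<le> e * norm h" .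
    qed
  qed (use der in auto)
  then obtain g where g: "\<And>x. (\<lambda>n. f n x) sums g x" "\<And>x. (g has_derivative (\<lambda>h. \<Sum>n. f' n x h)) (at x)"
    by auto
  have "g = (\<lambda>x. \<Sum>n. f n x)"
    using g(1) sums_unique by blast
  with g(2) show ?thesis by simp
qed

text \<open>Decay faster than every power. The weight is a power of n + 1 rather than n, so that it
  never vanishes and weights of different orders are comparable at index 0 too.\<close>

definition rapid :: "(nat \<Rightarrow> complex) \<Rightarrow> bool" where
  "rapid a \<longleftrightarrow> (\<forall>N. \<exists>C. \<forall>n. norm (a n) * real (Suc n) ^ N \<le> C)"

lemma rapidI: "(\<And>N. \<exists>C. \<forall>n. norm (a n) * real (Suc n) ^ N \<le> C) \<Longrightarrow> rapid a"
  by (simp add: rapid_def)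

lemma summable_inverse_Suc_square: "summable (\<lambda>n. 1 / real (Suc n) ^ 2)"
  using summable_Suc_iff[of "\<lambda>n. 1 / real n ^ 2"] inverse_power_summable[of 2, where 'a = real]
  by (simp add: divide_inverse)

text \<open>Two spare powers of the weight pay for the convergent series of 1/(n+1)^2.\<close>

lemma rapid_summable:
  assumes "rapid a"
  shows "summable (\<lambda>n. norm (a n) * real (Suc n) ^ N)"
proof -
  obtain C where C: "\<And>n. norm (a n) * real (Suc n) ^ (N + 2) \<le> C"
    using assms unfolding rapid_def by blast
  have "norm (norm (a n) * real (Suc n) ^ N) \<le> C * (1 / real (Suc n) ^ 2)" for n
    using C[of n] by (simp add: field_simps power_add power2_eq_square del: of_nat_Suc)
  then show ?thesis
    by (intro summable_comparison_test[OF _ summable_mult[OF summable_inverse_Suc_square]]) auto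
qed

lemma rapid_summable_norm: "rapid a \<Longrightarrow> summable (\<lambda>n. norm (a n))"
  using rapid_summable[of a 0] by simp

lemma rapid_mult_index:
  assumes "rapid a"
  shows "rapid (\<lambda>n. c * of_nat n * a n)"
proof (rule rapidI)
  fix N
  obtain C where C: "\<And>n. norm (a n) * real (Suc n) ^ (Suc N) \<le> C"
    using assms unfolding rapid_def by blast
  have "norm (c * of_nat n * a n) * real (Suc n) ^ N \<le> norm c * C" for n
  proof -
    have "norm (c * of_nat n * a n) * real (Suc n) ^ N = norm c * (norm (a n) * (real n * real (Suc n) ^ N))"
      by (simp add: norm_mult)
    also have "\<dots> \<le> norm c * (norm (a n) * real (Suc n) ^ Suc N)"
      by (intro mult_left_mono) (auto intro!: mult_right_mono)
    also have "\<dots> \<le> norm c * C"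
      using C by (intro mult_left_mono) auto
    finally show ?thesis .
  qed
  then show "\<exists>C. \<forall>n. norm (c * of_nat n * a n) * real (Suc n) ^ N \<le> C" by blast
qed

lemma rapid_cmult: 
  assumes "rapid a"
  shows "rapid (\<lambda>n. c * a n)"
proof (rule rapidI)
  fix N
  obtain C where C: "\<And>n. norm (a n) * real (Suc n) ^ N \<le> C"
    using assms unfolding rapid_def by blast
  have "norm (c * a n) * real (Suc n) ^ N \<le> norm c * C" for n
    using mult_left_mono[OF C[of n], of "norm c"] by (simp add: norm_mult mult.assoc)
  then show "\<exists>C. \<forall>n. norm (c * a n) * real (Suc n) ^ N \<le> C" by blast
qed

lemma rapid_add:
  assumes "rapid a" "rapid b"
  shows "rapid (\<lambda>n. a n + b n)"
proof (rule rapidI)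
  fix N
  obtain C D where C: "\<And>n. norm (a n) * real (Suc n) ^ N \<le> C" "\<And>n. norm (b n) * real (Suc n) ^ N \<le> D"
    using assms unfolding rapid_def by meson
  have "norm (a n + b n) * real (Suc n) ^ N \<le> C + D" for n
  proof -
    have "norm (a n + b n) * real (Suc n) ^ N \<le> (norm (a n) + norm (b n)) * real (Suc n) ^ N"
      by (intro mult_right_mono norm_triangle_ineq) auto
    also have "\<dots> \<le> C + D"
      using C[of n] by (simp add: distrib_right)
    finally show ?thesis .
  qed
  then show "\<exists>C. \<forall>n. norm (a n + b n) * real (Suc n) ^ N \<le> C" by blast
qed

text \<open>
  Bounded smooth continuations of multiples of \<open>exp (- s)\<close> from \<open>s \<ge> 0\<close> to the line serve to extend
  the series below across the real axis. They form a class closed under differentiation.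
\<close>

definition exp_profile :: "real \<Rightarrow> (real \<Rightarrow> real) \<Rightarrow> bool" where
  "exp_profile c \<gamma> \<longleftrightarrow> smooth_on UNIV \<gamma> \<and> (\<forall>s\<ge>0. \<gamma> s = c * exp (- s)) \<and> (\<forall>s\<le>-1. \<gamma> s = 0)"

lemma exp_profile_bounded:
  assumes "exp_profile c \<gamma>"
  obtains B where "\<And>s. \<bar>\<gamma> s\<bar> \<le> B"
proof -
  have "compact (\<gamma> ` {-1..0})"
    using assms smooth_on_continuous by (intro compact_continuous_image)
      (auto simp: exp_profile_def intro: continuous_on_subset)
  then obtain B where B: "\<And>s. s \<in> {-1..0} \<Longrightarrow> \<bar>\<gamma> s\<bar> \<le> B"
    using compact_imp_bounded[of "\<gamma> ` {-1..0}"] unfolding bounded_iff real_norm_def by blast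
  have "\<bar>\<gamma> s\<bar> \<le> \<bar>B\<bar> + \<bar>c\<bar>" for s
  proof -
    consider "s \<le> -1" | "s \<in> {-1..0}" | "s \<ge> 0" by fastforce
    then show ?thesis
    proof cases
      case 3
      have "\<bar>c\<bar> * exp (- s) \<le> \<bar>c\<bar> * 1"
        using 3 by (intro mult_left_mono) auto
      then show ?thesis using assms 3 by (simp add: exp_profile_def abs_mult)
    next
      case 2
      then show ?thesis using B[of s] by simp
    qed (use assms in \<open>simp add: exp_profile_def\<close>)
  qed
  then show ?thesis using that by blast
qed

lemma exp_profile_has_derivative:
  "exp_profile c \<gamma> \<Longrightarrow> (\<gamma> has_real_derivative rderiv \<gamma> s) (at s)"
  unfolding exp_profile_def has_real_derivative_iff_has_vector_derivative
  using smooth_on_has_vector_derivative by blast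

text \<open>Differentiating c exp(-s) flips the sign of c. The formulas for the derivative hold on
  the open half lines by locality, and continuity carries them to the endpoints 0 and -1.\<close>

lemma exp_profile_rderiv:
  assumes "exp_profile c \<gamma>"
  shows "exp_profile (- c) (rderiv \<gamma>)"
proof -
  have sm: "smooth_on UNIV (rderiv \<gamma>)"
    using assms by (simp add: exp_profile_def smooth_on_frechet_derivative)
  then have ct: "continuous_on UNIV (rderiv \<gamma>)"
    by (rule smooth_on_continuous)
  have pos: "rderiv \<gamma> s = - c * exp (- s)" if "s > 0" for s
  proof -
    have "((\<lambda>s. c * exp (- s)) has_real_derivative - c * exp (- s)) (at s)"
      by (auto intro!: derivative_eq_intros)
    moreover have ev: "eventually (\<lambda>s. c * exp (- s) = \<gamma> s) (nhds s)"
      using eventually_nhds_in_open[of "{0<..}" s] that assms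
      by (auto elim!: eventually_mono simp: exp_profile_def)
    ultimately have "(\<gamma> has_real_derivative - c * exp (- s)) (at s)"
      using DERIV_cong_ev[OF refl ev refl] by simp
    then show ?thesis
      using DERIV_unique[OF exp_profile_has_derivative[OF assms]] by blast
  qed
  have neg: "rderiv \<gamma> s = 0" if "s < -1" for s
  proof -
    have ev: "eventually (\<lambda>s. 0 = \<gamma> s) (nhds s)"
      using eventually_nhds_in_open[of "{..<-1}" s] that assms
      by (auto elim!: eventually_mono simp: exp_profile_def)
    then have "(\<gamma> has_real_derivative 0) (at s)"
      using DERIV_cong_ev[OF refl ev refl, of 0] by simp
    then show ?thesis
      using DERIV_unique[OF exp_profile_has_derivative[OF assms]] by blast
  qed
  have ct': "continuous_on (closure {0<..}) (\<lambda>s. rderiv \<gamma> s - (- c * exp (- s)))"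
    by (intro continuous_intros continuous_on_subset[OF ct]) auto
  have "rderiv \<gamma> s - (- c * exp (- s)) = 0" if "s \<in> closure {0<..}" for s
    by (rule continuous_constant_on_closure[OF ct' _ that]) (use pos in auto)
  moreover have "rderiv \<gamma> s = 0" if "s \<in> closure {..<-1}" for s
    by (rule continuous_constant_on_closure[OF continuous_on_subset[OF ct] neg that]) auto
  ultimately show ?thesis
    using sm by (simp add: exp_profile_def eq_neg_iff_add_eq_0)
qed

definition cutoff_exp :: "real \<Rightarrow> real" where
  "cutoff_exp s = exp (- s) * step (s + 1)"

lemma exp_profile_cutoff_exp: "exp_profile 1 cutoff_exp"
proof -
  have e: "smooth_on UNIV (\<lambda>s::real. exp (- s))"
  proof (rule smooth_on_realI[where P = "\<lambda>f. \<exists>c. f = (\<lambda>s. c * exp (- s))"])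
    fix f :: "real \<Rightarrow> real" assume "\<exists>c. f = (\<lambda>s. c * exp (- s))"
    then obtain c where f: "f = (\<lambda>s. c * exp (- s))" by blast
    have "(f has_real_derivative - c * exp (- s)) (at s)" for s
      unfolding f by (auto intro!: derivative_eq_intros)
    moreover have "\<exists>c'. (\<lambda>s. v *\<^sub>R (- c * exp (- s))) = (\<lambda>s. c' * exp (- s))" for v
      by (rule exI[of _ "v * (- c)"]) (simp add: mult.assoc)
    ultimately show "\<exists>f'. (\<forall>x\<in>UNIV. (f has_vector_derivative f' x) (at x)) \<and>
        (\<forall>v. \<exists>c. (\<lambda>x. v *\<^sub>R f' x) = (\<lambda>s. c * exp (- s)))"
      by (intro exI[of _ "\<lambda>s. - c * exp (- s)"]) (simp add: has_real_derivative_iff_has_vector_derivative)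
  qed (auto intro: exI[of _ 1])
  have "smooth_on UNIV (\<lambda>s. step (1 * s + 1))"
    by (rule smooth_on_compose[OF _ _ _ smooth_on_affine smooth_on_step]) auto
  then have "smooth_on UNIV cutoff_exp"
    unfolding cutoff_exp_def by (intro smooth_on_mult e) auto
  then show ?thesis
    by (simp add: exp_profile_def cutoff_exp_def step_eq_0 step_eq_1)
qed

text \<open>
  On the closed upper half plane, \<open>exp_series cutoff_exp a\<close> is the power series \<open>\<Sum>n. a n * q ^ n\<close>
  at \<open>q = exp (\<i> * z)\<close>.
\<close>

definition exp_series :: "(real \<Rightarrow> real) \<Rightarrow> (nat \<Rightarrow> complex) \<Rightarrow> complex \<Rightarrow> complex" where
  "exp_series \<gamma> a z = (\<Sum>n. a n * (cis (real n * Re z) * of_real (\<gamma> (real n * Im z))))"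

lemma exp_series_summable:
  assumes "rapid a" "exp_profile c \<gamma>"
  shows "summable (\<lambda>n. a n * (cis (real n * Re z) * of_real (\<gamma> (real n * Im z))))"
proof -
  obtain B where B: "\<And>s. \<bar>\<gamma> s\<bar> \<le> B" using exp_profile_bounded[OF assms(2)] by blast
  show ?thesis
    by (rule summable_comparison_test[OF _ summable_mult2[OF rapid_summable_norm[OF assms(1)], of B]])
       (auto simp: norm_mult intro!: exI[of _ 0] mult_left_mono B)
qed

lemma cis_has_vector_derivative: "(cis has_vector_derivative \<i> * cis x) (at x)"
  unfolding has_vector_derivative_complex_iff
  by (auto intro!: derivative_eq_intros simp: has_real_derivative_iff_has_vector_derivative[symmetric])

text \<open>Horizontal differentiation multiplies the coefficients by i n and keeps the profile;
  vertical differentiation multiplies them by n and differentiates the profile. Both stay in the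
  class of such series because n times a rapid sequence is rapid. The factor \<open>1\<close> is
  there to match the shape of \<open>rapid_mult_index\<close>.\<close>

lemma exp_series_has_derivative:
  assumes a: "rapid a" and \<gamma>: "exp_profile c \<gamma>"
  shows "(exp_series \<gamma> a has_derivative
    (\<lambda>h. of_real (Re h) * exp_series \<gamma> (\<lambda>n. \<i> * of_nat n * a n) z +
         of_real (Im h) * exp_series (rderiv \<gamma>) (\<lambda>n. 1 * of_nat n * a n) z)) (at z)"
proof -
  obtain B where B: "\<And>s. \<bar>\<gamma> s\<bar> \<le> B" using exp_profile_bounded[OF \<gamma>] by blast
  obtain B' where B': "\<And>s. \<bar>rderiv \<gamma> s\<bar> \<le> B'" using exp_profile_bounded[OF exp_profile_rderiv[OF \<gamma>]] by blast
  let ?t1 = "\<lambda>z n. (\<i> * of_nat n * a n) * (cis (real n * Re z) * of_real (\<gamma> (real n * Im z)))"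
  let ?t2 = "\<lambda>z n. (1 * of_nat n * a n) * (cis (real n * Re z) * of_real (rderiv \<gamma> (real n * Im z)))"
  define f' where "f' = (\<lambda>n z h. of_real (Re h) * ?t1 z n + of_real (Im h) * ?t2 z n)"
  have "((\<lambda>z. \<Sum>n. a n * (cis (real n * Re z) * of_real (\<gamma> (real n * Im z)))) has_derivative (\<lambda>h. \<Sum>n. f' n z h)) (at z)"
  proof (rule has_derivative_suminf[where M = "\<lambda>n. norm (a n) * real (Suc n) ^ 1 * (B + B')"])
    fix n z
    have 1: "((\<lambda>z. cis (real n * Re z)) has_derivative (\<lambda>h. (real n * Re h) *\<^sub>R (\<i> * cis (real n * Re z)))) (at z)"
    proof -
      have "((\<lambda>z. real n * Re z) has_derivative (\<lambda>h. real n * Re h)) (at z)"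
        by (intro derivative_intros bounded_linear_Re)
      from has_derivative_compose[OF this cis_has_vector_derivative[unfolded has_vector_derivative_def]]
      show ?thesis .
    qed
    have 2: "((\<lambda>z. complex_of_real (\<gamma> (real n * Im z))) has_derivative
        (\<lambda>h. of_real (rderiv \<gamma> (real n * Im z) * (real n * Im h)))) (at z)"
    proof -
      have "((\<lambda>z. real n * Im z) has_derivative (\<lambda>h. real n * Im h)) (at z)"
        by (intro derivative_intros bounded_linear_Im)
      from has_derivative_of_real[OF has_derivative_compose[OF this exp_profile_has_derivative[OF \<gamma>, unfolded has_field_derivative_def]]]
      show ?thesis .
    qed
    have "((\<lambda>z. a n * (cis (real n * Re z) * of_real (\<gamma> (real n * Im z)))) has_derivative
       (\<lambda>h. a n * (cis (real n * Re z) * of_real (rderiv \<gamma> (real n * Im z) * (real n * Im h)) +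
          (real n * Re h) *\<^sub>R (\<i> * cis (real n * Re z)) * of_real (\<gamma> (real n * Im z))))) (at z)"
      by (intro has_derivative_mult_right has_derivative_mult 1 2)
    then show "((\<lambda>z. a n * (cis (real n * Re z) * of_real (\<gamma> (real n * Im z)))) has_derivative f' n z) (at z)"
      by (rule has_derivative_eq_rhs) (auto simp: f'_def scaleR_conv_of_real algebra_simps)
  next
    fix n z h
    have "norm (f' n z h) \<le> norm (of_real (Re h) * ?t1 z n) + norm (of_real (Im h) * ?t2 z n)"
      unfolding f'_def by (rule norm_triangle_ineq)
    also have "\<dots> = (real n * norm (a n)) * (\<bar>Re h\<bar> * \<bar>\<gamma> (real n * Im z)\<bar> + \<bar>Im h\<bar> * \<bar>rderiv \<gamma> (real n * Im z)\<bar>)"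
      by (simp add: norm_mult algebra_simps)
    also have "\<dots> \<le> (real (Suc n) * norm (a n)) * (norm h * B + norm h * B')"
      using B B' abs_Re_le_cmod[of h] abs_Im_le_cmod[of h]
      by (intro mult_mono add_mono) (auto intro: order_trans[OF abs_ge_zero])
    finally show "norm (f' n z h) \<le> norm (a n) * real (Suc n) ^ 1 * (B + B') * norm h"
      by (simp add: algebra_simps)
  next
    show "summable (\<lambda>n. norm (a n) * real (Suc n) ^ 1 * (B + B'))"
      by (intro summable_mult2 rapid_summable a)
  qed (use exp_series_summable[OF a \<gamma>] in auto)
  moreover have "(\<Sum>n. f' n z h) = of_real (Re h) * exp_series \<gamma> (\<lambda>n. \<i> * of_nat n * a n) z +
         of_real (Im h) * exp_series (rderiv \<gamma>) (\<lambda>n. 1 * of_nat n * a n) z" for h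
  proof -
    have s1: "summable (?t1 z)" and s2: "summable (?t2 z)"
      by (rule exp_series_summable[OF rapid_mult_index[OF a] \<gamma>],
          rule exp_series_summable[OF rapid_mult_index[OF a] exp_profile_rderiv[OF \<gamma>]])
    show ?thesis
      unfolding f'_def exp_series_def suminf_add[OF summable_mult[OF s1] summable_mult[OF s2], symmetric]
        suminf_mult[OF s1] suminf_mult[OF s2] ..
  qed
  moreover have "exp_series \<gamma> a = (\<lambda>z. \<Sum>n. a n * (cis (real n * Re z) * of_real (\<gamma> (real n * Im z))))"
    by (rule ext) (rule exp_series_def)
  ultimately show ?thesis by simp
qed

lemma smooth_on_exp_series:
  assumes "rapid a" "exp_profile c \<gamma>"
  shows "smooth_on UNIV (exp_series \<gamma> a)"
proof -
  have "Ck_on k UNIV (exp_series \<gamma> a)" for k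
    using assms
  proof (induction k arbitrary: a \<gamma> c)
    case 0
    then show ?case
      using exp_series_has_derivative has_derivative_continuous
      by (force intro!: continuous_at_imp_continuous_on)
  next
    case (Suc k)
    show ?case
    proof (rule Ck_on_SucI[OF open_UNIV exp_series_has_derivative[OF Suc.prems]])
      fix v
      have "Ck_on k UNIV (exp_series \<gamma> (\<lambda>n. \<i> * of_nat n * a n))"
        "Ck_on k UNIV (exp_series (rderiv \<gamma>) (\<lambda>n. 1 * of_nat n * a n))"
        by (rule Suc.IH[OF rapid_mult_index[OF Suc.prems(1)] Suc.prems(2)],
            rule Suc.IH[OF rapid_mult_index[OF Suc.prems(1)] exp_profile_rderiv[OF Suc.prems(2)]])
      then show "Ck_on k UNIV (\<lambda>z. of_real (Re v) * exp_series \<gamma> (\<lambda>n. \<i> * of_nat n * a n) z +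
         of_real (Im v) * exp_series (rderiv \<gamma>) (\<lambda>n. 1 * of_nat n * a n) z)"
        by (intro Ck_on_add Ck_on_mult Ck_on_const open_UNIV)
    qed
  qed
  then show ?thesis by (rule smooth_onI)
qed

text \<open>For Im z \<ge> 0 the derivative of the profile is its negative, so the vertical
  derivative is i times the horizontal one: the Cauchy-Riemann equation. At real points this is a
  full derivative of the extended series, although the extension need not be holomorphic below the
  axis.\<close>

lemma exp_series_has_field_derivative:
  assumes "rapid a" "Im z \<ge> 0"
  shows "(exp_series cutoff_exp a has_field_derivative exp_series cutoff_exp (\<lambda>n. \<i> * of_nat n * a n) z) (at z)"
proof -
  have e: "exp_series (rderiv cutoff_exp) (\<lambda>n. 1 * of_nat n * a n) z =
      \<i> * exp_series cutoff_exp (\<lambda>n. \<i> * of_nat n * a n) z"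
  proof -
    have "rderiv cutoff_exp (real n * Im z) = - cutoff_exp (real n * Im z)" for n
      using exp_profile_rderiv[OF exp_profile_cutoff_exp] exp_profile_cutoff_exp assms(2)
      by (simp add: exp_profile_def)
    then have "exp_series (rderiv cutoff_exp) (\<lambda>n. 1 * of_nat n * a n) z =
      (\<Sum>n. \<i> * (\<i> * of_nat n * a n * (cis (real n * Re z) * of_real (cutoff_exp (real n * Im z)))))"
      by (simp add: exp_series_def mult.assoc[symmetric])
    also have "\<dots> = \<i> * exp_series cutoff_exp (\<lambda>n. \<i> * of_nat n * a n) z"
      unfolding exp_series_def
      by (rule suminf_mult[OF exp_series_summable[OF rapid_mult_index[OF assms(1)] exp_profile_cutoff_exp]])
    finally show ?thesis .
  qed
  have "(exp_series cutoff_exp a has_derivative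
    (\<lambda>h. of_real (Re h) * exp_series cutoff_exp (\<lambda>n. \<i> * of_nat n * a n) z +
         of_real (Im h) * (\<i> * exp_series cutoff_exp (\<lambda>n. \<i> * of_nat n * a n) z))) (at z)"
    using exp_series_has_derivative[OF assms(1) exp_profile_cutoff_exp, of z] e by simp
  moreover have "of_real (Re h) * w + of_real (Im h) * (\<i> * w) = w * h" for h w
    by (simp add: complex_eq_iff algebra_simps)
  ultimately show ?thesis
    by (simp add: has_field_derivative_def)
qed

section \<open>Fourier coefficients\<close>

definition mean :: "(real \<Rightarrow> complex) \<Rightarrow> complex" where
  "mean f = integral {0..2 * pi} f / (2 * pi)"

lemma continuous_imp_integrable:
  fixes f :: "real \<Rightarrow> 'a::euclidean_space"
  shows "continuous_on UNIV f \<Longrightarrow> f integrable_on {a..b}"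
  by (rule integrable_continuous_interval) (rule continuous_on_subset, auto)

lemma mean_add: "continuous_on UNIV f \<Longrightarrow> continuous_on UNIV g \<Longrightarrow> mean (\<lambda>t. f t + g t) = mean f + mean g"
  by (simp add: mean_def integral_add continuous_imp_integrable add_divide_distrib)

lemma mean_diff: "continuous_on UNIV f \<Longrightarrow> continuous_on UNIV g \<Longrightarrow> mean (\<lambda>t. f t - g t) = mean f - mean g"
  by (simp add: mean_def integral_diff continuous_imp_integrable diff_divide_distrib)

lemma mean_cmult: "mean (\<lambda>t. c * f t) = c * mean f"
  by (simp add: mean_def)

lemma mean_const: "mean (\<lambda>t. c) = c"
  by (simp add: mean_def scaleR_conv_of_real)

lemma mean_bound:
  assumes "continuous_on UNIV f" "\<And>t. norm (f t) \<le> B"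
  shows "norm (mean f) \<le> B"
proof -
  have "norm (integral {0..2 * pi} f) \<le> B * (2 * pi - 0)"
    by (rule integral_bound) (use assms in \<open>auto intro: continuous_on_subset\<close>)
  then show ?thesis
    by (simp add: mean_def norm_divide field_simps)
qed

lemma mean_derivative:
  assumes "\<And>t. (F has_vector_derivative F' t) (at t)" "F (2 * pi) = F 0"
  shows "mean F' = 0"
proof -
  have "(F' has_integral F (2 * pi) - F 0) {0..2 * pi}"
    by (rule fundamental_theorem_of_calculus) (auto intro: has_vector_derivative_at_within assms(1))
  then show ?thesis
    using assms(2) by (simp add: mean_def integral_unique)
qed

lemma continuous_on_suminf:
  fixes g :: "nat \<Rightarrow> real \<Rightarrow> complex"
  assumes "\<And>j. continuous_on UNIV (g j)" "\<And>j t. norm (g j t) \<le> M j" "summable M"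
  shows "continuous_on UNIV (\<lambda>t. \<Sum>j. g j t)"
proof -
  have "uniform_limit UNIV (\<lambda>n t. \<Sum>j<n. g j t) (\<lambda>t. \<Sum>j. g j t) sequentially"
    by (rule Weierstrass_m_test) (use assms in auto)
  then show ?thesis
    by (rule uniform_limit_theorem[rotated]) (auto intro!: always_eventually continuous_intros assms(1))
qed

text \<open>The tails of \<open>M\<close> bound the tails of the series uniformly in t, hence also
  their means.\<close>

lemma mean_suminf:
  fixes g :: "nat \<Rightarrow> real \<Rightarrow> complex"
  assumes g: "\<And>j. continuous_on UNIV (g j)" "\<And>j t. norm (g j t) \<le> M j" "summable M"
  shows "(\<lambda>j. mean (g j)) sums mean (\<lambda>t. \<Sum>j. g j t)"
proof -
  have s: "summable (\<lambda>j. g j t)" for t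
    by (rule summable_comparison_test[OF _ g(3)]) (use g(2) in auto)
  have b: "norm (mean (\<lambda>t. \<Sum>j. g j t) - (\<Sum>j<n. mean (g j))) \<le> (\<Sum>j. M (j + n))" for n
  proof -
    have "(\<Sum>j<n. mean (g j)) = mean (\<lambda>t. \<Sum>j<n. g j t)"
    proof (induction n)
      case (Suc n)
      then show ?case
        by (simp add: mean_add g(1) continuous_on_sum)
    qed (simp add: mean_const)
    moreover have "mean (\<lambda>t. \<Sum>j. g j t) - mean (\<lambda>t. \<Sum>j<n. g j t) = mean (\<lambda>t. (\<Sum>j. g j t) - (\<Sum>j<n. g j t))"
      by (intro mean_diff[symmetric] continuous_on_suminf[OF g] continuous_on_sum g(1))
    moreover have "norm (mean (\<lambda>t. (\<Sum>j. g j t) - (\<Sum>j<n. g j t))) \<le> (\<Sum>j. M (j + n))"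
    proof (rule mean_bound)
      show "continuous_on UNIV (\<lambda>t. (\<Sum>j. g j t) - (\<Sum>j<n. g j t))"
        by (intro continuous_on_diff continuous_on_suminf[OF g] continuous_on_sum g(1))
      show "norm ((\<Sum>j. g j t) - (\<Sum>j<n. g j t)) \<le> (\<Sum>j. M (j + n))" for t
        unfolding suminf_minus_initial_segment[OF s, symmetric]
        by (rule norm_suminf_le) (use g(2) g(3) in \<open>auto simp: summable_iff_shift\<close>)
    qed
    ultimately show ?thesis by simp
  qed
  have "(\<lambda>n. mean (\<lambda>t. \<Sum>j. g j t) - (\<Sum>j<n. mean (g j))) \<longlonglongrightarrow> 0"
    by (rule Lim_null_comparison[OF _ suminf_exist_split2[OF g(3)]]) (intro always_eventually allI b)
  from tendsto_diff[OF tendsto_const this, of "mean (\<lambda>t. \<Sum>j. g j t)"]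
  have "(\<lambda>n. \<Sum>j<n. mean (g j)) \<longlonglongrightarrow> mean (\<lambda>t. \<Sum>j. g j t)"
    by simp
  then show ?thesis by (simp add: sums_def)
qed

section \<open>Orthogonality and uniqueness of Fourier coefficients\<close>

lemma continuous_on_cis [continuous_intros]:
  "continuous_on S f \<Longrightarrow> continuous_on S (\<lambda>t. cis (f t))"
  unfolding cis_conv_exp by (intro continuous_intros)

lemma cis_2pi_int [simp]: "cis (2 * pi * of_int k) = 1"
  by (simp add: cis_multiple_2pi)

lemma mean_cis:
  assumes "k \<noteq> 0"
  shows "mean (\<lambda>t. cis (of_int k * t)) = 0"
proof -
  have "((\<lambda>t. cis (of_int k * t) / (\<i> * of_int k)) has_vector_derivative cis (of_int k * t)) (at t)" for t
  proof -
    have "((\<lambda>t. cis (of_int k * t)) has_vector_derivative of_int k *\<^sub>R (\<i> * cis (of_int k * t))) (at t)"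
      using vector_diff_chain_at[of "\<lambda>t. of_int k * t" "of_int k" t cis "\<i> * cis (of_int k * t)"]
        cis_has_vector_derivative[of "of_int k * t"]
      by (simp add: o_def has_real_derivative_iff_has_vector_derivative[symmetric] DERIV_cmult_Id)
    from has_vector_derivative_divide[OF this, of "\<i> * of_int k"] show ?thesis
      using assms by (simp add: scaleR_conv_of_real)
  qed
  then show ?thesis
    by (rule mean_derivative) (use cis_2pi_int[of k] in \<open>simp add: mult.commute\<close>)
qed

lemma periodic_cis_cong:
  assumes "\<And>t. f (t + 2 * pi) = f t" "cis x = cis y"
  shows "f x = (f y :: 'a)"
proof -
  have "sin x = sin y \<and> cos x = cos y"
    using assms(2) by (simp add: complex_eq_iff)
  then obtain n where "x = y + 2 * pi * of_int n"
    unfolding sin_cos_eq_iff by blast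
  then show ?thesis
    using periodic_of_int[of f "2 * pi" y n] assms(1) by (simp add: mult.commute)
qed

text \<open>The factorization is f o Arg. On the negative half line, where \<open>Arg\<close> jumps,
  periodicity permits replacing Arg z by Arg(-z) + pi, which is continuous there.\<close>

lemma periodic_on_circle:
  fixes f :: "real \<Rightarrow> 'a::topological_space"
  assumes "continuous_on UNIV f" "\<And>t. f (t + 2 * pi) = f t"
  obtains F where "continuous_on (sphere 0 1) F" "\<And>t. F (cis t) = f t"
proof
  let ?F = "\<lambda>z. f (Arg z)"
  have cf: "isCont f t" for t
    using assms(1) by (simp add: continuous_on_eq_continuous_at)
  have eq: "f (Arg (- z) + pi) = f (Arg z)" if "norm z = 1" for z
  proof (rule periodic_cis_cong[of f, OF assms(2)])
    have "z \<noteq> 0" "sgn z = z" "sgn (- z) = - z"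
      using that by (auto simp: sgn_eq)
    then have "cis (Arg z) = z" "cis (Arg (- z)) = - z"
      using cis_Arg[of z] cis_Arg[of "- z"] by simp_all
    then show "cis (Arg (- z) + pi) = cis (Arg z)"
      using cis_mult[of "Arg (- z)" pi] by simp
  qed
  show "continuous_on (sphere 0 1) ?F"
  proof (unfold continuous_on_eq_continuous_within, intro ballI)
    fix z :: complex assume "z \<in> sphere 0 1"
    then have z: "norm z = 1" by simp
    show "continuous (at z within sphere 0 1) ?F"
    proof (cases "z \<in> \<real>\<^sub>\<le>\<^sub>0")
      case False
      then have "isCont ?F z"
        using continuous_within_compose3[OF cf continuous_at_Arg] by blast
      then show ?thesis by (rule continuous_at_imp_continuous_at_within)
    next
      case True
      then have "- z \<notin> \<real>\<^sub>\<le>\<^sub>0"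
        using z by (auto simp: complex_nonpos_Reals_iff complex_is_Real_iff cmod_def)
      then have "isCont (\<lambda>z. Arg (- z) + pi) z"
        by (intro continuous_intros continuous_within_compose3[OF continuous_at_Arg]) auto
      then have "isCont (\<lambda>z. f (Arg (- z) + pi)) z"
        using continuous_within_compose3[OF cf] by blast
      then have "continuous (at z within sphere 0 1) (\<lambda>z. f (Arg (- z) + pi))"
        by (rule continuous_at_imp_continuous_at_within)
      then show ?thesis
        by (rule continuous_transform_within[OF _ zero_less_one]) (use z eq in auto)
    qed
  qed
  show "?F (cis t) = f t" for t
    by (rule periodic_cis_cong[of f, OF assms(2)]) (simp add: cis_Arg sgn_eq)
qed

lemma continuous_on_real_polynomial_circle:
  assumes "real_polynomial_function q"
  shows "continuous_on UNIV (\<lambda>t. complex_of_real (q (cis t)))"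
proof -
  have "continuous_on UNIV q"
    using assms by (simp add: continuous_on_polymonial_function real_polynomial_function_eq)
  then have "continuous_on UNIV (\<lambda>t. q (cis t))"
    by (rule continuous_on_compose2) (auto intro!: continuous_intros)
  then show ?thesis
    by (rule continuous_on_of_real)
qed

text \<open>On the circle a real linear function is a combination of exp(it) and exp(-it), so
  multiplying by it shifts frequencies by one. Letting \<open>f\<close> vary in the induction
  handles products: \<open>f\<close> times the first factor again has only vanishing
  coefficients.\<close>

lemma fourier_vanish_mult_polynomial:
  assumes "real_polynomial_function q" "continuous_on UNIV f" "\<And>n::int. mean (\<lambda>t. f t * cis (of_int n * t)) = 0"
  shows "mean (\<lambda>t. f t * of_real (q (cis t)) * cis (of_int n * t)) = 0"
  using assms
proof (induction q arbitrary: f n rule: real_polynomial_function.induct)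
  case (linear q)
  have q: "q (cis t) = cos t * q 1 + sin t * q \<i>" for t
  proof -
    have "cis t = cos t *\<^sub>R 1 + sin t *\<^sub>R \<i>"
      by (simp add: complex_eq_iff)
    moreover have "linear q"
      using linear(1) by (rule bounded_linear.linear)
    ultimately show ?thesis
      by (simp only: linear_add linear_cmul real_scaleR_def)
  qed
  then have e: "of_real (q (cis t)) * cis (of_int n * t) =
      (of_real (q 1) - \<i> * of_real (q \<i>)) / 2 * cis (of_int (n + 1) * t) +
      (of_real (q 1) + \<i> * of_real (q \<i>)) / 2 * cis (of_int (n - 1) * t)" for t
  proof -
    have c1: "cis (of_int (n + 1) * t) = cis (of_int n * t) * cis t"
      "cis (of_int (n - 1) * t) = cis (of_int n * t) * cis (- t)"
      by (simp_all add: cis_mult algebra_simps)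
    have c2: "complex_of_real (cos t) = (cis t + cis (- t)) / 2"
      "complex_of_real (sin t) = - \<i> * (cis t - cis (- t)) / 2"
      by (simp_all add: complex_eq_iff)
    show ?thesis
      unfolding q of_real_add of_real_mult c1 c2 by (simp add: field_simps)
  qed
  have E: "(\<lambda>t. f t * of_real (q (cis t)) * cis (of_int n * t)) = (\<lambda>t.
      (of_real (q 1) - \<i> * of_real (q \<i>)) / 2 * (f t * cis (of_int (n + 1) * t)) +
      (of_real (q 1) + \<i> * of_real (q \<i>)) / 2 * (f t * cis (of_int (n - 1) * t)))"
    by (rule ext) (simp only: mult.assoc e, simp add: algebra_simps)
  show ?case
    unfolding E
    by (subst mean_add) (intro continuous_intros linear.prems | simp only: mean_cmult linear.prems mult_zero_right add_0_left)+
next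
  case (const c)
  have "mean (\<lambda>t. of_real c * (f t * cis (of_int n * t))) = 0"
    unfolding mean_cmult using const by simp
  then show ?case by (simp add: mult_ac)
next
  case (add p q)
  note c = continuous_on_real_polynomial_circle
  show ?case
    unfolding of_real_add distrib_left distrib_right
    using add c[OF add.hyps(1)] c[OF add.hyps(2)]
    by (subst mean_add) (auto intro!: continuous_intros)
next
  case (mult p q)
  note c = continuous_on_real_polynomial_circle
  have "mean (\<lambda>t. (f t * of_real (p (cis t))) * of_real (q (cis t)) * cis (of_int n * t)) = 0"
    by (intro mult.IH continuous_on_mult mult.prems c mult.hyps)
  then show ?case by (simp add: mult_ac)
qed

text \<open>Polynomials are dense in the continuous functions on the circle, so f is orthogonal to
  every continuous periodic real function, in particular to its own real and imaginary parts; thus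
  the mean of |f|^2 vanishes.\<close>

theorem fourier_unique:
  assumes f: "continuous_on UNIV f" "\<And>t. f (t + 2 * pi) = f t"
    and z: "\<And>n::int. mean (\<lambda>t. f t * cis (of_int n * t)) = 0"
  shows "f t = 0"
proof -
  obtain B where B: "\<And>t. norm (f t) \<le> B"
    using continuous_periodic_bounded[OF f(1) _ f(2)] by auto
  have *: "mean (\<lambda>t. f t * of_real (g t)) = 0" if g: "continuous_on UNIV g" "\<And>t. g (t + 2 * pi) = g t" for g
  proof -
    obtain G where G: "continuous_on (sphere 0 1) G" "\<And>t. G (cis t) = g t"
      using periodic_on_circle[OF g] by blast
    have "norm (mean (\<lambda>t. f t * of_real (g t))) \<le> B * e" if "e > 0" for e
    proof -
      obtain q where q: "real_polynomial_function q" "\<And>z. z \<in> sphere 0 1 \<Longrightarrow> \<bar>G z - q z\<bar> < e"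
        using Stone_Weierstrass_real_polynomial_function[OF compact_sphere G(1) \<open>e > 0\<close>] by blast
      have c: "continuous_on UNIV (\<lambda>t. f t * of_real (q (cis t)))"
        by (intro continuous_on_mult f(1) continuous_on_real_polynomial_circle q(1))
      have c': "continuous_on UNIV (\<lambda>t. f t * of_real (g t))"
        by (intro continuous_intros f(1) g(1))
      have "mean (\<lambda>t. f t * of_real (q (cis t))) = 0"
        using fourier_vanish_mult_polynomial[OF q(1) f(1) z, of 0] by simp
      then have "mean (\<lambda>t. f t * of_real (g t)) = mean (\<lambda>t. f t * of_real (g t) - f t * of_real (q (cis t)))"
        by (simp add: mean_diff[OF c' c])
      also have "norm \<dots> \<le> B * e"
      proof (rule mean_bound)
        show "continuous_on UNIV (\<lambda>t. f t * of_real (g t) - f t * of_real (q (cis t)))"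
          by (intro continuous_on_diff c c')
        fix t
        have "norm (f t * of_real (g t) - f t * of_real (q (cis t))) = norm (f t) * \<bar>g t - q (cis t)\<bar>"
          by (metis norm_mult norm_of_real of_real_diff right_diff_distrib)
        also have "\<dots> \<le> B * e"
          using B[of t] q(2)[of "cis t"] G(2)[of t] by (intro mult_mono) (auto intro: order_trans[OF norm_ge_zero])
        finally show "norm (f t * of_real (g t) - f t * of_real (q (cis t))) \<le> B * e" .
      qed
      finally show ?thesis .
    qed
    moreover have "((\<lambda>e. B * e) \<longlongrightarrow> 0) (at_right 0)"
      by (auto intro!: tendsto_eq_intros)
    ultimately have "norm (mean (\<lambda>t. f t * of_real (g t))) \<le> 0"
      by (intro tendsto_lowerbound[of "\<lambda>e. B * e" 0 "at_right 0"]) (auto simp: eventually_at_filter)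
    then show ?thesis by simp
  qed
  have "mean (\<lambda>t. f t * of_real (Re (f t))) = 0" "mean (\<lambda>t. f t * of_real (Im (f t))) = 0"
    by (intro * continuous_intros f(1); simp add: f(2))+
  moreover have "(\<lambda>t. complex_of_real ((norm (f t))\<^sup>2)) = (\<lambda>t. f t * of_real (Re (f t)) - \<i> * (f t * of_real (Im (f t))))"
    by (auto simp: complex_eq_iff cmod_power2 power2_eq_square[symmetric] algebra_simps)
  ultimately have "mean (\<lambda>t. complex_of_real ((norm (f t))\<^sup>2)) = 0"
    by (simp add: mean_diff mean_cmult continuous_intros f(1))
  then have "integral {0..2 * pi} (\<lambda>t. complex_of_real ((norm (f t))\<^sup>2)) = 0"
    by (simp add: mean_def)
  moreover have "integral {0..2 * pi} (complex_of_real \<circ> (\<lambda>t. (norm (f t))\<^sup>2)) =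
      of_real (integral {0..2 * pi} (\<lambda>t. (norm (f t))\<^sup>2))"
    by (intro integral_linear continuous_imp_integrable continuous_intros f(1) bounded_linear_of_real)
  ultimately have "integral {0..2 * pi} (\<lambda>t. (norm (f t))\<^sup>2) = 0"
    by (simp add: o_def)
  then have 0: "\<forall>t\<in>{0..2 * pi}. (norm (f t))\<^sup>2 = 0"
    by (subst (asm) integral_eq_0_iff) (auto intro!: continuous_intros continuous_on_subset[OF f(1)])
  define k where "k = \<lfloor>t / (2 * pi)\<rfloor>"
  have "of_int k \<le> t / (2 * pi)" "t / (2 * pi) < of_int k + 1"
    unfolding k_def by linarith+
  then have "t + of_int (- k) * (2 * pi) \<in> {0..2 * pi}"
    by (simp add: field_simps)
  then have "f (t + of_int (- k) * (2 * pi)) = 0"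
    using 0 by fastforce
  then show ?thesis
    using periodic_of_int[of f "2 * pi" t "- k"] f(2) by simp
qed

section \<open>Non-stationary phase\<close>

definition uniform_C0 :: "'i set \<Rightarrow> ('i \<Rightarrow> real \<Rightarrow> complex) \<Rightarrow> bool" where
  "uniform_C0 I F \<longleftrightarrow> (\<forall>i\<in>I. continuous_on UNIV (F i) \<and> (\<forall>t. F i (t + 2 * pi) = F i t)) \<and>
     (\<exists>B. \<forall>i\<in>I. \<forall>t. norm (F i t) \<le> B)"

text \<open>Bounds on derivatives up to order k that are uniform in the index; they keep the
  constants of the oscillatory estimates independent of parameters. The derivative family is
  existentially quantified, so that closed formulas can serve as witnesses.\<close>

primrec uniform_Ck :: "nat \<Rightarrow> 'i set \<Rightarrow> ('i \<Rightarrow> real \<Rightarrow> complex) \<Rightarrow> bool" where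
  "uniform_Ck 0 I F \<longleftrightarrow> uniform_C0 I F"
| "uniform_Ck (Suc k) I F \<longleftrightarrow> uniform_C0 I F \<and>
     (\<exists>F'. (\<forall>i\<in>I. \<forall>t. (F i has_vector_derivative F' i t) (at t)) \<and> uniform_Ck k I F')"

lemma uniform_Ck_Suc_iff:
  "uniform_Ck (Suc k) I F \<longleftrightarrow> uniform_Ck 0 I F \<and>
     (\<exists>F'. (\<forall>i\<in>I. \<forall>t. (F i has_vector_derivative F' i t) (at t)) \<and> uniform_Ck k I F')"
  by (simp add: uniform_C0_def)

declare uniform_Ck.simps [simp del]
lemmas uniform_Ck_0_iff [simp] = uniform_Ck.simps(1)[unfolded uniform_C0_def]

lemma uniform_Ck_0: "uniform_Ck k I F \<Longrightarrow> uniform_Ck 0 I F"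
  by (cases k) (simp_all only: uniform_Ck_Suc_iff)

lemma uniform_Ck_Suc: "uniform_Ck (Suc k) I F \<Longrightarrow> uniform_Ck k I F"
proof (induction k arbitrary: F)
  case (Suc k)
  then obtain F' where "\<forall>i\<in>I. \<forall>t. (F i has_vector_derivative F' i t) (at t)" "uniform_Ck (Suc k) I F'"
    unfolding uniform_Ck_Suc_iff[of "Suc k"] by blast
  then show ?case
    using Suc.IH Suc.prems unfolding uniform_Ck_Suc_iff[of k] uniform_Ck_Suc_iff[of "Suc k"] by blast
qed (simp only: uniform_Ck_Suc_iff)

lemma uniform_Ck_SucD:
  "uniform_Ck (Suc k) I F \<Longrightarrow> \<exists>F'. (\<forall>i\<in>I. \<forall>t. (F i has_vector_derivative F' i t) (at t)) \<and> uniform_Ck k I F'"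
  unfolding uniform_Ck_Suc_iff by blast

lemma uniform_Ck_SucI:
  assumes "uniform_Ck 0 I F" "\<And>i t. i \<in> I \<Longrightarrow> (F i has_vector_derivative F' i t) (at t)" "uniform_Ck k I F'"
  shows "uniform_Ck (Suc k) I F"
  using assms unfolding uniform_Ck_Suc_iff by blast

lemma uniform_Ck_periodic: "uniform_Ck k I F \<Longrightarrow> i \<in> I \<Longrightarrow> F i (t + 2 * pi) = F i t"
  using uniform_Ck_0[of k I F] unfolding uniform_Ck_0_iff by blast

lemma uniform_Ck_continuous: "uniform_Ck k I F \<Longrightarrow> i \<in> I \<Longrightarrow> continuous_on UNIV (F i)"
  using uniform_Ck_0[of k I F] unfolding uniform_Ck_0_iff by blast

lemma uniform_Ck_const: "uniform_Ck k I (\<lambda>i t. c)"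
proof (induction k arbitrary: c)
  case (0 c)
  show ?case by (auto intro: exI[of _ "norm c"])
next
  case (Suc k c)
  show ?case
    by (rule uniform_Ck_SucI[where F' = "\<lambda>i t. 0"]) (use Suc in \<open>auto intro: exI[of _ "norm c"]\<close>)
qed

lemma uniform_Ck_param: "(\<And>i. i \<in> I \<Longrightarrow> norm (c i) \<le> B) \<Longrightarrow> uniform_Ck k I (\<lambda>i t. c i)"
proof (cases k)
  case (Suc l)
  assume "\<And>i. i \<in> I \<Longrightarrow> norm (c i) \<le> B"
  then show ?thesis
    unfolding Suc by (intro uniform_Ck_SucI[where F' = "\<lambda>i t. 0"] uniform_Ck_const) auto
qed auto

lemma uniform_Ck_add:
  "uniform_Ck k I F \<Longrightarrow> uniform_Ck k I G \<Longrightarrow> uniform_Ck k I (\<lambda>i t. F i t + G i t)"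
proof (induction k arbitrary: F G)
  case 0
  then obtain B C where "\<forall>i\<in>I. \<forall>t. norm (F i t) \<le> B" "\<forall>i\<in>I. \<forall>t. norm (G i t) \<le> C"
    unfolding uniform_Ck_0_iff by blast
  then have "\<forall>i\<in>I. \<forall>t. norm (F i t + G i t) \<le> B + C"
    by (meson add_mono norm_triangle_le)
  then show ?case using 0 by (auto intro!: continuous_intros)
next
  case (Suc k)
  obtain F' where F': "\<And>i t. i \<in> I \<Longrightarrow> (F i has_vector_derivative F' i t) (at t)" "uniform_Ck k I F'"
    using uniform_Ck_SucD[OF Suc.prems(1)] by blast
  obtain G' where G': "\<And>i t. i \<in> I \<Longrightarrow> (G i has_vector_derivative G' i t) (at t)" "uniform_Ck k I G'"
    using uniform_Ck_SucD[OF Suc.prems(2)] by blast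
  show ?case
  proof (rule uniform_Ck_SucI)
    show "uniform_Ck 0 I (\<lambda>i t. F i t + G i t)"
      by (rule uniform_Ck_0[OF Suc.IH]) (use Suc.prems uniform_Ck_Suc in blast)+
    show "((\<lambda>t. F i t + G i t) has_vector_derivative F' i t + G' i t) (at t)" if "i \<in> I" for i t
      by (intro has_vector_derivative_add F' G' that)
    show "uniform_Ck k I (\<lambda>i t. F' i t + G' i t)"
      by (rule Suc.IH[OF F'(2) G'(2)])
  qed
qed

lemma uniform_Ck_mult:
  "uniform_Ck k I F \<Longrightarrow> uniform_Ck k I G \<Longrightarrow> uniform_Ck k I (\<lambda>i t. F i t * G i t)"
proof (induction k arbitrary: F G)
  case 0
  then obtain B C where B: "\<And>i t. i \<in> I \<Longrightarrow> norm (F i t) \<le> B" "\<And>i t. i \<in> I \<Longrightarrow> norm (G i t) \<le> C"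
    unfolding uniform_Ck_0_iff by blast
  have "norm (F i t * G i t) \<le> B * C" if "i \<in> I" for i t
    unfolding norm_mult using B[OF that, of t] by (intro mult_mono) (auto intro: order_trans[OF norm_ge_zero])
  then show ?case using 0 by (auto intro!: continuous_intros exI[of _ "B * C"] simp del: norm_mult)
next
  case (Suc k)
  obtain F' where F': "\<And>i t. i \<in> I \<Longrightarrow> (F i has_vector_derivative F' i t) (at t)" "uniform_Ck k I F'"
    using uniform_Ck_SucD[OF Suc.prems(1)] by blast
  obtain G' where G': "\<And>i t. i \<in> I \<Longrightarrow> (G i has_vector_derivative G' i t) (at t)" "uniform_Ck k I G'"
    using uniform_Ck_SucD[OF Suc.prems(2)] by blast
  have k: "uniform_Ck k I F" "uniform_Ck k I G"
    using Suc.prems uniform_Ck_Suc by blast+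
  show ?case
  proof (rule uniform_Ck_SucI)
    show "uniform_Ck 0 I (\<lambda>i t. F i t * G i t)"
      by (rule uniform_Ck_0[OF Suc.IH[OF k]])
    show "((\<lambda>t. F i t * G i t) has_vector_derivative F i t * G' i t + F' i t * G i t) (at t)" if "i \<in> I" for i t
      by (intro has_vector_derivative_mult F' G' that)
    show "uniform_Ck k I (\<lambda>i t. F i t * G' i t + F' i t * G i t)"
      by (intro uniform_Ck_add Suc.IH F'(2) G'(2) k)
  qed
qed

text \<open>A lower bound uniform in the index keeps the reciprocals uniformly bounded, and their
  derivatives are products of reciprocals and derivatives of F.\<close>

lemma uniform_Ck_inverse:
  assumes c: "c > 0"
  shows "uniform_Ck k I F \<Longrightarrow> (\<And>i t. i \<in> I \<Longrightarrow> norm (F i t) \<ge> c) \<Longrightarrow> uniform_Ck k I (\<lambda>i t. inverse (F i t))"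
proof (induction k)
  case 0
  have nz: "F i t \<noteq> 0" if "i \<in> I" for i t
    using 0(2)[OF that, of t] c by auto
  have "norm (inverse (F i t)) \<le> inverse c" if "i \<in> I" for i t
    unfolding norm_inverse using 0(2)[OF that, of t] c by (intro le_imp_inverse_le)
  then show ?case using 0(1) nz by (auto intro!: continuous_on_inverse exI[of _ "inverse c"] simp del: norm_inverse)
next
  case (Suc k)
  obtain F' where F': "\<And>i t. i \<in> I \<Longrightarrow> (F i has_vector_derivative F' i t) (at t)" "uniform_Ck k I F'"
    using uniform_Ck_SucD[OF Suc.prems(1)] by blast
  have k: "uniform_Ck k I (\<lambda>i t. inverse (F i t))"
    by (rule Suc.IH[OF uniform_Ck_Suc[OF Suc.prems(1)] Suc.prems(2)])
  show ?case
  proof (rule uniform_Ck_SucI[OF uniform_Ck_0[OF k]])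
    show "((\<lambda>t. inverse (F i t)) has_vector_derivative (- 1) * (inverse (F i t) * F' i t * inverse (F i t))) (at t)"
      if "i \<in> I" for i t
    proof -
      have "F i t \<noteq> 0" using Suc.prems(2)[OF that, of t] c by auto
      from Deriv.has_derivative_inverse[OF this F'(1)[OF that, unfolded has_vector_derivative_def]]
      show ?thesis unfolding has_vector_derivative_def
        by (rule has_derivative_eq_rhs) (auto simp: scaleR_conv_of_real)
    qed
    show "uniform_Ck k I (\<lambda>i t. (- 1) * (inverse (F i t) * F' i t * inverse (F i t)))"
      by (intro uniform_Ck_mult uniform_Ck_const F'(2) k)
  qed
qed

lemma cis_has_vector_derivative_chain:
  assumes "(\<psi> has_real_derivative d) (at t)"
  shows "((\<lambda>t. cis (c * \<psi> t)) has_vector_derivative of_real (c * d) * (\<i> * cis (c * \<psi> t))) (at t)"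
proof -
  have "((\<lambda>t. c * \<psi> t) has_vector_derivative c * d) (at t)"
    using DERIV_cmult[OF assms, of c] by (simp add: has_real_derivative_iff_has_vector_derivative)
  from vector_diff_chain_at[OF this, of cis] cis_has_vector_derivative
  show ?thesis by (simp add: o_def scaleR_conv_of_real)
qed

text \<open>Integration by parts: F exp(ik\<psi>) is F / (ik\<psi>') times the derivative of
  exp(ik\<psi>). Each step gains a factor 1/|k| and replaces F, up to a constant of modulus 1, by
  the derivative of F / \<psi>', which again lies in a uniform class.\<close>

theorem nonstationary_phase:
  assumes \<psi>: "\<And>i t. i \<in> I \<Longrightarrow> (\<psi> i has_real_derivative \<psi>' i t) (at t)"
    and per: "\<And>i t. i \<in> I \<Longrightarrow> \<psi> i (t + 2 * pi) = \<psi> i t + 2 * pi"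
    and nz: "\<And>i t. i \<in> I \<Longrightarrow> \<psi>' i t \<noteq> 0"
    and p: "uniform_Ck N I (\<lambda>i t. inverse (complex_of_real (\<psi>' i t)))"
    and F: "uniform_Ck N I F"
  shows "\<exists>C. \<forall>i\<in>I. \<forall>k::int. k \<noteq> 0 \<longrightarrow> norm (mean (\<lambda>t. F i t * cis (of_int k * \<psi> i t))) * \<bar>of_int k\<bar> ^ N \<le> C"
  using p F
proof (induction N arbitrary: F)
  case 0
  then obtain B where B: "\<And>i t. i \<in> I \<Longrightarrow> norm (F i t) \<le> B"
    unfolding uniform_Ck_0_iff by blast
  have "norm (mean (\<lambda>t. F i t * cis (of_int k * \<psi> i t))) \<le> B" if "i \<in> I" for i and k :: int
  proof (rule mean_bound)
    have "continuous_on UNIV (\<psi> i)"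
      using \<psi>[OF that] by (auto intro!: continuous_at_imp_continuous_on DERIV_isCont)
    then show "continuous_on UNIV (\<lambda>t. F i t * cis (of_int k * \<psi> i t))"
      using 0 that by (auto intro!: continuous_intros)
  qed (use B[OF that] in \<open>simp add: norm_mult\<close>)
  then show ?case by auto
next
  case (Suc N)
  define H where "H = (\<lambda>i t. F i t * inverse (complex_of_real (\<psi>' i t)))"
  have "uniform_Ck (Suc N) I H"
    unfolding H_def by (rule uniform_Ck_mult[OF Suc.prems(2,1)])
  then obtain H' where H': "\<And>i t. i \<in> I \<Longrightarrow> (H i has_vector_derivative H' i t) (at t)" "uniform_Ck N I H'"
    using uniform_Ck_SucD by blast
  from Suc.IH[OF uniform_Ck_Suc[OF Suc.prems(1)] H'(2)]
  obtain C where C: "\<forall>i\<in>I. \<forall>k::int. k \<noteq> 0 \<longrightarrow>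
      norm (mean (\<lambda>t. H' i t * cis (of_int k * \<psi> i t))) * \<bar>of_int k\<bar> ^ N \<le> C" ..
  have "norm (mean (\<lambda>t. F i t * cis (of_int k * \<psi> i t))) * \<bar>of_int k\<bar> ^ Suc N \<le> C" if i: "i \<in> I" and k: "k \<noteq> 0" for i and k :: int
  proof -
    have c\<psi>: "continuous_on UNIV (\<psi> i)"
      using \<psi>[OF i] by (auto intro!: continuous_at_imp_continuous_on DERIV_isCont)
    have c1: "continuous_on UNIV (\<lambda>t. H' i t * cis (of_int k * \<psi> i t))"
      by (intro continuous_intros c\<psi> uniform_Ck_continuous[OF H'(2) i])
    have c2: "continuous_on UNIV (\<lambda>t. (\<i> * of_int k) * (F i t * cis (of_int k * \<psi> i t)))"
      by (intro continuous_intros c\<psi> uniform_Ck_continuous[OF Suc.prems(2) i])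
    have "mean (\<lambda>t. H' i t * cis (of_int k * \<psi> i t) + (\<i> * of_int k) * (F i t * cis (of_int k * \<psi> i t))) = 0"
    proof (rule mean_derivative)
      fix t
      have "((\<lambda>t. H i t * cis (of_int k * \<psi> i t)) has_vector_derivative
          H i t * (of_real (of_int k * \<psi>' i t) * (\<i> * cis (of_int k * \<psi> i t))) + H' i t * cis (of_int k * \<psi> i t)) (at t)"
        by (intro has_vector_derivative_mult H'(1)[OF i] cis_has_vector_derivative_chain \<psi>[OF i])
      then show "((\<lambda>t. H i t * cis (of_int k * \<psi> i t)) has_vector_derivative
          H' i t * cis (of_int k * \<psi> i t) + (\<i> * of_int k) * (F i t * cis (of_int k * \<psi> i t))) (at t)"
        using nz[OF i, of t] by (simp add: H_def field_simps)
    next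
      \<comment> \<open>No boundary terms: \<psi> advances by one full period and k is an
        integer.\<close>
      have "\<psi> i (2 * pi) = \<psi> i 0 + 2 * pi" using per[OF i, of 0] by simp
      then have "cis (of_int k * \<psi> i (2 * pi)) = cis (of_int k * \<psi> i 0)"
        using cis_2pi_int[of k] by (simp add: distrib_left cis_mult[symmetric] mult.commute)
      moreover have "H i (2 * pi) = H i 0"
        using uniform_Ck_periodic[OF \<open>uniform_Ck (Suc N) I H\<close> i, of 0] by simp
      ultimately show "H i (2 * pi) * cis (of_int k * \<psi> i (2 * pi)) = H i 0 * cis (of_int k * \<psi> i 0)"
        by simp
    qed
    then have "(\<i> * of_int k) * mean (\<lambda>t. F i t * cis (of_int k * \<psi> i t)) = - mean (\<lambda>t. H' i t * cis (of_int k * \<psi> i t))"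
      unfolding mean_add[OF c1 c2] unfolding mean_cmult by (simp add: eq_neg_iff_add_eq_0 add.commute)
    then have "norm ((\<i> * of_int k) * mean (\<lambda>t. F i t * cis (of_int k * \<psi> i t))) = norm (mean (\<lambda>t. H' i t * cis (of_int k * \<psi> i t)))"
      by simp
    then have "\<bar>of_int k\<bar> * norm (mean (\<lambda>t. F i t * cis (of_int k * \<psi> i t))) = norm (mean (\<lambda>t. H' i t * cis (of_int k * \<psi> i t)))"
      by (simp add: norm_mult)
    from this[symmetric] show ?thesis
      using C[rule_format, OF i k] by (simp add: mult_ac)
  qed
  then show ?case by blast
qed

section \<open>The welding problem for small periodic perturbations of the identity\<close>

text \<open>With \<open>\<sigma>\<close> equal to \<open>int\<close> or to \<open>neg_index\<close>
  this is the half of a Fourier series with nonnegative or with negative frequencies; one definition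
  serves both.\<close>

definition trig :: "(nat \<Rightarrow> int) \<Rightarrow> (nat \<Rightarrow> complex) \<Rightarrow> real \<Rightarrow> complex" where
  "trig \<sigma> a t = (\<Sum>n. a n * cis (of_int (\<sigma> n) * t))"

lemma trig_summable: "summable (\<lambda>n. norm (a n)) \<Longrightarrow> summable (\<lambda>n. a n * cis (of_int (\<sigma> n) * t))"
  by (rule summable_norm_cancel) (simp add: norm_mult)

lemma norm_trig_le: "summable (\<lambda>n. norm (a n)) \<Longrightarrow> norm (trig \<sigma> a t) \<le> (\<Sum>n. norm (a n))"
  unfolding trig_def by (rule norm_suminf_le) (simp_all add: norm_mult)

lemma trig_periodic: "trig \<sigma> a (t + 2 * pi) = trig \<sigma> a t"
  unfolding trig_def using cis_2pi_int by (simp add: distrib_left cis_mult[symmetric] mult.commute)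

lemma continuous_on_trig: "summable (\<lambda>n. norm (a n)) \<Longrightarrow> continuous_on UNIV (trig \<sigma> a)"
  unfolding trig_def[abs_def]
  by (rule continuous_on_suminf[where M = "\<lambda>n. norm (a n)"]) (auto intro!: continuous_intros simp: norm_mult)

lemma trig_has_vector_derivative:
  assumes "rapid a" "\<And>n. \<bar>\<sigma> n\<bar> \<le> int (Suc n)"
  shows "(trig \<sigma> a has_vector_derivative trig \<sigma> (\<lambda>n. \<i> * of_int (\<sigma> n) * a n) t) (at t)"
proof -
  have \<sigma>: "\<bar>real_of_int (\<sigma> n)\<bar> \<le> real (Suc n)" for n
    using assms(2)[of n] by linarith
  define f' where "f' = (\<lambda>n t h. h *\<^sub>R (a n * (of_real (of_int (\<sigma> n) * 1) * (\<i> * cis (of_int (\<sigma> n) * t)))))"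
  have "((\<lambda>t. \<Sum>n. a n * cis (of_int (\<sigma> n) * t)) has_derivative (\<lambda>h. \<Sum>n. f' n t h)) (at t)"
  proof (rule has_derivative_suminf[where M = "\<lambda>n. norm (a n) * real (Suc n) ^ 1"])
    show "((\<lambda>t. a n * cis (of_int (\<sigma> n) * t)) has_derivative f' n t) (at t)" for n t
      unfolding f'_def has_vector_derivative_def[symmetric]
      by (intro has_vector_derivative_mult_right cis_has_vector_derivative_chain) simp
    show "norm (f' n t h) \<le> norm (a n) * real (Suc n) ^ 1 * norm h" for n t h
      using mult_left_mono[OF \<sigma>[of n], of "\<bar>h\<bar> * norm (a n)"]
      by (simp add: f'_def norm_mult mult_ac)
    show "summable (\<lambda>n. norm (a n) * real (Suc n) ^ 1)"
      by (rule rapid_summable[OF assms(1)])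
    show "summable (\<lambda>n. a n * cis (of_int (\<sigma> n) * t))" for t
      by (rule trig_summable[OF rapid_summable_norm[OF assms(1)]])
  qed
  moreover have "(\<Sum>n. f' n t h) = h *\<^sub>R trig \<sigma> (\<lambda>n. \<i> * of_int (\<sigma> n) * a n) t" for h
  proof -
    have "summable (\<lambda>n. norm (\<i> * of_int (\<sigma> n) * a n))"
      by (rule summable_comparison_test[OF _ rapid_summable[OF assms(1), of 1]])
         (use mult_right_mono[OF \<sigma>] in \<open>auto simp: norm_mult mult.commute\<close>)
    from suminf_scaleR_right[OF trig_summable[OF this], of h \<sigma> t]
    show ?thesis by (simp add: f'_def trig_def mult_ac)
  qed
  ultimately show ?thesis
    unfolding trig_def[of \<sigma> a, abs_def] has_vector_derivative_def by simp
qed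

lemma rapid_mult_frequency:
  assumes "rapid a" "\<And>n. \<bar>\<sigma> n\<bar> \<le> int (Suc n)"
  shows "rapid (\<lambda>n. \<i> * of_int (\<sigma> n) * a n)"
proof (rule rapidI)
  fix N
  obtain C where C: "\<And>n. norm (a n) * real (Suc n) ^ (Suc N) \<le> C"
    using assms(1) unfolding rapid_def by blast
  have "norm (\<i> * of_int (\<sigma> n) * a n) * real (Suc n) ^ N \<le> C" for n
  proof -
    have "norm (\<i> * of_int (\<sigma> n) * a n) * real (Suc n) ^ N = \<bar>real_of_int (\<sigma> n)\<bar> * (norm (a n) * real (Suc n) ^ N)"
      by (simp add: norm_mult)
    also have "\<dots> \<le> real (Suc n) * (norm (a n) * real (Suc n) ^ N)"
      using assms(2)[of n] by (intro mult_right_mono) (linarith, simp)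
    also have "\<dots> \<le> C"
      using C[of n] by (simp add: mult_ac)
    finally show ?thesis .
  qed
  then show "\<exists>C. \<forall>n. norm (\<i> * of_int (\<sigma> n) * a n) * real (Suc n) ^ N \<le> C" by blast
qed

lemma uniform_Ck_trig:
  assumes "\<And>n. \<bar>\<sigma> n\<bar> \<le> int (Suc n)"
  shows "rapid a \<Longrightarrow> uniform_Ck N I (\<lambda>i. trig \<sigma> a)"
proof (induction N arbitrary: a)
  case 0
  then show ?case
    using norm_trig_le[OF rapid_summable_norm[OF 0]]
    by (auto simp: continuous_on_trig rapid_summable_norm trig_periodic)
next
  case (Suc N)
  have "uniform_Ck 0 I (\<lambda>i. trig \<sigma> a)"
    using norm_trig_le[OF rapid_summable_norm[OF Suc.prems]] Suc.prems
    by (auto simp: continuous_on_trig rapid_summable_norm trig_periodic)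
  then show ?case
    by (rule uniform_Ck_SucI[OF _ trig_has_vector_derivative[OF Suc.prems assms] Suc.IH[OF rapid_mult_frequency[OF Suc.prems assms]]])
qed

lemma mean_trig_compose:
  assumes a: "summable (\<lambda>n. norm (a n))" and c: "continuous_on UNIV \<psi>" "continuous_on UNIV \<omega>"
    and \<omega>: "\<And>t. norm (\<omega> t) \<le> B"
  shows "(\<lambda>n. a n * mean (\<lambda>t. \<omega> t * cis (of_int (\<sigma> n) * \<psi> t))) sums mean (\<lambda>t. \<omega> t * trig \<sigma> a (\<psi> t))"
proof -
  have B: "B \<ge> 0" using \<omega>[of 0] norm_ge_zero order_trans by blast
  have "(\<lambda>n. mean (\<lambda>t. a n * (\<omega> t * cis (of_int (\<sigma> n) * \<psi> t)))) sums
      mean (\<lambda>t. \<Sum>n. a n * (\<omega> t * cis (of_int (\<sigma> n) * \<psi> t)))"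
  proof (rule mean_suminf[where M = "\<lambda>n. norm (a n) * B"])
    show "norm (a n * (\<omega> t * cis (of_int (\<sigma> n) * \<psi> t))) \<le> norm (a n) * B" for n t
      using \<omega>[of t] by (simp add: norm_mult mult_left_mono)
  qed (auto intro!: continuous_intros c summable_mult2 a)
  moreover have "(\<Sum>n. a n * (\<omega> t * cis (of_int (\<sigma> n) * \<psi> t))) = \<omega> t * trig \<sigma> a (\<psi> t)" for t
    using suminf_mult[OF trig_summable[OF a], of "\<omega> t" \<sigma> "\<psi> t"] by (simp add: trig_def mult_ac)
  ultimately show ?thesis by (simp add: mean_cmult)
qed

abbreviation neg_index :: "nat \<Rightarrow> int" where "neg_index j \<equiv> - int (Suc j)"

text \<open>Stated for an abstract orthogonality relation because it is applied in two settings: to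
  the circle variable t with weight 1, and to the variable R(t) with weight R'(t).\<close>

lemma trig_coefficient:
  assumes a: "summable (\<lambda>n. norm (a n))" and c: "continuous_on UNIV \<psi>" "continuous_on UNIV \<omega>"
    and \<omega>: "\<And>t. norm (\<omega> t) \<le> B"
    and orth: "\<And>k::int. mean (\<lambda>t. \<omega> t * cis (of_int k * \<psi> t)) = (if k = 0 then 1 else 0)"
  shows "mean (\<lambda>t. \<omega> t * trig \<sigma> a (\<psi> t) * cis (of_int m * \<psi> t)) = (\<Sum>n. if \<sigma> n = - m then a n else 0)"
proof -
  have "(\<lambda>n. a n * mean (\<lambda>t. (\<omega> t * cis (of_int m * \<psi> t)) * cis (of_int (\<sigma> n) * \<psi> t))) sums
      mean (\<lambda>t. (\<omega> t * cis (of_int m * \<psi> t)) * trig \<sigma> a (\<psi> t))"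
    by (rule mean_trig_compose[OF a c(1), where B = B]) (auto intro!: continuous_intros c simp: norm_mult \<omega>)
  moreover have "a n * mean (\<lambda>t. (\<omega> t * cis (of_int m * \<psi> t)) * cis (of_int (\<sigma> n) * \<psi> t)) =
      (if \<sigma> n = - m then a n else 0)" for n
  proof -
    have "(\<lambda>t. (\<omega> t * cis (of_int m * \<psi> t)) * cis (of_int (\<sigma> n) * \<psi> t)) = (\<lambda>t. \<omega> t * cis (of_int (m + \<sigma> n) * \<psi> t))"
      by (simp add: cis_mult distrib_right mult.assoc)
    then show ?thesis
      unfolding orth[of "m + \<sigma> n"] by (auto simp: orth simp del: of_int_add)
  qed
  ultimately show ?thesis by (simp add: sums_iff mult_ac)
qed

lemma suminf_single_index:
  fixes a :: "nat \<Rightarrow> complex"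
  shows "(\<Sum>n. if int n = m then a n else 0) = (if m \<ge> 0 then a (nat m) else 0)"
    and "(\<Sum>j. if neg_index j = m then a j else 0) = (if m < 0 then a (nat (- m - 1)) else 0)"
proof -
  have "(\<Sum>n. if int n = m then a n else 0) = (\<Sum>n\<in>(if m \<ge> 0 then {nat m} else {}). if int n = m then a n else 0)"
    by (rule suminf_finite) auto
  then show "(\<Sum>n. if int n = m then a n else 0) = (if m \<ge> 0 then a (nat m) else 0)"
    by auto
  have "(\<Sum>j. if neg_index j = m then a j else 0) = (\<Sum>j\<in>(if m < 0 then {nat (- m - 1)} else {}). if neg_index j = m then a j else 0)"
    by (rule suminf_finite) auto
  then show "(\<Sum>j. if neg_index j = m then a j else 0) = (if m < 0 then a (nat (- m - 1)) else 0)"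
    by auto
qed

lemma mean_cis_orth: "mean (\<lambda>t. 1 * cis (of_int k * t)) = (if k = 0 then 1 else 0)"
  using mean_cis[of k] by (simp add: mean_const)

lemma trig_coefficient_id:
  assumes "summable (\<lambda>n. norm (a n))"
  shows "mean (\<lambda>t. trig \<sigma> a t * cis (of_int m * t)) = (\<Sum>n. if \<sigma> n = - m then a n else 0)"
  using trig_coefficient[OF assms, of "\<lambda>t. t" "\<lambda>t. 1" 1 \<sigma> m, OF _ _ _ mean_cis_orth] by (simp add: continuous_intros)

text \<open>The substitution s = R(t) in disguise: for k \<noteq> 0 the integrand is, up to a
  factor, the derivative of the periodic function cis(kR), and for k = 0 it differs from 1 by the
  derivative of the periodic function R(t) - t.\<close>

lemma mean_cis_compose:
  assumes R: "\<And>t. (R has_real_derivative R' t) (at t)" "continuous_on UNIV R'"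
    and per: "\<And>t. R (t + 2 * pi) = R t + 2 * pi" and R0: "R 0 = 0"
  shows "mean (\<lambda>t. of_real (R' t) * cis (of_int k * R t)) = (if k = 0 then 1 else 0)"
proof (cases "k = 0")
  case True
  have "mean (\<lambda>t. of_real (R' t) - 1) = 0"
  proof (rule mean_derivative[where F = "\<lambda>t. of_real (R t - t)"])
    show "((\<lambda>t. complex_of_real (R t - t)) has_vector_derivative of_real (R' t) - 1) (at t)" for t
      using has_vector_derivative_of_real[OF DERIV_diff[OF R(1) DERIV_ident]] by simp
  qed (use per[of 0] in simp)
  then show ?thesis
    using True R(2) by (simp add: mean_diff mean_const continuous_intros)
next
  case False
  have "mean (\<lambda>t. of_real (of_int k * R' t) * (\<i> * cis (of_int k * R t))) = 0"
  proof (rule mean_derivative)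
    show "((\<lambda>t. cis (of_int k * R t)) has_vector_derivative of_real (of_int k * R' t) * (\<i> * cis (of_int k * R t))) (at t)" for t
      by (rule cis_has_vector_derivative_chain[OF R(1)])
    show "cis (of_int k * R (2 * pi)) = cis (of_int k * R 0)"
      using per[of 0] cis_2pi_int[of k] by (simp add: R0 mult.commute)
  qed
  moreover have "(\<lambda>t. of_real (of_int k * R' t) * (\<i> * cis (of_int k * R t))) =
      (\<lambda>t. (\<i> * of_int k) * (of_real (R' t) * cis (of_int k * R t)))"
    by (simp add: mult_ac)
  ultimately show ?thesis
    using False by (simp add: mean_cmult)
qed

text \<open>The inversion theorem for absolutely summable coefficients, transported by a change of the circle variable.\<close>

lemma fourier_expansion:
  assumes R: "\<And>t. (R has_real_derivative R' t) (at t)" "continuous_on UNIV R'" "\<And>t. R' t > 0"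
    and per: "\<And>t. R (t + 2 * pi) = R t + 2 * pi" and R0: "R 0 = 0"
    and f: "continuous_on UNIV f" "\<And>t. f (t + 2 * pi) = f t"
    and p: "\<And>n. p n = mean (\<lambda>t. f t * of_real (R' t) * cis (- (real n * R t)))" "summable (\<lambda>n. norm (p n))"
    and q: "\<And>j. q j = mean (\<lambda>t. f t * of_real (R' t) * cis (real (Suc j) * R t))" "summable (\<lambda>j. norm (q j))"
  shows "f t = trig int p (R t) + trig neg_index q (R t)"
proof -
  have cR: "continuous_on UNIV R"
    using R(1) by (auto intro!: continuous_at_imp_continuous_on DERIV_isCont)
  have mono: "strict_mono R"
    by (rule strict_monoI, rule DERIV_pos_imp_increasing) (use R(1,3) in auto)
  then have inj: "inj R" by (rule strict_mono_imp_inj_on)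
  obtain B where B: "\<And>t. norm (R t - t) \<le> B"
    using continuous_periodic_bounded[of "\<lambda>t. R t - t" "2 * pi", OF continuous_on_diff[OF cR continuous_on_id]] per
    by auto
  \<comment> \<open>By periodicity R(t) - t is bounded, so the intermediate value theorem
    applies.\<close>
  have surj: "\<exists>s. R s = y" for y
  proof -
    have "R (y - B) \<le> y" "y \<le> R (y + B)" "y - B \<le> y + B"
      using B[of "y - B"] B[of "y + B"] B[of 0] by (auto simp: abs_if split: if_splits)
    then show ?thesis
      using IVT'[of R "y - B" y "y + B"] cR by (auto intro: continuous_on_subset)
  qed
  then have rng: "range R = UNIV" by (metis surjI surj_def)
  have ci: "continuous_on UNIV (inv R)"
    using continuous_on_inverse_open[OF open_UNIV cR, of "inv R"] rng inv_f_f[OF inj] by simp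
  have invR: "inv R (R t) = t" "R (inv R t) = t" for t
    using inj rng by (auto simp: surj_f_inv_f)
  have invper: "inv R (s + 2 * pi) = inv R s + 2 * pi" for s
    using per[of "inv R s"] invR by metis
  obtain M where M: "\<And>t. norm (R' t) \<le> M"
  proof (rule continuous_periodic_bounded[OF R(2), of "2 * pi"])
    show "R' (t + 2 * pi) = R' t" for t
    proof (rule DERIV_unique)
      show "(R has_real_derivative R' (t + 2 * pi)) (at (t + 2 * pi))" by (rule R(1))
      have "(R has_real_derivative R' t) (at ((t + 2 * pi) - 2 * pi))"
        using R(1)[of t] by simp
      moreover have "((\<lambda>s. s - 2 * pi) has_real_derivative 1) (at (t + 2 * pi))"
        by (auto intro!: derivative_eq_intros)
      ultimately have "((\<lambda>s. R (s - 2 * pi)) has_real_derivative R' t * 1) (at (t + 2 * pi))"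
        by (rule DERIV_chain2)
      from DERIV_add[OF this DERIV_const[of "2 * pi"]]
      have "((\<lambda>s. R (s - 2 * pi) + 2 * pi) has_real_derivative R' t) (at (t + 2 * pi))"
        by simp
      moreover have "(\<lambda>s. R (s - 2 * pi) + 2 * pi) = R"
      proof (rule ext)
        show "R (s - 2 * pi) + 2 * pi = R s" for s
          using per[of "s - 2 * pi"] by simp
      qed
      ultimately show "(R has_real_derivative R' t) (at (t + 2 * pi))" by simp
    qed
  qed (use that in auto)
  \<comment> \<open>The defect of the expansion. All its coefficients in the variable s = R(t)
    vanish, so uniqueness is applied to it as a function of s.\<close>
  define D where "D = (\<lambda>t. f t - (trig int p (R t) + trig neg_index q (R t)))"
  have cT: "continuous_on UNIV (\<lambda>t. trig \<sigma> a (R t))" if "summable (\<lambda>n. norm (a n))" for \<sigma> a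
    using continuous_on_compose2[OF continuous_on_trig[OF that] cR] by auto
  note orth = mean_cis_compose[OF R(1,2) per R0]
  have coeff: "mean (\<lambda>t. of_real (R' t) * trig \<sigma> a (R t) * cis (of_int m * R t)) = (\<Sum>n. if \<sigma> n = - m then a n else 0)"
    if "summable (\<lambda>n. norm (a n))" for \<sigma> a m
    by (rule trig_coefficient[OF that cR _ _ orth, where B = M]) (use M R(2) in \<open>auto intro: continuous_intros\<close>)
  have D0: "mean (\<lambda>t. of_real (R' t) * D t * cis (of_int m * R t)) = 0" for m
  proof -
    have E: "(\<lambda>t. of_real (R' t) * D t * cis (of_int m * R t)) = (\<lambda>t. f t * of_real (R' t) * cis (of_int m * R t) -
       (of_real (R' t) * trig int p (R t) * cis (of_int m * R t) + of_real (R' t) * trig neg_index q (R t) * cis (of_int m * R t)))"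
      by (auto simp: D_def algebra_simps)
    have c1: "continuous_on UNIV (\<lambda>t. f t * of_real (R' t) * cis (of_int m * R t))"
      by (intro continuous_intros f cR R(2))
    have c2: "continuous_on UNIV (\<lambda>t. of_real (R' t) * trig \<sigma> a (R t) * cis (of_int m * R t))"
      if "summable (\<lambda>n. norm (a n))" for \<sigma> a
      by (intro continuous_intros cT[OF that] cR R(2))
    have "mean (\<lambda>t. of_real (R' t) * D t * cis (of_int m * R t)) = mean (\<lambda>t. f t * of_real (R' t) * cis (of_int m * R t)) -
       ((if - m \<ge> 0 then p (nat (- m)) else 0) + (if - m < 0 then q (nat (- (- m) - 1)) else 0))"
      unfolding E mean_diff[OF c1 continuous_on_add[OF c2[OF p(2)] c2[OF q(2)]]] mean_add[OF c2[OF p(2)] c2[OF q(2)]]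
        coeff[OF p(2)] coeff[OF q(2)] suminf_single_index ..
    also have "\<dots> = 0"
      unfolding p(1) q(1) by auto
    finally show ?thesis .
  qed
  have cD: "continuous_on UNIV D"
    unfolding D_def by (intro continuous_intros f cT p q)
  have "D (inv R s) = 0" for s
  proof (rule fourier_unique[where f = "\<lambda>s. D (inv R s)"])
    show "continuous_on UNIV (\<lambda>s. D (inv R s))"
      using continuous_on_compose2[OF cD ci] by auto
    show "D (inv R (s + 2 * pi)) = D (inv R s)" for s
      by (simp add: invper D_def f(2) per trig_periodic)
    fix n :: int
    let ?h = "\<lambda>s. D (inv R s) * cis (of_int n * s)"
    have m: "R ` {0..2 * pi} \<subseteq> {R 0..R (2 * pi)}" "R 0 \<le> R (2 * pi)"
      using strict_mono_mono[OF mono] by (auto simp: mono_def)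
    have ch: "continuous_on {R 0..R (2 * pi)} ?h"
      by (intro continuous_intros continuous_on_compose2[OF cD] continuous_on_subset[OF ci]) auto
    \<comment> \<open>The interval of integration is preserved, since R(0) = 0 and R(2 pi) = 2
      pi.\<close>
    have "((\<lambda>t. R' t *\<^sub>R ?h (R t)) has_integral (integral {R 0..R (2 * pi)} ?h)) {0..2 * pi}"
      by (rule has_integral_substitution[OF _ m(2,1) ch]) (auto intro: has_field_derivative_at_within R(1))
    then have "integral {0..2 * pi} (\<lambda>t. R' t *\<^sub>R ?h (R t)) = integral {0..2 * pi} ?h"
      using per[of 0] R0 by (simp add: integral_unique)
    then have "mean ?h = mean (\<lambda>t. of_real (R' t) * D t * cis (of_int n * R t))"
      by (simp add: mean_def scaleR_conv_of_real invR mult.assoc)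
    then show "mean ?h = 0" using D0 by simp
  qed
  from this[of "R t"] show ?thesis
    by (simp add: invR D_def)
qed

text \<open>The number pi^2/6: the factor incurred by summing a bound of order 1/(n+1)^2 over one
  frequency.\<close>

definition inv_square_sum :: real where
  "inv_square_sum = (\<Sum>n. 1 / real (Suc n) ^ 2)"

lemma inv_square_sum_nonneg: "inv_square_sum \<ge> 0"
  unfolding inv_square_sum_def by (rule suminf_nonneg[OF summable_inverse_Suc_square]) auto

lemma suminf_inv_square_bound:
  fixes f :: "nat \<Rightarrow> 'a::banach"
  assumes "\<And>n. norm (f n) \<le> C * (1 / real (Suc n) ^ 2)"
  shows "summable (\<lambda>n. norm (f n))" "summable f" "(\<Sum>n. norm (f n)) \<le> C * inv_square_sum"
    "norm (\<Sum>n. f n) \<le> C * inv_square_sum"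
proof -
  show 1: "summable (\<lambda>n. norm (f n))"
    by (rule summable_comparison_test[OF _ summable_mult[OF summable_inverse_Suc_square, of C]]) (use assms in auto)
  then show "summable f" by (rule summable_norm_cancel)
  have "(\<Sum>n. norm (f n)) \<le> (\<Sum>n. C * (1 / real (Suc n) ^ 2))"
    by (rule suminf_le[OF assms 1 summable_mult[OF summable_inverse_Suc_square]])
  also have "\<dots> = C * inv_square_sum"
    unfolding inv_square_sum_def by (rule suminf_mult[OF summable_inverse_Suc_square])
  finally show 2: "(\<Sum>n. norm (f n)) \<le> C * inv_square_sum" .
  show "norm (\<Sum>n. f n) \<le> C * inv_square_sum"
    using summable_norm[OF 1] 2 by linarith
qed

text \<open>The oscillatory estimate says nothing at frequency 0 and weighs by |k|. For the sequence
  starting at frequency 0, the inequality n + 1 \<le> 2n for n \<ge> 1 costs a factor 2^N, and index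
  0 is bounded separately.\<close>

lemma rapid_of_bound:
  assumes "\<And>N. \<exists>C. \<forall>k::int. k \<noteq> 0 \<longrightarrow> norm (c k) * \<bar>of_int k\<bar> ^ N \<le> (C :: real)"
  shows "rapid (\<lambda>j. c (int (Suc j)))" "rapid (\<lambda>n. c (- int n))"
proof -
  show "rapid (\<lambda>j. c (int (Suc j)))"
  proof (rule rapidI)
    fix N
    obtain C where "\<forall>k::int. k \<noteq> 0 \<longrightarrow> norm (c k) * \<bar>of_int k\<bar> ^ N \<le> C" using assms by blast
    then have "norm (c (int (Suc n))) * real (Suc n) ^ N \<le> C" for n
      by (elim allE[of _ "int (Suc n)"]) simp
    then show "\<exists>C. \<forall>n. norm (c (int (Suc n))) * real (Suc n) ^ N \<le> C" by blast
  qed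
  show "rapid (\<lambda>n. c (- int n))"
  proof (rule rapidI)
    fix N
    obtain C where C: "\<forall>k::int. k \<noteq> 0 \<longrightarrow> norm (c k) * \<bar>of_int k\<bar> ^ N \<le> C" using assms by blast
    have "norm (c (- int n)) * real (Suc n) ^ N \<le> max (norm (c 0)) (2 ^ N * C)" for n
    proof (cases n)
      case (Suc m)
      have "real (Suc n) ^ N \<le> (2 * real n) ^ N"
        using Suc by (intro power_mono) auto
      then have "norm (c (- int n)) * real (Suc n) ^ N \<le> norm (c (- int n)) * (2 * real n) ^ N"
        by (intro mult_left_mono) auto
      also have "\<dots> = 2 ^ N * (norm (c (- int n)) * \<bar>of_int (- int n)\<bar> ^ N)"
        by (simp add: power_mult_distrib)
      also have "\<dots> \<le> 2 ^ N * C"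
        using C[rule_format, of "- int n"] Suc by (intro mult_left_mono) auto
      finally show ?thesis by simp
    qed simp
    then show "\<exists>C. \<forall>n. norm (c (- int n)) * real (Suc n) ^ N \<le> C" by blast
  qed
qed

text \<open>
  The matrix coefficients of the composition operator with \<open>R\<close> that occur here connect frequencies
  of opposite sign; they vanish for \<open>\<delta> = 0\<close>.
\<close>

locale small_welding =
  fixes \<delta> \<delta>' :: "real \<Rightarrow> real" and \<eta> :: real and R :: "real \<Rightarrow> real"
  assumes der: "\<And>t. (\<delta> has_real_derivative \<delta>' t) (at t)"
    and per: "\<And>t. \<delta> (t + 2 * pi) = \<delta> t"
    and zero: "\<delta> 0 = 0"
    and bound: "\<And>t. \<bar>\<delta>' t\<bar> \<le> 1 / 2"
    and smooth: "\<And>N. uniform_Ck N {()} (\<lambda>_ t. complex_of_real (\<delta>' t))"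
    and eta: "\<eta> \<ge> 0" "\<eta> * inv_square_sum \<le> 1 / 8" "\<eta> * inv_square_sum * inv_square_sum \<le> 1 / 8"
    and R_eq: "R = (\<lambda>t. t + \<delta> t)"
    and S_small: "\<And>n j. norm (mean (\<lambda>t. cis (- (real n * t)) * cis (- (real (Suc j) * R t))))
        \<le> \<eta> * (1 / real (Suc n) ^ 3) * (1 / real (Suc j) ^ 2)"
    and S'_small: "\<And>n j. norm (mean (\<lambda>t. cis (real (Suc j) * t) * cis (real n * R t)))
        \<le> \<eta> * (1 / real (Suc n) ^ 2) * (1 / real (Suc j) ^ 2)"
    and S_rapid: "\<And>N. \<exists>C. \<forall>n j. norm (mean (\<lambda>t. cis (- (real n * t)) * cis (- (real (Suc j) * R t)))) *
         real (Suc n) ^ N \<le> C * (1 / real (Suc j) ^ 2)"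
    and d_small: "\<And>j. norm (mean (\<lambda>t. complex_of_real (\<delta> t) * cis (real (Suc j) * t))) \<le> \<eta> * (1 / real (Suc j) ^ 3)"
begin

abbreviation "Z \<equiv> inv_square_sum"

definition "R' = (\<lambda>t. 1 + \<delta>' t)"

text \<open>The coefficient of exp(int), n \<ge> 0, in exp(-i(j+1)R(t)): the leak from a negative
  R-frequency into a nonnegative t-frequency.\<close>

definition "S n j = mean (\<lambda>t. cis (- (real n * t)) * cis (- (real (Suc j) * R t)))"

text \<open>The opposite leak: the coefficient of exp(-i(j+1)t) in exp(inR(t)), n \<ge> 0.\<close>

definition "S' j n = mean (\<lambda>t. cis (real (Suc j) * t) * cis (real n * R t))"

definition "dp n = mean (\<lambda>t. complex_of_real (\<delta> t) * cis (- (real n * t)))"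

definition "dm j = mean (\<lambda>t. complex_of_real (\<delta> t) * cis (real (Suc j) * t))"

text \<open>The weight R' makes \<open>q f\<close> and \<open>p f\<close> the Fourier coefficients
  of f in the variable s = R(t), at the frequencies -(j+1) and n; \<open>dm\<close> and
  \<open>dp\<close> are the analogous coefficients of \<delta> in the variable t.\<close>

definition "q f j = mean (\<lambda>t. f t * of_real (R' t) * cis (real (Suc j) * R t))"

definition "p f n = mean (\<lambda>t. f t * of_real (R' t) * cis (- (real n * R t)))"

text \<open>The nonnegative t-coefficients of the part of f with negative R-frequencies.\<close>

definition "A f n = (\<Sum>j. S n j * q f j)"

text \<open>Two demands on r = v o R lead to the equation r = T r. As r has only negative
  R-frequencies, its nonnegative t-coefficients are \<open>A r\<close>; as u = r + \<delta> has no
  negative t-frequencies, r must cancel \<delta> there.\<close>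

definition "T f t = trig int (A f) t + trig neg_index (\<lambda>j. - dm j) t"

section \<open>Estimates for the operator \<open>T\<close> and its fixed point\<close>

lemma inv_cube_le: "1 / real (Suc n) ^ 3 \<le> 1 / real (Suc n) ^ 2"
  by (intro divide_left_mono power_increasing) auto

lemma R_der: "(R has_real_derivative R' t) (at t)"
  unfolding R_eq R'_def by (rule DERIV_add[OF DERIV_ident der])

lemma R_per: "R (t + 2 * pi) = R t + 2 * pi"
  by (simp add: R_eq per)

lemma R_zero: "R 0 = 0"
  by (simp add: R_eq zero)

lemma R'_bounds: "R' t \<ge> 1 / 2" "R' t \<le> 3 / 2"
  using bound[of t] unfolding R'_def by linarith+

lemma R'_pos: "R' t > 0"
  using R'_bounds(1)[of t] by linarith

lemma R'_norm: "norm (complex_of_real (R' t)) \<le> 2"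
  using R'_bounds[of t] by simp

lemma R_cont: "continuous_on UNIV R"
  using R_der by (auto intro!: continuous_at_imp_continuous_on DERIV_isCont)

lemma \<delta>_cont: "continuous_on UNIV \<delta>"
  using der by (auto intro!: continuous_at_imp_continuous_on DERIV_isCont)

lemma R'_smooth: "uniform_Ck N {()} (\<lambda>_ t. complex_of_real (R' t))"
  using uniform_Ck_add[OF uniform_Ck_const[of N "{()}" 1] smooth[of N]] by (simp add: R'_def)

lemma R'_cont: "continuous_on UNIV R'"
  using continuous_on_Re[OF uniform_Ck_continuous[OF R'_smooth[of 0], of "()"]] by simp

lemma R'_inverse_smooth: "uniform_Ck N {()} (\<lambda>_ t. inverse (complex_of_real (R' t)))"
  by (rule uniform_Ck_inverse[OF _ R'_smooth, of "1/2"]) (use order_trans[OF R'_bounds(1) abs_ge_self] in auto)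

text \<open>The factor 2 is a convenient bound for R', which is at most 3/2.\<close>

lemma q_bound:
  assumes "continuous_on UNIV f" "\<And>t. norm (f t) \<le> B"
  shows "norm (q f j) \<le> 2 * B" "norm (p f n) \<le> 2 * B"
proof -
  have "norm (f t * of_real (R' t) * cis s) \<le> 2 * B" for t s
    using mult_mono[OF assms(2)[of t] R'_norm[of t]] order_trans[OF norm_ge_zero assms(2)[of t]]
    by (simp add: norm_mult mult.commute)
  then show "norm (q f j) \<le> 2 * B" "norm (p f n) \<le> 2 * B"
    unfolding q_def p_def by (intro mean_bound continuous_intros assms R'_cont R_cont; blast)+
qed

lemma A_terms:
  assumes "continuous_on UNIV f" "\<And>t. norm (f t) \<le> B"
  shows "norm (S n j * q f j) \<le> \<eta> * (2 * B) * (1 / real (Suc n) ^ 3) * (1 / real (Suc j) ^ 2)"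
proof -
  have "norm (S n j * q f j) \<le> (\<eta> * (1 / real (Suc n) ^ 3) * (1 / real (Suc j) ^ 2)) * (2 * B)"
    unfolding norm_mult using S_small[of n j] q_bound(1)[OF assms]
    by (intro mult_mono) (auto simp: S_def eta(1))
  then show ?thesis by (simp add: mult_ac)
qed

text \<open>Square decay suffices for summing the series with coefficients \<open>A f\<close>; the
  cube keeps one power in reserve for the derivative at 0, which has to be estimated at the end of
  the welding proof.\<close>

lemma A_bound:
  assumes "continuous_on UNIV f" "\<And>t. norm (f t) \<le> B"
  shows "norm (A f n) \<le> \<eta> * (2 * B) * Z * (1 / real (Suc n) ^ 3)"
    "norm (A f n) \<le> \<eta> * (2 * B) * Z * (1 / real (Suc n) ^ 2)"
    "summable (\<lambda>j. S n j * q f j)"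
proof -
  have B: "B \<ge> 0" using assms(2)[of 0] norm_ge_zero order_trans by blast
  show 1: "norm (A f n) \<le> \<eta> * (2 * B) * Z * (1 / real (Suc n) ^ 3)"
    using suminf_inv_square_bound(4)[OF A_terms[OF assms]] by (simp add: A_def mult_ac)
  show "summable (\<lambda>j. S n j * q f j)"
    by (rule suminf_inv_square_bound(2)[OF A_terms[OF assms]])
  have "\<eta> * (2 * B) * Z * (1 / real (Suc n) ^ 3) \<le> \<eta> * (2 * B) * Z * (1 / real (Suc n) ^ 2)"
    using inv_cube_le B eta(1) inv_square_sum_nonneg by (intro mult_left_mono) auto
  with 1 show "norm (A f n) \<le> \<eta> * (2 * B) * Z * (1 / real (Suc n) ^ 2)" by linarith
qed

lemma A_diff:
  assumes "continuous_on UNIV f" "\<And>t. norm (f t) \<le> B" "continuous_on UNIV g" "\<And>t. norm (g t) \<le> C"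
  shows "A f n - A g n = A (\<lambda>t. f t - g t) n"
proof -
  have "q (\<lambda>t. f t - g t) j = q f j - q g j" for j
    unfolding q_def left_diff_distrib by (intro mean_diff continuous_intros assms R'_cont R_cont)
  then show ?thesis
    unfolding A_def using suminf_diff[OF A_bound(3)[OF assms(1,2)] A_bound(3)[OF assms(3,4)], of n]
    by (simp add: right_diff_distrib)
qed

lemma dm_bound: "norm (- dm j) \<le> \<eta> * (1 / real (Suc j) ^ 2)"
proof -
  have "\<eta> * (1 / real (Suc j) ^ 3) \<le> \<eta> * (1 / real (Suc j) ^ 2)"
    using inv_cube_le eta(1) by (rule mult_left_mono)
  then show ?thesis
    using d_small[of j] by (simp add: dm_def)
qed

lemma T_cont:
  assumes "continuous_on UNIV f" "\<And>t. norm (f t) \<le> B"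
  shows "continuous_on UNIV (T f)"
  unfolding T_def[abs_def]
  by (intro continuous_on_add continuous_on_trig suminf_inv_square_bound(1)[OF A_bound(2)[OF assms]]
      suminf_inv_square_bound(1)[OF dm_bound])

text \<open>The constraints on \<eta> are tuned to this: with Z the sum of inverse squares, 2B
  \<eta> Z^2 \<le> B/4 and \<eta> Z \<le> 1/8.\<close>

lemma T_bound:
  assumes "continuous_on UNIV f" "\<And>t. norm (f t) \<le> B"
  shows "norm (T f t) \<le> B / 4 + 1 / 8"
proof -
  have B: "B \<ge> 0" using assms(2)[of 0] norm_ge_zero order_trans by blast
  have "norm (trig int (A f) t) \<le> \<eta> * (2 * B) * Z * Z"
    using norm_trig_le[OF suminf_inv_square_bound(1)[OF A_bound(2)[OF assms]]]
      suminf_inv_square_bound(3)[OF A_bound(2)[OF assms]] by (rule order_trans)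
  also have "\<dots> = (2 * B) * (\<eta> * Z * Z)" by simp
  also have "\<dots> \<le> (2 * B) * (1 / 8)"
    using eta(3) B by (intro mult_left_mono) auto
  finally have 1: "norm (trig int (A f) t) \<le> B / 4" by simp
  have "norm (trig neg_index (\<lambda>j. - dm j) t) \<le> \<eta> * Z"
    using norm_trig_le[OF suminf_inv_square_bound(1)[OF dm_bound]] suminf_inv_square_bound(3)[OF dm_bound]
    by (rule order_trans)
  then show ?thesis
    using 1 eta(2) norm_triangle_ineq[of "trig int (A f) t" "trig neg_index (\<lambda>j. - dm j) t"]
    unfolding T_def by linarith
qed

lemma T_lipschitz:
  assumes "continuous_on UNIV f" "\<And>t. norm (f t) \<le> B" "continuous_on UNIV g" "\<And>t. norm (g t) \<le> C"
    and d: "\<And>t. norm (f t - g t) \<le> D"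
  shows "norm (T f t - T g t) \<le> D / 4"
proof -
  have D: "D \<ge> 0" using d[of 0] norm_ge_zero order_trans by blast
  note fg = A_bound(2)[OF continuous_on_diff[OF assms(1,3)] d]
  note sA = suminf_inv_square_bound(1)[OF A_bound(2)[OF assms(1,2)]] suminf_inv_square_bound(1)[OF A_bound(2)[OF assms(3,4)]]
  have "T f t - T g t = trig int (A f) t - trig int (A g) t"
    by (simp add: T_def)
  also have "\<dots> = trig int (\<lambda>n. A f n - A g n) t"
    unfolding trig_def using suminf_diff[OF trig_summable[OF sA(1), of int t] trig_summable[OF sA(2), of int t]]
    by (simp add: left_diff_distrib)
  also have "\<dots> = trig int (A (\<lambda>t. f t - g t)) t"
    using A_diff[OF assms(1-4)] by simp
  also have "norm \<dots> \<le> \<eta> * (2 * D) * Z * Z"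
    using norm_trig_le[OF suminf_inv_square_bound(1)[OF fg]]
      suminf_inv_square_bound(3)[OF fg] by (rule order_trans)
  also have "\<dots> = (2 * D) * (\<eta> * Z * Z)" by simp
  also have "\<dots> \<le> (2 * D) * (1 / 8)"
    using eta(3) D by (intro mult_left_mono) auto
  finally show ?thesis by simp
qed

text \<open>As \<open>S\<close> is smoothing, the sup norm is enough: the contraction takes place in
  the Banach space of bounded continuous functions. The norm B of the fixed point satisfies B \<le>
  B/4 + 1/8, hence B \<le> 1/4.\<close>

lemma fixed_point:
  obtains r where "continuous_on UNIV r" "\<And>t. norm (r t) \<le> 1 / 4" "\<And>t. r t = T r t"
proof -
  define F :: "(real \<Rightarrow>\<^sub>C complex) \<Rightarrow> (real \<Rightarrow>\<^sub>C complex)" where "F = (\<lambda>r. Bcontfun (T (apply_bcontfun r)))"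
  have c: "continuous_on UNIV (apply_bcontfun r)" for r :: "real \<Rightarrow>\<^sub>C complex"
    using apply_bcontfun[of r] by (simp add: bcontfun_def)
  have F: "apply_bcontfun (F r) = T (apply_bcontfun r)" for r
    unfolding F_def
    by (rule Bcontfun_inverse[OF bcontfun_normI[OF T_cont[OF c norm_bounded] T_bound[OF c norm_bounded]]])
  have "\<exists>!r. F r = r"
  proof (rule banach_fix_type)
    show "\<forall>r s. dist (F r) (F s) \<le> 1 / 4 * dist r s"
    proof (intro allI dist_bound)
      fix r s t
      have "norm (T (apply_bcontfun r) t - T (apply_bcontfun s) t) \<le> dist r s / 4"
        by (rule T_lipschitz[OF c norm_bounded c norm_bounded]) (use dist_bounded in \<open>simp add: dist_norm[symmetric]\<close>)
      then show "dist (F r t) (F s t) \<le> 1 / 4 * dist r s"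
        by (simp add: F dist_norm)
    qed
  qed auto
  then obtain r where r: "F r = r" by blast
  define B where "B = norm r"
  have B: "norm (r t) \<le> B" for t
    unfolding B_def by (rule norm_bounded)
  have fix_r: "r t = T (apply_bcontfun r) t" for t
    using F[of r] r by simp
  have "norm r \<le> B / 4 + 1 / 8"
    by (rule norm_bound) (metis T_bound[OF c B] fix_r)
  then have "B \<le> 1 / 4" unfolding B_def by simp
  then show ?thesis
    using that[of "apply_bcontfun r", OF c _ fix_r] B order_trans by blast
qed

text \<open>The gain of regularity: \<open>S\<close> decays rapidly in n, whatever bounded
  continuous f supplies the coefficients \<open>q f\<close>.\<close>

lemma A_rapid:
  assumes "continuous_on UNIV f" "\<And>t. norm (f t) \<le> B"
  shows "rapid (A f)"
proof (rule rapidI)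
  fix N
  obtain C where C: "\<And>n j. norm (S n j) * real (Suc n) ^ N \<le> C * (1 / real (Suc j) ^ 2)"
    using S_rapid[of N] unfolding S_def by blast
  have "norm (A f n) * real (Suc n) ^ N \<le> (C * (2 * B)) * Z" for n
  proof -
    have "norm (of_real (real (Suc n) ^ N) * (S n j * q f j)) \<le> (C * (2 * B)) * (1 / real (Suc j) ^ 2)" for j
    proof -
      have "norm (of_real (real (Suc n) ^ N) * (S n j * q f j)) = (norm (S n j) * real (Suc n) ^ N) * norm (q f j)"
        by (simp add: norm_mult norm_power del: of_nat_Suc)
      also have "\<dots> \<le> (C * (1 / real (Suc j) ^ 2)) * (2 * B)"
        by (rule mult_mono'[OF C q_bound(1)[OF assms]]) auto
      finally show ?thesis by (simp add: mult_ac)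
    qed
    from suminf_inv_square_bound(4)[OF this]
    have "norm (\<Sum>j. of_real (real (Suc n) ^ N) * (S n j * q f j)) \<le> (C * (2 * B)) * Z" .
    also have "(\<Sum>j. of_real (real (Suc n) ^ N) * (S n j * q f j)) = of_real (real (Suc n) ^ N) * A f n"
      unfolding A_def by (rule suminf_mult[OF A_bound(3)[OF assms]])
    finally show ?thesis
      by (simp add: norm_mult norm_power mult.commute del: of_nat_Suc)
  qed
  then show "\<exists>C. \<forall>n. norm (A f n) * real (Suc n) ^ N \<le> C" by blast
qed

lemma dm_dp_rapid: "rapid dm" "rapid dp"
proof -
  have \<delta>C: "uniform_Ck N {()} (\<lambda>_ t. complex_of_real (\<delta> t))" for N
  proof -
    obtain B where B: "\<And>t. norm (\<delta> t) \<le> B"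
      using continuous_periodic_bounded[OF \<delta>_cont _ per] by auto
    have "uniform_Ck 0 {()} (\<lambda>_ t. complex_of_real (\<delta> t))"
      using B per by (auto intro!: continuous_intros \<delta>_cont)
    then have "uniform_Ck (Suc N) {()} (\<lambda>_ t. complex_of_real (\<delta> t))"
      by (rule uniform_Ck_SucI[OF _ _ smooth[of N]]) (rule has_vector_derivative_of_real[OF der])
    then show ?thesis by (rule uniform_Ck_Suc)
  qed
  define c where "c = (\<lambda>k::int. mean (\<lambda>t. complex_of_real (\<delta> t) * cis (of_int k * t)))"
  have "\<exists>C. \<forall>k::int. k \<noteq> 0 \<longrightarrow> norm (c k) * \<bar>of_int k\<bar> ^ N \<le> C" for N
    using nonstationary_phase[of "{()}" "\<lambda>_ t. t" "\<lambda>_ t. 1" N "\<lambda>_ t. complex_of_real (\<delta> t)"] \<delta>C uniform_Ck_const[of N "{()}" 1]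
    by (simp add: c_def)
  from rapid_of_bound[OF this] show "rapid dm" "rapid dp"
    by (simp_all add: c_def dm_def[abs_def] dp_def[abs_def])
qed

text \<open>By the definition of \<open>T\<close>, the sum r + \<delta> has only nonnegative
  t-frequencies, which gives u. It remains to show that r has only negative R-frequencies; v is then
  read off from its R-coefficients. The last conclusion says that F+ has nonzero derivative at
  0.\<close>

theorem welding:
  obtains a b where "rapid a" "rapid b"
    "\<And>t. of_real t + exp_series cutoff_exp a (of_real t) = of_real (R t) + exp_series cutoff_exp b (- of_real (R t))"
    "1 + exp_series cutoff_exp (\<lambda>n. \<i> * of_nat n * a n) 0 \<noteq> 0"
proof -
  obtain r where r: "continuous_on UNIV r" "\<And>t. norm (r t) \<le> 1 / 4" "\<And>t. r t = T r t"
    using fixed_point by blast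
  define a0 where "a0 = A r"
  define q0 where "q0 = q r"
  define p0 where "p0 = p r"
  have Ar: "rapid a0"
    unfolding a0_def by (rule A_rapid[OF r(1,2)])
  have dmr: "rapid (\<lambda>j. - dm j)"
    using rapid_cmult[OF dm_dp_rapid(1), of "-1"] by simp
  note sum_A = rapid_summable_norm[OF Ar] and sum_d = rapid_summable_norm[OF dmr]
  have r_eq: "r = (\<lambda>t. trig int a0 t + trig neg_index (\<lambda>j. - dm j) t)"
    using r(3) by (auto simp: T_def a0_def)
  have r_per: "r (t + 2 * pi) = r t" for t
    unfolding r(3)[of "t + 2 * pi"] r(3)[of t] by (simp add: T_def trig_periodic)
  \<comment> \<open>Bootstrap: being a value of \<open>T\<close>, the merely continuous r has rapid
    coefficients and is therefore smooth.\<close>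
  have "uniform_Ck N {()} (\<lambda>_. r)" for N
    by (subst r_eq) (intro uniform_Ck_add uniform_Ck_trig Ar dmr, auto)
  then have "uniform_Ck N {()} (\<lambda>_ t. r t * of_real (R' t))" for N
    by (rule uniform_Ck_mult[OF _ R'_smooth])
  from nonstationary_phase[of "{()}" "\<lambda>_. R" "\<lambda>_. R'", OF R_der R_per _ R'_inverse_smooth this] R'_pos
  have "\<exists>C. \<forall>k::int. k \<noteq> 0 \<longrightarrow> norm (mean (\<lambda>t. r t * of_real (R' t) * cis (of_int k * R t))) * \<bar>of_int k\<bar> ^ N \<le> C" for N
    by (simp add: less_imp_neq[THEN not_sym])
  from rapid_of_bound[OF this] have qr: "rapid q0" and pr: "rapid p0"
    by (simp_all add: q0_def p0_def q_def[abs_def] p_def[abs_def])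
  note sum_q = rapid_summable_norm[OF qr] and sum_p = rapid_summable_norm[OF pr]
  \<comment> \<open>The unwanted part of r, with nonnegative R-frequencies.\<close>
  define W where "W = (\<lambda>t. trig int p0 (R t))"
  have expand: "r t = W t + trig neg_index q0 (R t)" for t
    unfolding W_def
    by (rule fourier_expansion[OF R_der R'_cont R'_pos R_per R_zero r(1) r_per _ sum_p _ sum_q]) (simp_all only: p0_def q0_def p_def q_def)
  have cT: "continuous_on UNIV (\<lambda>t. trig \<sigma> c (R t))" if "summable (\<lambda>n. norm (c n))" for \<sigma> c
    using continuous_on_compose2[OF continuous_on_trig[OF that] R_cont] by auto
  have W_cont: "continuous_on UNIV W"
    unfolding W_def by (rule cT[OF sum_p])
  have W_per: "W (t + 2 * pi) = W t" for t
    by (simp add: W_def R_per trig_periodic)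
  \<comment> \<open>The fixed point equation says that r and its negative R-part have the same
    nonnegative t-coefficients, so those of their difference W vanish.\<close>
  have W_coeff_nonneg: "mean (\<lambda>t. W t * cis (- (real k * t))) = 0" for k
  proof -
    have s: "(\<lambda>j. q0 j * S k j) sums mean (\<lambda>t. cis (- (real k * t)) * trig neg_index q0 (R t))"
      using mean_trig_compose[OF sum_q R_cont, of "\<lambda>t. cis (- (real k * t))" 1 neg_index]
      by (simp add: S_def[abs_def] continuous_intros del: of_nat_Suc)
    have "a0 k = mean (\<lambda>t. trig int a0 t * cis (of_int (- int k) * t)) + mean (\<lambda>t. trig neg_index (\<lambda>j. - dm j) t * cis (of_int (- int k) * t))"
      unfolding trig_coefficient_id[OF sum_A] trig_coefficient_id[OF sum_d] suminf_single_index by simp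
    also have "\<dots> = mean (\<lambda>t. r t * cis (of_int (- int k) * t))"
      unfolding fun_cong[OF r_eq] distrib_right
      by (intro mean_add[symmetric] continuous_intros continuous_on_trig sum_A sum_d)
    also have "\<dots> = mean (\<lambda>t. W t * cis (- (real k * t)) + cis (- (real k * t)) * trig neg_index q0 (R t))"
      by (simp add: expand algebra_simps)
    also have "\<dots> = mean (\<lambda>t. W t * cis (- (real k * t))) + mean (\<lambda>t. cis (- (real k * t)) * trig neg_index q0 (R t))"
      by (intro mean_add continuous_intros cT sum_q W_cont)
    also have "mean (\<lambda>t. cis (- (real k * t)) * trig neg_index q0 (R t)) = a0 k"
      using s by (simp add: sums_iff a0_def q0_def A_def mult.commute)
    finally show ?thesis by simp
  qed
  define e where "e = (\<lambda>j. mean (\<lambda>t. W t * cis (real (Suc j) * t)))"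
  \<comment> \<open>This allows \<open>p0\<close> to be bounded by the sup norm of W itself instead
    of that of r.\<close>
  have p_W: "p0 = p W"
  proof
    fix n
    have "mean (\<lambda>t. of_real (R' t) * trig neg_index q0 (R t) * cis (of_int (- int n) * R t)) = 0"
      unfolding trig_coefficient[OF sum_q R_cont _ R'_norm mean_cis_compose[OF R_der R'_cont R_per R_zero], OF continuous_on_of_real[OF R'_cont]]
        suminf_single_index by simp
    moreover have "p0 n = mean (\<lambda>t. W t * of_real (R' t) * cis (- (real n * R t)) +
        of_real (R' t) * trig neg_index q0 (R t) * cis (of_int (- int n) * R t))"
      unfolding p0_def p_def by (simp add: expand algebra_simps)
    moreover have "\<dots> = p W n + mean (\<lambda>t. of_real (R' t) * trig neg_index q0 (R t) * cis (of_int (- int n) * R t))"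
      unfolding p_def by (intro mean_add continuous_intros cT sum_q W_cont R'_cont R_cont)
    ultimately show "p0 n = p W n" by simp
  qed
  have e_bound: "norm (e j) \<le> (\<eta> * (2 * B) * Z) * (1 / real (Suc j) ^ 2)" if B: "\<And>t. norm (W t) \<le> B" for B j
  proof -
    have "(\<lambda>n. p0 n * S' j n) sums mean (\<lambda>t. cis (real (Suc j) * t) * trig int p0 (R t))"
      using mean_trig_compose[OF sum_p R_cont, of "\<lambda>t. cis (real (Suc j) * t)" 1 int]
      by (simp add: S'_def[abs_def] continuous_intros del: of_nat_Suc)
    then have "e j = (\<Sum>n. p0 n * S' j n)"
      unfolding e_def W_def by (simp add: sums_iff mult.commute)
    also have "norm \<dots> \<le> (\<eta> * (2 * B) * (1 / real (Suc j) ^ 2)) * Z"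
    proof (rule suminf_inv_square_bound)
      fix n
      have "norm (p0 n * S' j n) \<le> (2 * B) * (\<eta> * (1 / real (Suc n) ^ 2) * (1 / real (Suc j) ^ 2))"
        unfolding norm_mult p_W S'_def by (rule mult_mono'[OF q_bound(2)[OF W_cont B] S'_small]) auto
      then show "norm (p0 n * S' j n) \<le> \<eta> * (2 * B) * (1 / real (Suc j) ^ 2) * (1 / real (Suc n) ^ 2)"
        by (simp add: mult_ac)
    qed
    finally show ?thesis by (simp add: mult_ac)
  qed
  obtain B0 where B0: "\<And>t. norm (W t) \<le> B0"
    using norm_trig_le[OF sum_p] unfolding W_def by blast
  note sum_e = suminf_inv_square_bound(1)[OF e_bound[OF B0]]
  have W_eq: "W t = trig neg_index e t" for t
  proof -
    have "W t - trig neg_index e t = 0"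
    proof (rule fourier_unique[where f = "\<lambda>t. W t - trig neg_index e t"])
      show "continuous_on UNIV (\<lambda>t. W t - trig neg_index e t)"
        by (intro continuous_on_diff W_cont continuous_on_trig sum_e)
      show "W (t + 2 * pi) - trig neg_index e (t + 2 * pi) = W t - trig neg_index e t" for t
        by (simp add: W_per trig_periodic)
      fix m :: int
      have "mean (\<lambda>t. (W t - trig neg_index e t) * cis (of_int m * t)) =
          mean (\<lambda>t. W t * cis (of_int m * t)) - mean (\<lambda>t. trig neg_index e t * cis (of_int m * t))"
        unfolding left_diff_distrib
        by (intro mean_diff continuous_intros W_cont continuous_on_trig sum_e)
      also have "mean (\<lambda>t. trig neg_index e t * cis (of_int m * t)) = (if - m < 0 then e (nat (- (- m) - 1)) else 0)"
        unfolding trig_coefficient_id[OF sum_e] suminf_single_index ..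
      also have "mean (\<lambda>t. W t * cis (of_int m * t)) = \<dots>"
      proof (cases "m > 0")
        case True
        then show ?thesis by (simp add: e_def)
      next
        case False
        then show ?thesis using W_coeff_nonneg[of "nat (- m)"] by simp
      qed
      finally show "mean (\<lambda>t. (W t - trig neg_index e t) * cis (of_int m * t)) = 0" by simp
    qed
    then show ?thesis by simp
  qed
  \<comment> \<open>A bound for W reproduces itself at a quarter of its size, which forces W =
    0.\<close>
  have shrink: "norm (W t) \<le> B / 4" if B: "\<And>t. norm (W t) \<le> B" for B t
  proof -
    have "B \<ge> 0" using B[of 0] norm_ge_zero order_trans by blast
    have "norm (W t) \<le> \<eta> * (2 * B) * Z * Z"
      unfolding W_eq
      using norm_trig_le[OF suminf_inv_square_bound(1)[OF e_bound[OF B]]] suminf_inv_square_bound(3)[OF e_bound[OF B]]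
      by (rule order_trans)
    also have "\<dots> = (2 * B) * (\<eta> * Z * Z)" by simp
    also have "\<dots> \<le> (2 * B) * (1 / 8)"
      using eta(3) \<open>B \<ge> 0\<close> by (intro mult_left_mono) auto
    finally show ?thesis by simp
  qed
  have W_zero: "W t = 0" for t
  proof -
    define B where "B = (SUP t. norm (W t))"
    have B: "norm (W t) \<le> B" for t
      unfolding B_def by (rule cSUP_upper) (use B0 in \<open>auto simp: bdd_above_def\<close>)
    have "B \<le> B / 4"
      unfolding B_def by (rule cSUP_least) (use shrink[OF B] in \<open>auto simp: B_def\<close>)
    then have "norm (W t) \<le> 0" using B[of t] by linarith
    then show ?thesis by simp
  qed
  define a where "a = (\<lambda>n. a0 n + dp n)"
  \<comment> \<open>Index shift: v has no constant term, and \<open>q0 j\<close> belongs to the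
    frequency -(j+1).\<close>
  define b where "b = (\<lambda>n. case n of 0 \<Rightarrow> 0 | Suc j \<Rightarrow> q0 j)"
  have a: "rapid a"
    unfolding a_def by (rule rapid_add[OF Ar dm_dp_rapid(2)])
  have b: "rapid b"
  proof (rule rapidI)
    fix N
    obtain C where C: "\<And>n. norm (q0 n) * real (Suc n) ^ N \<le> C"
      using qr unfolding rapid_def by blast
    have "norm (b n) * real (Suc n) ^ N \<le> 2 ^ N * C" for n
    proof (cases n)
      case 0
      have "0 \<le> C" by (rule order_trans[OF _ C[of 0]]) simp
      then show ?thesis using 0 by (simp add: b_def)
    next
      case (Suc j)
      have "real (Suc n) ^ N \<le> (2 * real (Suc j)) ^ N"
        using Suc by (intro power_mono) auto
      then have "norm (b n) * real (Suc n) ^ N \<le> norm (q0 j) * (2 * real (Suc j)) ^ N"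
        using Suc by (auto simp: b_def intro!: mult_left_mono)
      also have "\<dots> = 2 ^ N * (norm (q0 j) * real (Suc j) ^ N)"
        by (simp only: power_mult_distrib mult_ac)
      also have "\<dots> \<le> 2 ^ N * C"
        using C by (intro mult_left_mono) auto
      finally show ?thesis .
    qed
    then show "\<exists>C. \<forall>n. norm (b n) * real (Suc n) ^ N \<le> C" by blast
  qed
  have real_eq: "exp_series cutoff_exp c (of_real t) = trig int c t" for c t
    using exp_profile_cutoff_exp by (simp add: exp_series_def trig_def exp_profile_def)
  have b_eq: "exp_series cutoff_exp b (- of_real s) = trig neg_index q0 s" for s
  proof -
    have "exp_series cutoff_exp b (of_real (- s)) = trig int b (- s)"
      by (rule real_eq)
    also have "\<dots> = (\<Sum>n. b (Suc n) * cis (of_int (int (Suc n)) * - s))"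
      unfolding trig_def
      using suminf_split_head[OF trig_summable[OF rapid_summable_norm[OF b], of int "- s"]] by (simp add: b_def del: of_nat_Suc)
    finally show ?thesis
      by (simp add: trig_def b_def del: of_nat_Suc)
  qed
  have \<delta>_expand: "complex_of_real (\<delta> t) = trig int dp t + trig neg_index dm t" for t
    by (rule fourier_expansion[of "\<lambda>t. t" "\<lambda>t. 1"])
       (use rapid_summable_norm[OF dm_dp_rapid(1)] rapid_summable_norm[OF dm_dp_rapid(2)] in
         \<open>auto simp: per dp_def dm_def intro!: continuous_intros \<delta>_cont\<close>)
  have neg: "trig neg_index (\<lambda>j. - dm j) t = - trig neg_index dm t" for t
    unfolding trig_def using suminf_minus[OF trig_summable[OF rapid_summable_norm[OF dm_dp_rapid(1)]], of neg_index t] by simp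
  have a_eq: "trig int a t = r t + \<delta> t" for t
  proof -
    have "trig int a t = trig int a0 t + trig int dp t"
      unfolding trig_def a_def distrib_right
      by (rule suminf_add[symmetric]) (intro trig_summable rapid_summable_norm Ar dm_dp_rapid)+
    then show ?thesis
      using fun_cong[OF r_eq, of t] neg[of t] \<delta>_expand[of t] by simp
  qed
  show ?thesis
  proof (rule that[OF a b])
    fix t
    show "of_real t + exp_series cutoff_exp a (of_real t) = of_real (R t) + exp_series cutoff_exp b (- of_real (R t))"
      unfolding real_eq b_eq a_eq using expand[of t] W_zero[of t] by (simp add: R_eq)
  next
    have nat_freq: "\<bar>int n\<bar> \<le> int (Suc n)" "\<bar>neg_index n\<bar> \<le> int (Suc n)" for n by auto
    \<comment> \<open>With Z the sum of inverse squares, the derivative of u = r + \<delta> at 0 is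
      at most \<eta> Z^2 / 2 + \<eta> Z + 1/2 < 1 in modulus. Each differentiated series uses up one
      of the three powers in its bound.\<close>
    have "(trig int a has_vector_derivative (trig int (\<lambda>n. \<i> * of_int (int n) * a0 n) 0 +
         trig neg_index (\<lambda>n. \<i> * of_int (neg_index n) * - dm n) 0) + of_real (\<delta>' 0)) (at 0)"
      unfolding a_eq[abs_def]
      by (rule has_vector_derivative_add[OF _ has_vector_derivative_of_real[OF der]], subst r_eq)
         (intro has_vector_derivative_add trig_has_vector_derivative Ar dmr nat_freq)
    from vector_derivative_unique_at[OF trig_has_vector_derivative[OF a nat_freq(1)] this]
    have D: "exp_series cutoff_exp (\<lambda>n. \<i> * of_nat n * a n) 0 =
        trig int (\<lambda>n. \<i> * of_int (int n) * a0 n) 0 + trig neg_index (\<lambda>n. \<i> * of_int (neg_index n) * - dm n) 0 + of_real (\<delta>' 0)"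
      using real_eq[of _ 0] by simp
    have "norm (\<i> * of_int (int n) * a0 n) \<le> (\<eta> * (2 * (1 / 4)) * Z) * (1 / real (Suc n) ^ 2)" for n
    proof -
      have "norm (\<i> * of_int (int n) * a0 n) \<le> real (Suc n) * (\<eta> * (2 * (1 / 4)) * Z * (1 / real (Suc n) ^ 3))"
        unfolding norm_mult by (rule mult_mono'[OF _ A_bound(1)[OF r(1,2), folded a0_def]]) auto
      also have "\<dots> = (\<eta> * (2 * (1 / 4)) * Z) * (1 / real (Suc n) ^ 2)"
        by (simp add: power2_eq_square power3_eq_cube field_simps del: of_nat_Suc)
      finally show ?thesis .
    qed
    from order_trans[OF norm_trig_le[OF suminf_inv_square_bound(1)[OF this]] suminf_inv_square_bound(3)[OF this]]
    have 1: "norm (trig int (\<lambda>n. \<i> * of_int (int n) * a0 n) 0) \<le> \<eta> * (2 * (1 / 4)) * Z * Z" .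
    have "norm (\<i> * of_int (neg_index j) * - dm j) \<le> \<eta> * (1 / real (Suc j) ^ 2)" for j
    proof -
      have "norm (\<i> * of_int (neg_index j) * - dm j) = real (Suc j) * norm (dm j)"
        unfolding norm_mult norm_of_int by simp
      also have "\<dots> \<le> real (Suc j) * (\<eta> * (1 / real (Suc j) ^ 3))"
        unfolding dm_def by (intro mult_left_mono d_small) simp
      also have "\<dots> = \<eta> * (1 / real (Suc j) ^ 2)"
        by (simp add: power2_eq_square power3_eq_cube field_simps del: of_nat_Suc)
      finally show ?thesis .
    qed
    from order_trans[OF norm_trig_le[OF suminf_inv_square_bound(1)[OF this]] suminf_inv_square_bound(3)[OF this]]
    have 2: "norm (trig neg_index (\<lambda>n. \<i> * of_int (neg_index n) * - dm n) 0) \<le> \<eta> * Z" .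
    have "norm (exp_series cutoff_exp (\<lambda>n. \<i> * of_nat n * a n) 0) \<le>
        norm (trig int (\<lambda>n. \<i> * of_int (int n) * a0 n) 0) + norm (trig neg_index (\<lambda>n. \<i> * of_int (neg_index n) * - dm n) 0) + \<bar>\<delta>' 0\<bar>"
      unfolding D
      by (rule order_trans[OF norm_triangle_ineq add_mono[OF norm_triangle_ineq]]) simp
    also have "\<dots> < 1"
      using 1 2 eta bound[of 0] by linarith
    finally have less: "norm (exp_series cutoff_exp (\<lambda>n. \<i> * of_nat n * a n) 0) < 1" .
    show "1 + exp_series cutoff_exp (\<lambda>n. \<i> * of_nat n * a n) 0 \<noteq> 0"
    proof
      assume "1 + exp_series cutoff_exp (\<lambda>n. \<i> * of_nat n * a n) 0 = 0"
      then have "exp_series cutoff_exp (\<lambda>n. \<i> * of_nat n * a n) 0 = - 1"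
        by (rule minus_unique[symmetric])
      with less show False by simp
    qed
  qed
qed

end

section \<open>Local solution of the welding problem\<close>

lemma uniform_Ck_reindex:
  "uniform_Ck k I F \<Longrightarrow> (\<And>j. j \<in> J \<Longrightarrow> f j \<in> I) \<Longrightarrow> uniform_Ck k J (\<lambda>j. F (f j))"
proof (induction k arbitrary: F)
  case 0
  then show ?case by (auto simp: uniform_Ck_0_iff) blast
next
  case (Suc k)
  obtain F' where F': "\<forall>i\<in>I. \<forall>t. (F i has_vector_derivative F' i t) (at t)" "uniform_Ck k I F'"
    using uniform_Ck_SucD[OF Suc.prems(1)] by blast
  show ?case
  proof (rule uniform_Ck_SucI)
    show "uniform_Ck 0 J (\<lambda>j. F (f j))"
      by (rule uniform_Ck_0[OF Suc.IH[OF uniform_Ck_Suc[OF Suc.prems(1)] Suc.prems(2)]])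
    show "(F (f j) has_vector_derivative F' (f j) t) (at t)" if "j \<in> J" for j t
      using F'(1) Suc.prems(2)[OF that] by blast
    show "uniform_Ck k J (\<lambda>j. F' (f j))"
      by (rule Suc.IH[OF F'(2) Suc.prems(2)])
  qed
qed

section \<open>Rescaled families with uniform bounds\<close>

lemma smooth_on_has_real_derivative:
  "smooth_on UNIV f \<Longrightarrow> (f has_real_derivative rderiv f t) (at t)"
  using smooth_on_has_vector_derivative[of UNIV f t] by (simp add: has_real_derivative_iff_has_vector_derivative)

lemma smooth_on_rderiv: "smooth_on UNIV f \<Longrightarrow> smooth_on UNIV (rderiv f)"
  by (rule smooth_on_frechet_derivative)

lemma rderiv_periodic:
  fixes f :: "real \<Rightarrow> real"
  assumes "smooth_on UNIV f" "\<And>t. f (t + p) = f t"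
  shows "rderiv f (t + p) = rderiv f t"
proof -
  have "((\<lambda>t. f (t + p)) has_real_derivative rderiv f (t + p)) (at t)"
    using smooth_on_has_real_derivative[OF assms(1), of "t + p"] by (simp add: DERIV_shift)
  then show ?thesis
    unfolding assms(2) using DERIV_unique smooth_on_has_real_derivative[OF assms(1), of t] by blast
qed

lemma uniform_Ck_smooth_periodic:
  assumes "smooth_on UNIV f" "\<And>t. f (t + 2 * pi) = f t"
  shows "uniform_Ck k I (\<lambda>i t. complex_of_real (f t))"
  using assms
proof (induction k arbitrary: f)
  case (0 f)
  obtain B where "\<And>t. norm (f t) \<le> B"
    using continuous_periodic_bounded[OF smooth_on_continuous[OF 0(1)] _ 0(2)] by auto
  then show ?case
    using 0 by (auto intro!: continuous_intros smooth_on_continuous)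
next
  case (Suc k f)
  obtain B where "\<And>t. norm (f t) \<le> B"
    using continuous_periodic_bounded[OF smooth_on_continuous[OF Suc.prems(1)] _ Suc.prems(2)] by auto
  then have "uniform_Ck 0 I (\<lambda>i t. complex_of_real (f t))"
    using Suc.prems by (auto intro!: continuous_intros smooth_on_continuous)
  then show ?case
  proof (rule uniform_Ck_SucI)
    show "((\<lambda>t. complex_of_real (f t)) has_vector_derivative complex_of_real (rderiv f t)) (at t)" for t
      by (rule has_vector_derivative_of_real[OF smooth_on_has_real_derivative[OF Suc.prems(1)]])
    show "uniform_Ck k I (\<lambda>i t. complex_of_real (rderiv f t))"
      by (rule Suc.IH[OF smooth_on_rderiv[OF Suc.prems(1)] rderiv_periodic[OF Suc.prems]])
  qed
qed

definition kappa_bound :: real where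
  "kappa_bound = (SOME K. \<forall>t. \<bar>kappa t\<bar> \<le> K)"

lemma kappa_bound: "\<bar>kappa t\<bar> \<le> kappa_bound"
proof -
  obtain B where "\<And>t. norm (kappa t) \<le> B"
    using continuous_periodic_bounded[OF smooth_on_continuous[OF smooth_on_kappa] _ kappa_periodic] by auto
  then have "\<forall>t. \<bar>kappa t\<bar> \<le> B" by simp
  then have "\<forall>t. \<bar>kappa t\<bar> \<le> kappa_bound"
    unfolding kappa_bound_def by (rule someI)
  then show ?thesis by blast
qed

lemma kappa_bound_nonneg: "kappa_bound \<ge> 0"
  using kappa_bound[of 0] by linarith

text \<open>Differentiation in t produces \<epsilon>, the derivative of \<open>kappa\<close>, and
  the derivative of h at the same argument, so the induction can run over h. As \<open>kappa\<close>
  is bounded, all arguments stay in one compact interval for \<epsilon> \<le> 1.\<close>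

lemma uniform_Ck_rescaled:
  fixes h :: "real \<Rightarrow> real"
  assumes "smooth_on UNIV h"
  shows "uniform_Ck k {0..1} (\<lambda>\<epsilon> t. complex_of_real (h (x0 + \<epsilon> * kappa t)))"
  using assms
proof (induction k arbitrary: h)
  have *: "uniform_Ck 0 {0..1} (\<lambda>\<epsilon> t. complex_of_real (h (x0 + \<epsilon> * kappa t)))" if h: "smooth_on UNIV h" for h :: "real \<Rightarrow> real"
  proof -
    have "compact (h ` cball x0 kappa_bound)"
      using smooth_on_continuous[OF h] by (intro compact_continuous_image) (auto intro: continuous_on_subset)
    then obtain B where B: "\<And>x. x \<in> cball x0 kappa_bound \<Longrightarrow> \<bar>h x\<bar> \<le> B"
      using compact_imp_bounded[of "h ` cball x0 kappa_bound"] unfolding bounded_iff real_norm_def by blast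
    have "\<bar>h (x0 + \<epsilon> * kappa t)\<bar> \<le> B" if "\<epsilon> \<in> {0..1}" for \<epsilon> t
    proof (rule B)
      have "\<epsilon> * \<bar>kappa t\<bar> \<le> 1 * kappa_bound"
        using that kappa_bound[of t] by (intro mult_mono) auto
      then show "x0 + \<epsilon> * kappa t \<in> cball x0 kappa_bound"
        using that by (simp add: dist_real_def abs_mult)
    qed
    moreover have "continuous_on UNIV (\<lambda>t. h (x0 + \<epsilon> * kappa t))" for \<epsilon>
      by (rule continuous_on_compose2[OF smooth_on_continuous[OF h]])
         (auto intro!: continuous_intros smooth_on_continuous[OF smooth_on_kappa])
    ultimately show ?thesis
      unfolding uniform_Ck_0_iff
      by (intro conjI ballI allI exI[of _ B]) (auto simp: kappa_periodic intro!: continuous_intros)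
  qed
  {
    case 0
    then show ?case by (rule *)
  next
    case (Suc k)
    show ?case
    proof (rule uniform_Ck_SucI[OF *[OF Suc.prems]])
      fix \<epsilon> t :: real
      have "((\<lambda>t. x0 + \<epsilon> * kappa t) has_real_derivative \<epsilon> * rderiv kappa t) (at t)"
        using DERIV_add[OF DERIV_const[of x0] DERIV_cmult[OF smooth_on_has_real_derivative[OF smooth_on_kappa], of \<epsilon>]] by simp
      from has_vector_derivative_of_real[OF DERIV_chain2[OF smooth_on_has_real_derivative[OF Suc.prems] this]]
      show "((\<lambda>t. complex_of_real (h (x0 + \<epsilon> * kappa t))) has_vector_derivative
          of_real (rderiv h (x0 + \<epsilon> * kappa t)) * (of_real \<epsilon> * of_real (rderiv kappa t))) (at t)"
        by simp
    next
      show "uniform_Ck k {0..1} (\<lambda>\<epsilon> t. complex_of_real (rderiv h (x0 + \<epsilon> * kappa t)) * (of_real \<epsilon> * of_real (rderiv kappa t)))"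
        by (intro uniform_Ck_mult Suc.IH smooth_on_rderiv Suc.prems uniform_Ck_param[where B = 1]
            uniform_Ck_smooth_periodic smooth_on_kappa rderiv_periodic kappa_periodic) auto
    qed
  }
qed

lemma norm_cis_diff_le: "norm (cis (x + y) - cis x) \<le> \<bar>y\<bar>"
proof -
  have "norm (cis (x + y) - cis x) = norm (cis x) * norm (cis y - 1)"
    unfolding norm_mult[symmetric] by (simp add: cis_mult[symmetric] right_diff_distrib)
  also have "norm (cis y - 1) \<le> \<bar>y\<bar>"
  proof -
    have "norm (cis y - cis 0) \<le> 1 * norm (y - 0)"
    proof (rule differentiable_bound[where S = UNIV and f' = "\<lambda>x h. h *\<^sub>R (\<i> * cis x)"])
      show "(cis has_derivative (\<lambda>h. h *\<^sub>R (\<i> * cis x))) (at x within UNIV)" for x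
        using cis_has_vector_derivative[of x] by (simp add: has_vector_derivative_def)
      show "onorm (\<lambda>h. h *\<^sub>R (\<i> * cis x)) \<le> 1" for x
        by (rule onorm_le) (simp add: norm_mult)
    qed auto
    then show ?thesis by simp
  qed
  finally show ?thesis by simp
qed

text \<open>The unperturbed exponential has mean zero, so only the change of the exponential, at
  most |K| B, contributes. There is no decay in K, but a factor that tends to 0 with B.\<close>

lemma mean_phase_small:
  assumes \<delta>: "continuous_on UNIV \<delta>" "\<And>t. \<bar>\<delta> t\<bar> \<le> B" and K: "K \<noteq> 0" and l: "\<bar>l\<bar> \<le> 1"
  shows "norm (mean (\<lambda>t. cis (of_int K * (t + l * \<delta> t)))) \<le> \<bar>of_int K\<bar> * B"
proof -
  have c1: "continuous_on UNIV (\<lambda>t. cis (of_int K * (t + l * \<delta> t)))" and c2: "continuous_on UNIV (\<lambda>t. cis (of_int K * t))"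
    by (intro continuous_intros \<delta>(1))+
  have "mean (\<lambda>t. cis (of_int K * (t + l * \<delta> t))) = mean (\<lambda>t. cis (of_int K * (t + l * \<delta> t)) - cis (of_int K * t))"
    unfolding mean_diff[OF c1 c2] mean_cis[OF K] by simp
  also have "norm \<dots> \<le> \<bar>of_int K\<bar> * B"
  proof (rule mean_bound[OF continuous_on_diff[OF c1 c2]])
    fix t
    have "norm (cis (of_int K * (t + l * \<delta> t)) - cis (of_int K * t)) \<le> \<bar>of_int K * (l * \<delta> t)\<bar>"
      using norm_cis_diff_le[of "of_int K * t" "of_int K * (l * \<delta> t)"] by (simp add: distrib_left)
    also have "\<dots> \<le> \<bar>of_int K\<bar> * (1 * B)"
      unfolding abs_mult using \<delta>(2)[of t] l by (intro mult_mono mult_nonneg_nonneg) auto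
    finally show "norm (cis (of_int K * (t + l * \<delta> t)) - cis (of_int K * t)) \<le> \<bar>of_int K\<bar> * B" by simp
  qed
  finally show ?thesis .
qed

text \<open>Interpolates between a high-order decay estimate and a bound by the perturbation parameter.\<close>

lemma interpolate_bound:
  fixes x k C B \<eta> :: real
  assumes "x \<ge> 0" "k > 0" "x * k ^ (2 * N + p) \<le> C" "x \<le> k ^ p * B" "C * B \<le> \<eta>\<^sup>2" "\<eta> \<ge> 0" "B \<ge> 0"
  shows "x \<le> \<eta> * (1 / k ^ N)"
proof -
  have "k ^ (2 * N) = k ^ N * k ^ N"
    by (simp add: mult_2 power_add)
  then have "(x * k ^ N)\<^sup>2 * k ^ p = (x * k ^ (2 * N + p)) * x"
    by (simp only: power2_eq_square power_add mult_ac)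
  also have "\<dots> \<le> C * (k ^ p * B)"
    using assms by (intro mult_mono) (auto intro: order_trans[rotated])
  also have "\<dots> \<le> \<eta>\<^sup>2 * k ^ p"
    using mult_right_mono[OF assms(5), of "k ^ p"] assms(2) by (simp add: mult_ac)
  finally have "(x * k ^ N)\<^sup>2 \<le> \<eta>\<^sup>2"
    using assms(2) by simp
  then have "x * k ^ N \<le> \<eta>"
    using assms(6) by (rule power2_le_imp_le)
  then show ?thesis
    using assms(2) by (simp add: field_simps)
qed

text \<open>The gluing is magnified by 1/\<epsilon> at x0 and normalized to slope 1 there, which
  makes the perturbation and its derivative O(\<epsilon>). High-order decay with constants
  independent of \<epsilon> is then traded against this smallness.\<close>

theorem local_welding:
  fixes \<rho> :: "real \<Rightarrow> real"
  assumes \<rho>: "smooth_on UNIV \<rho>" and pos: "rderiv \<rho> x0 > 0"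
  obtains \<epsilon> a b where "\<epsilon> > 0" "rapid a" "rapid b"
    "1 + exp_series cutoff_exp (\<lambda>n. \<i> * of_nat n * a n) 0 \<noteq> 0"
    "\<And>t s. \<bar>t\<bar> \<le> pi / 4 \<Longrightarrow> s = (\<rho> (x0 + \<epsilon> * t) - \<rho> x0) / (\<epsilon> * rderiv \<rho> x0) \<Longrightarrow>
       of_real t + exp_series cutoff_exp a (of_real t) = of_real s + exp_series cutoff_exp b (- of_real s)"
proof -
  define A where "A = rderiv \<rho> x0"
  note A_eq = A_def
  have A: "A > 0" using pos by (simp add: A_eq)
  define K where "K = kappa_bound"
  have K: "K \<ge> 0" "\<And>t. \<bar>kappa t\<bar> \<le> K"
    unfolding K_def by (rule kappa_bound_nonneg, rule kappa_bound)
  \<comment> \<open>The deviation of the rescaled gluing from the identity. Composition with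
    \<open>kappa\<close> turns it into a periodic function that is unchanged for |t| \<le>
    pi/4.\<close>
  define d where "d = (\<lambda>\<epsilon> x. (\<rho> (x0 + \<epsilon> * x) - \<rho> x0) / (\<epsilon> * A) - x)"
  define \<delta> where "\<delta> = (\<lambda>\<epsilon> t. d \<epsilon> (kappa t))"
  define \<delta>' where "\<delta>' = (\<lambda>\<epsilon> t. (rderiv \<rho> (x0 + \<epsilon> * kappa t) * (1 / A) + (- 1)) * rderiv kappa t)"
  have \<rho>_der: "(\<rho> has_real_derivative rderiv \<rho> x) (at x)" for x
    by (rule smooth_on_has_real_derivative[OF \<rho>])
  have d_der: "(d \<epsilon> has_real_derivative rderiv \<rho> (x0 + \<epsilon> * x) * (1 / A) + (- 1)) (at x)" if "\<epsilon> > 0" for \<epsilon> x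
  proof -
    have "((\<lambda>x. x0 + \<epsilon> * x) has_real_derivative \<epsilon>) (at x)"
      by (auto intro!: derivative_eq_intros)
    from DERIV_diff[OF DERIV_cdivide[OF DERIV_diff[OF DERIV_chain2[OF \<rho>_der this] DERIV_const[of "\<rho> x0"]], of "\<epsilon> * A"] DERIV_ident]
    show ?thesis
      using that A by (simp add: d_def)
  qed
  have \<delta>_der: "(\<delta> \<epsilon> has_real_derivative \<delta>' \<epsilon> t) (at t)" if "\<epsilon> > 0" for \<epsilon> t
    unfolding \<delta>_def \<delta>'_def
    by (rule DERIV_chain2[OF d_der[OF that] smooth_on_has_real_derivative[OF smooth_on_kappa]])
  have \<delta>_per: "\<delta> \<epsilon> (t + 2 * pi) = \<delta> \<epsilon> t" for \<epsilon> t
    by (simp add: \<delta>_def kappa_periodic)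
  have \<delta>_zero: "\<delta> \<epsilon> 0 = 0" for \<epsilon>
    by (simp add: \<delta>_def d_def kappa_eq)
  have \<delta>'_smooth: "uniform_Ck N {0..1} (\<lambda>\<epsilon> t. complex_of_real (\<delta>' \<epsilon> t))" for N
    unfolding \<delta>'_def of_real_mult of_real_add
    by (intro uniform_Ck_mult uniform_Ck_add uniform_Ck_const uniform_Ck_rescaled smooth_on_rderiv \<rho>
        uniform_Ck_smooth_periodic smooth_on_kappa rderiv_periodic kappa_periodic)
  obtain M where M: "M \<ge> 0" "\<And>x. x \<in> cball x0 K \<Longrightarrow> \<bar>rderiv (rderiv \<rho>) x\<bar> \<le> M"
  proof -
    have "compact (rderiv (rderiv \<rho>) ` cball x0 K)"
      using smooth_on_continuous[OF smooth_on_rderiv[OF smooth_on_rderiv[OF \<rho>]]]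
      by (intro compact_continuous_image) (auto intro: continuous_on_subset)
    then obtain B where B: "\<And>x. x \<in> cball x0 K \<Longrightarrow> \<bar>rderiv (rderiv \<rho>) x\<bar> \<le> B"
      using compact_imp_bounded[of "rderiv (rderiv \<rho>) ` cball x0 K"] unfolding bounded_iff real_norm_def by blast
    have "0 \<le> B" using B[of x0] K(1) by (simp add: order_trans[OF abs_ge_zero])
    then show ?thesis using B that by blast
  qed
  have near: "x0 + \<epsilon> * x \<in> cball x0 K" "\<bar>\<epsilon> * x\<bar> \<le> \<epsilon> * K" if "0 < \<epsilon>" "\<epsilon> \<le> 1" "\<bar>x\<bar> \<le> K" for \<epsilon> x
  proof -
    show "\<bar>\<epsilon> * x\<bar> \<le> \<epsilon> * K"
      unfolding abs_mult using that by (intro mult_mono) auto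
    moreover have "\<epsilon> * K \<le> 1 * K" using that K(1) by (intro mult_right_mono) auto
    ultimately show "x0 + \<epsilon> * x \<in> cball x0 K" by (simp add: dist_real_def)
  qed
  have d'_small: "\<bar>rderiv \<rho> (x0 + \<epsilon> * x) * (1 / A) + (- 1)\<bar> \<le> \<epsilon> * (M * K / A)"
    if e: "0 < \<epsilon>" "\<epsilon> \<le> 1" "\<bar>x\<bar> \<le> K" for \<epsilon> x
  proof -
    have "norm (rderiv \<rho> (x0 + \<epsilon> * x) - rderiv \<rho> x0) \<le> M * norm ((x0 + \<epsilon> * x) - x0)"
    proof (rule field_differentiable_bound[of "cball x0 K"])
      show "(rderiv \<rho> has_real_derivative rderiv (rderiv \<rho>) x) (at x within cball x0 K)" for x
        using smooth_on_has_real_derivative[OF smooth_on_rderiv[OF \<rho>]] has_field_derivative_at_within by blast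
    qed (use M K near[OF e] in auto)
    also have "\<dots> \<le> M * (\<epsilon> * K)"
      using near(2)[OF e] M(1) by (intro mult_left_mono) auto
    finally have "\<bar>rderiv \<rho> (x0 + \<epsilon> * x) - A\<bar> / A \<le> M * (\<epsilon> * K) / A"
      using A by (intro divide_right_mono) (auto simp: A_def)
    moreover have "rderiv \<rho> (x0 + \<epsilon> * x) * (1 / A) + (- 1) = (rderiv \<rho> (x0 + \<epsilon> * x) - A) / A"
      using A by (simp add: field_simps)
    ultimately show ?thesis
      using A by (simp add: mult_ac)
  qed
  obtain L where L: "L \<ge> 0" "\<And>t. \<bar>rderiv kappa t\<bar> \<le> L"
  proof -
    obtain B where B: "\<And>t. norm (rderiv kappa t) \<le> B"
      using continuous_periodic_bounded[OF smooth_on_continuous[OF smooth_on_rderiv[OF smooth_on_kappa]] _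
          rderiv_periodic[OF smooth_on_kappa kappa_periodic]] by auto
    have "B \<ge> 0" by (rule order_trans[OF norm_ge_zero B])
    then show ?thesis using B that[of B] by simp
  qed
  define C1 where "C1 = M * K / A * L"
  define C2 where "C2 = M * K / A * K"
  have C12: "C1 \<ge> 0" "C2 \<ge> 0"
    using M(1) K(1) A L(1) by (auto simp: C1_def C2_def)
  have \<delta>'_small: "\<bar>\<delta>' \<epsilon> t\<bar> \<le> \<epsilon> * C1" if "0 < \<epsilon>" "\<epsilon> \<le> 1" for \<epsilon> t
  proof -
    have "\<bar>\<delta>' \<epsilon> t\<bar> \<le> (\<epsilon> * (M * K / A)) * L"
      unfolding \<delta>'_def abs_mult using d'_small[OF that K(2)[of t]] L(2)[of t]
      by (intro mult_mono) (auto intro: order_trans[OF abs_ge_zero])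
    then show ?thesis by (simp add: C1_def mult.assoc)
  qed
  have \<delta>_small: "\<bar>\<delta> \<epsilon> t\<bar> \<le> \<epsilon> * C2" if e: "0 < \<epsilon>" "\<epsilon> \<le> 1" for \<epsilon> t
  proof -
    have "norm (d \<epsilon> (kappa t) - d \<epsilon> 0) \<le> (\<epsilon> * (M * K / A)) * norm (kappa t - 0)"
    proof (rule field_differentiable_bound[of "cball 0 K"])
      show "(d \<epsilon> has_real_derivative rderiv \<rho> (x0 + \<epsilon> * x) * (1 / A) + (- 1)) (at x within cball 0 K)" for x
        using d_der[OF e(1)] has_field_derivative_at_within by blast
      show "norm (rderiv \<rho> (x0 + \<epsilon> * x) * (1 / A) + - 1) \<le> \<epsilon> * (M * K / A)" if "x \<in> cball 0 K" for x
        using d'_small[OF e, of x] that by simp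
    qed (use K in auto)
    also have "\<dots> \<le> (\<epsilon> * (M * K / A)) * K"
      using K e M(1) A by (intro mult_left_mono) auto
    finally show ?thesis
      by (simp add: \<delta>_def d_def C2_def mult.assoc)
  qed
  \<comment> \<open>Chosen so that |\<delta>'| \<le> 1/2; then t + l \<delta>(t) has no stationary
    point for any l in [0, 1].\<close>
  define e1 where "e1 = min 1 (1 / (2 * (1 + C1)))"
  have e1: "e1 > 0" "e1 \<le> 1"
    using C12 by (auto simp: e1_def)
  have half: "\<bar>\<delta>' \<epsilon> t\<bar> \<le> 1 / 2" if "0 < \<epsilon>" "\<epsilon> \<le> e1" for \<epsilon> t
  proof -
    have "\<epsilon> * C1 \<le> 1 / (2 * (1 + C1)) * (1 + C1)"
      using that C12 by (intro mult_mono) (auto simp: e1_def)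
    also have "\<dots> = 1 / 2"
      using C12 by simp
    finally show ?thesis
      using \<delta>'_small[of \<epsilon> t] that e1 by linarith
  qed
  \<comment> \<open>Pairs (\<epsilon>, l): every phase in the matrix coefficients is an integer
    multiple of t + l \<delta>(t).\<close>
  define I where "I = {0<..e1} \<times> {0..1::real}"
  have phase: "\<exists>C. \<forall>i\<in>I. \<forall>k::int. k \<noteq> 0 \<longrightarrow>
      norm (mean (\<lambda>t. 1 * cis (of_int k * (t + snd i * \<delta> (fst i) t)))) * \<bar>of_int k\<bar> ^ N \<le> C" for N
  proof (rule nonstationary_phase[where \<psi>' = "\<lambda>i t. 1 + snd i * \<delta>' (fst i) t"])
    fix i t assume i: "i \<in> I"
    then have f: "0 < fst i" "fst i \<le> e1" "0 \<le> snd i" "snd i \<le> 1" by (auto simp: I_def)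
    show "((\<lambda>t. t + snd i * \<delta> (fst i) t) has_real_derivative 1 + snd i * \<delta>' (fst i) t) (at t)"
      by (rule DERIV_add[OF DERIV_ident DERIV_cmult[OF \<delta>_der[OF f(1)]]])
    show "t + 2 * pi + snd i * \<delta> (fst i) (t + 2 * pi) = t + snd i * \<delta> (fst i) t + 2 * pi"
      by (simp add: \<delta>_per)
  next
    have b: "norm (complex_of_real (1 + snd i * \<delta>' (fst i) t)) \<ge> 1 / 2" if "i \<in> I" for i t
    proof -
      have f: "0 < fst i" "fst i \<le> e1" "0 \<le> snd i" "snd i \<le> 1" using that by (auto simp: I_def)
      have "\<bar>snd i * \<delta>' (fst i) t\<bar> \<le> 1 * (1 / 2)"
        unfolding abs_mult using f half[OF f(1,2), of t] by (intro mult_mono) auto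
      then show ?thesis unfolding norm_of_real by linarith
    qed
    then show "1 + snd i * \<delta>' (fst i) t \<noteq> 0" if "i \<in> I" for i t
      using b[OF that, of t] by (auto simp del: of_real_add)
    have "uniform_Ck N I (\<lambda>i t. complex_of_real (\<delta>' (fst i) t))"
      by (rule uniform_Ck_reindex[OF \<delta>'_smooth]) (use e1 in \<open>auto simp: I_def\<close>)
    then have "uniform_Ck N I (\<lambda>i t. 1 + complex_of_real (snd i) * complex_of_real (\<delta>' (fst i) t))"
      by (intro uniform_Ck_add uniform_Ck_const uniform_Ck_mult uniform_Ck_param[where B = 1]) (auto simp: I_def)
    then have "uniform_Ck N I (\<lambda>i t. complex_of_real (1 + snd i * \<delta>' (fst i) t))"
      by simp
    then show "uniform_Ck N I (\<lambda>i t. inverse (complex_of_real (1 + snd i * \<delta>' (fst i) t)))"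
      by (rule uniform_Ck_inverse[rotated, OF _ b]) auto
    show "uniform_Ck N I (\<lambda>i t. 1)"
      by (rule uniform_Ck_const)
  qed
  have \<delta>_cont: "continuous_on UNIV (\<delta> \<epsilon>)" if "\<epsilon> > 0" for \<epsilon>
    using \<delta>_der[OF that] by (auto intro!: continuous_at_imp_continuous_on DERIV_isCont)
  have \<delta>_smooth: "uniform_Ck N {0<..1} (\<lambda>\<epsilon> t. complex_of_real (\<delta> \<epsilon> t))" for N
  proof -
    have "\<bar>\<delta> \<epsilon> t\<bar> \<le> C2" if "0 < \<epsilon>" "\<epsilon> \<le> 1" for \<epsilon> t
      using \<delta>_small[OF that, of t] mult_right_mono[OF that(2) C12(2)] by linarith
    then have "uniform_Ck 0 {0<..1} (\<lambda>\<epsilon> t. complex_of_real (\<delta> \<epsilon> t))"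
      unfolding uniform_Ck_0_iff
      by (intro conjI ballI allI exI[of _ C2]) (auto intro!: continuous_intros \<delta>_cont simp: \<delta>_per)
    then have "uniform_Ck (Suc N) {0<..1} (\<lambda>\<epsilon> t. complex_of_real (\<delta> \<epsilon> t))"
    proof (rule uniform_Ck_SucI)
      show "((\<lambda>t. complex_of_real (\<delta> \<epsilon> t)) has_vector_derivative of_real (\<delta>' \<epsilon> t)) (at t)" if "\<epsilon> \<in> {0<..1}" for \<epsilon> t
        using that by (intro has_vector_derivative_of_real \<delta>_der) auto
      show "uniform_Ck N {0<..1} (\<lambda>\<epsilon> t. complex_of_real (\<delta>' \<epsilon> t))"
        by (rule uniform_Ck_reindex[OF \<delta>'_smooth, of _ "\<lambda>x. x"]) auto
    qed
    then show ?thesis by (rule uniform_Ck_Suc)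
  qed
  have coeff: "\<exists>C. \<forall>\<epsilon>\<in>{0<..1}. \<forall>k::int. k \<noteq> 0 \<longrightarrow>
      norm (mean (\<lambda>t. complex_of_real (\<delta> \<epsilon> t) * cis (of_int k * t))) * \<bar>of_int k\<bar> ^ N \<le> C" for N
    by (rule nonstationary_phase[where \<psi>' = "\<lambda>_ t. 1"]) (use \<delta>_smooth uniform_Ck_const[of N _ 1] in auto)
  \<comment> \<open>Meets both smallness requirements of the locale, since the sum Z of inverse
    squares and Z^2 are at most (1 + Z)^2.\<close>
  define \<eta> where "\<eta> = 1 / (8 * (1 + inv_square_sum)\<^sup>2)"
  have \<eta>: "\<eta> > 0" "\<eta> * inv_square_sum \<le> 1 / 8" "\<eta> * inv_square_sum * inv_square_sum \<le> 1 / 8"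
  proof -
    note Z = inv_square_sum_nonneg
    have e: "\<eta> * (1 + inv_square_sum)\<^sup>2 = 1 / 8"
      using Z by (simp add: \<eta>_def)
    show p: "\<eta> > 0" using Z by (simp add: \<eta>_def)
    have "inv_square_sum \<le> (1 + inv_square_sum)\<^sup>2" "inv_square_sum * inv_square_sum \<le> (1 + inv_square_sum)\<^sup>2"
      using Z by (auto simp: power2_eq_square algebra_simps)
    from this[THEN mult_left_mono[of _ _ \<eta>]] p e
    show "\<eta> * inv_square_sum \<le> 1 / 8" "\<eta> * inv_square_sum * inv_square_sum \<le> 1 / 8"
      by (auto simp: mult.assoc)
  qed
  \<comment> \<open>Interpolating decay of this order with the bound |k| \<epsilon> C2 leaves decay
    of order 5 = 3 + 2, to be shared between n and j. P and, below, Q are uniform in \<epsilon>, so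
    \<epsilon> may be chosen after them.\<close>
  from phase[of "2 * 5 + 1"] obtain P where P: "\<forall>i\<in>I. \<forall>k::int. k \<noteq> 0 \<longrightarrow>
      norm (mean (\<lambda>t. 1 * cis (of_int k * (t + snd i * \<delta> (fst i) t)))) * \<bar>of_int k\<bar> ^ (2 * 5 + 1) \<le> P" ..
  from coeff[of "2 * 3 + 0"] obtain Q where Q: "\<forall>\<epsilon>\<in>{0<..1}. \<forall>k::int. k \<noteq> 0 \<longrightarrow>
      norm (mean (\<lambda>t. complex_of_real (\<delta> \<epsilon> t) * cis (of_int k * t))) * \<bar>of_int k\<bar> ^ (2 * 3 + 0) \<le> Q" ..
  \<comment> \<open>A common positive bound for P C2 and Q C2, so that \<epsilon> \<le> \<eta>^2 / H
    serves both interpolations.\<close>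
  define H where "H = (1 + \<bar>P\<bar> + \<bar>Q\<bar>) * (1 + C2)"
  have H: "H > 0" using C12 by (auto simp: H_def intro!: mult_pos_pos)
  define \<epsilon> where "\<epsilon> = min e1 (\<eta>\<^sup>2 / H)"
  have \<epsilon>: "\<epsilon> > 0" "\<epsilon> \<le> e1" "\<epsilon> \<le> 1"
    using e1 \<eta>(1) H by (auto simp: \<epsilon>_def)
  have "\<epsilon> * H \<le> \<eta>\<^sup>2"
  proof -
    have "\<epsilon> * H \<le> \<eta>\<^sup>2 / H * H"
      using H by (intro mult_right_mono) (auto simp: \<epsilon>_def)
    then show ?thesis using H by simp
  qed
  then have PQ: "P * (\<epsilon> * C2) \<le> \<eta>\<^sup>2" "Q * (\<epsilon> * C2) \<le> \<eta>\<^sup>2"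
  proof -
    have PQ: "P * C2 \<le> H" "Q * C2 \<le> H"
      unfolding H_def using C12 by (intro mult_mono; simp)+
    show "P * (\<epsilon> * C2) \<le> \<eta>\<^sup>2" "Q * (\<epsilon> * C2) \<le> \<eta>\<^sup>2"
      using order_trans[OF mult_left_mono[OF PQ(1) less_imp_le[OF \<epsilon>(1)]] \<open>\<epsilon> * H \<le> \<eta>\<^sup>2\<close>]
        order_trans[OF mult_left_mono[OF PQ(2) less_imp_le[OF \<epsilon>(1)]] \<open>\<epsilon> * H \<le> \<eta>\<^sup>2\<close>]
      by (simp_all only: mult.left_commute[of P \<epsilon>] mult.left_commute[of Q \<epsilon>])
  qed
  have phase_small: "norm (mean (\<lambda>t. cis (of_int k * (t + l * \<delta> \<epsilon> t)))) \<le> \<eta> * (1 / \<bar>of_int k\<bar> ^ 5)"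
    if "k \<noteq> 0" "0 \<le> l" "l \<le> 1" for k :: int and l
  proof (rule interpolate_bound[where p = 1 and C = P and B = "\<epsilon> * C2"])
    show "norm (mean (\<lambda>t. cis (of_int k * (t + l * \<delta> \<epsilon> t)))) * \<bar>of_int k\<bar> ^ (2 * 5 + 1) \<le> P"
      using P[rule_format, of "(\<epsilon>, l)" k] that \<epsilon> by (simp add: I_def)
    show "norm (mean (\<lambda>t. cis (of_int k * (t + l * \<delta> \<epsilon> t)))) \<le> \<bar>of_int k\<bar> ^ 1 * (\<epsilon> * C2)"
      using mean_phase_small[OF \<delta>_cont[OF \<epsilon>(1)] \<delta>_small[OF \<epsilon>(1,3)] that(1), of l] that by simp
  qed (use that PQ \<eta> \<epsilon> C12 in auto)
  define R where "R = (\<lambda>t. t + \<delta> \<epsilon> t)"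
  \<comment> \<open>The two phases have the same sign and add up: n t + (j+1) R(t) = (n+j+1) (t + l
    \<delta>(t)) with l = (j+1)/(n+j+1) in [0, 1]. This is why coefficients between frequencies of
    opposite sign have no stationary phase.\<close>
  have S_eq: "cis (- (real n * t)) * cis (- (real (Suc j) * R t)) =
      cis (of_int (- int (Suc (n + j))) * (t + (real (Suc j) / real (Suc (n + j))) * \<delta> \<epsilon> t))" for n j t
    unfolding cis_mult R_def by (rule arg_cong[of _ _ cis]) (simp add: field_simps)
  have S'_eq: "cis (real (Suc j) * t) * cis (real n * R t) =
      cis (of_int (int (Suc (n + j))) * (t + (real n / real (Suc (n + j))) * \<delta> \<epsilon> t))" for n j t
    unfolding cis_mult R_def by (rule arg_cong[of _ _ cis]) (simp add: field_simps)
  \<comment> \<open>As n + j + 1 dominates both n + 1 and j + 1, decay in the sum can be split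
    between the two indices.\<close>
  have pow: "1 / real (Suc (n + j)) ^ (p + p') \<le> (1 / real (Suc n) ^ p) * (1 / real (Suc j) ^ p')" for n j p p'
  proof -
    have "real (Suc n) ^ p * real (Suc j) ^ p' \<le> real (Suc (n + j)) ^ p * real (Suc (n + j)) ^ p'"
      by (intro mult_mono power_mono) auto
    then show ?thesis
      unfolding times_divide_times_eq power_add mult_1_left by (intro divide_left_mono) (auto simp del: of_nat_Suc)
  qed
  interpret small_welding "\<delta> \<epsilon>" "\<delta>' \<epsilon>" \<eta> R
  proof
    show "(\<delta> \<epsilon> has_real_derivative \<delta>' \<epsilon> t) (at t)" for t by (rule \<delta>_der[OF \<epsilon>(1)])
    show "\<delta> \<epsilon> (t + 2 * pi) = \<delta> \<epsilon> t" for t by (rule \<delta>_per)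
    show "\<delta> \<epsilon> 0 = 0" by (rule \<delta>_zero)
    show "\<bar>\<delta>' \<epsilon> t\<bar> \<le> 1 / 2" for t by (rule half[OF \<epsilon>(1,2)])
    show "uniform_Ck N {()} (\<lambda>_ t. complex_of_real (\<delta>' \<epsilon> t))" for N
      by (rule uniform_Ck_reindex[OF \<delta>'_smooth, of _ "\<lambda>_. \<epsilon>"]) (use \<epsilon> in auto)
    show "0 \<le> \<eta>" "\<eta> * inv_square_sum \<le> 1 / 8" "\<eta> * inv_square_sum * inv_square_sum \<le> 1 / 8"
      using \<eta> by auto
    show "R = (\<lambda>t. t + \<delta> \<epsilon> t)" by (rule R_def)
    fix n j
    have "norm (mean (\<lambda>t. cis (- (real n * t)) * cis (- (real (Suc j) * R t)))) \<le> \<eta> * (1 / \<bar>of_int (- int (Suc (n + j)))\<bar> ^ 5)"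
      unfolding S_eq by (rule phase_small) (auto simp: field_simps)
    also have "\<dots> = \<eta> * (1 / real (Suc (n + j)) ^ (3 + 2))"
      unfolding of_int_minus abs_minus_cancel by simp
    also have "\<dots> \<le> \<eta> * ((1 / real (Suc n) ^ 3) * (1 / real (Suc j) ^ 2))"
      using \<eta>(1) by (intro mult_left_mono pow) auto
    finally show "norm (mean (\<lambda>t. cis (- (real n * t)) * cis (- (real (Suc j) * R t)))) \<le> \<eta> * (1 / real (Suc n) ^ 3) * (1 / real (Suc j) ^ 2)"
      by (simp only: mult.assoc)
    have "norm (mean (\<lambda>t. cis (real (Suc j) * t) * cis (real n * R t))) \<le> \<eta> * (1 / \<bar>of_int (int (Suc (n + j)))\<bar> ^ 5)"
      unfolding S'_eq by (rule phase_small) (auto simp: field_simps)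
    also have "\<dots> \<le> \<eta> * (1 / real (Suc (n + j)) ^ (2 + 2))"
      using \<eta>(1) by (intro mult_left_mono divide_left_mono) (auto intro!: power_increasing)
    also have "\<dots> \<le> \<eta> * ((1 / real (Suc n) ^ 2) * (1 / real (Suc j) ^ 2))"
      using \<eta>(1) by (intro mult_left_mono pow) auto
    finally show "norm (mean (\<lambda>t. cis (real (Suc j) * t) * cis (real n * R t))) \<le> \<eta> * (1 / real (Suc n) ^ 2) * (1 / real (Suc j) ^ 2)"
      by (simp only: mult.assoc)
    show "norm (mean (\<lambda>t. complex_of_real (\<delta> \<epsilon> t) * cis (real (Suc j) * t))) \<le> \<eta> * (1 / real (Suc j) ^ 3)"
    proof (rule interpolate_bound[where p = 0 and C = Q and B = "\<epsilon> * C2"])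
      show "norm (mean (\<lambda>t. complex_of_real (\<delta> \<epsilon> t) * cis (real (Suc j) * t))) * real (Suc j) ^ (2 * 3 + 0) \<le> Q"
        using Q[rule_format, of \<epsilon> "int (Suc j)"] \<epsilon> by simp
      have "norm (mean (\<lambda>t. complex_of_real (\<delta> \<epsilon> t) * cis (real (Suc j) * t))) \<le> \<epsilon> * C2"
        by (rule mean_bound) (use \<delta>_small[OF \<epsilon>(1,3)] in \<open>auto intro!: continuous_intros \<delta>_cont \<epsilon> simp: norm_mult\<close>)
      then show "norm (mean (\<lambda>t. complex_of_real (\<delta> \<epsilon> t) * cis (real (Suc j) * t))) \<le> real (Suc j) ^ 0 * (\<epsilon> * C2)"
        by simp
    qed (use PQ \<eta> \<epsilon> C12 in auto)
  next
    fix N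
    from phase[of "N + 2"] obtain C where C: "\<forall>i\<in>I. \<forall>k::int. k \<noteq> 0 \<longrightarrow>
      norm (mean (\<lambda>t. 1 * cis (of_int k * (t + snd i * \<delta> (fst i) t)))) * \<bar>of_int k\<bar> ^ (N + 2) \<le> C" ..
    have "norm (mean (\<lambda>t. cis (- (real n * t)) * cis (- (real (Suc j) * R t)))) * real (Suc n) ^ N \<le> C * (1 / real (Suc j) ^ 2)" for n j
    proof -
      let ?x = "norm (mean (\<lambda>t. cis (- (real n * t)) * cis (- (real (Suc j) * R t))))"
      have c: "?x * real (Suc (n + j)) ^ (N + 2) \<le> C"
        unfolding S_eq using C[rule_format, of "(\<epsilon>, real (Suc j) / real (Suc (n + j)))" "- int (Suc (n + j))"] \<epsilon>
        by (simp add: I_def field_simps)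
      have "real (Suc n) ^ N * real (Suc j) ^ 2 \<le> real (Suc (n + j)) ^ N * real (Suc (n + j)) ^ 2"
        by (intro mult_mono power_mono) auto
      then have "?x * (real (Suc n) ^ N * real (Suc j) ^ 2) \<le> ?x * real (Suc (n + j)) ^ (N + 2)"
        unfolding power_add by (intro mult_left_mono) auto
      with c have "?x * (real (Suc n) ^ N * real (Suc j) ^ 2) \<le> C" by linarith
      then show ?thesis
        by (simp add: field_simps del: of_nat_Suc)
    qed
    then show "\<exists>C. \<forall>n j. norm (mean (\<lambda>t. cis (- (real n * t)) * cis (- (real (Suc j) * R t)))) *
         real (Suc n) ^ N \<le> C * (1 / real (Suc j) ^ 2)" by blast
  qed
  obtain a b where ab: "rapid a" "rapid b"
    "\<And>t. of_real t + exp_series cutoff_exp a (of_real t) = of_real (R t) + exp_series cutoff_exp b (- of_real (R t))"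
    "1 + exp_series cutoff_exp (\<lambda>n. \<i> * of_nat n * a n) 0 \<noteq> 0"
    using welding by blast
  show ?thesis
  proof (rule that[OF \<epsilon>(1) ab(1,2,4)])
    fix t s assume t: "\<bar>t\<bar> \<le> pi / 4" and s: "s = (\<rho> (x0 + \<epsilon> * t) - \<rho> x0) / (\<epsilon> * rderiv \<rho> x0)"
    have "R t = s"
      using kappa_eq[OF t] s by (simp add: R_def \<delta>_def d_def A_eq)
    then show "of_real t + exp_series cutoff_exp a (of_real t) = of_real s + exp_series cutoff_exp b (- of_real s)"
      using ab(3)[of t] by simp
  qed
qed

section \<open>Complex differentiability up to the boundary\<close>

lemma linear_complex_expand:
  fixes D :: "complex \<Rightarrow> 'b::real_vector"
  assumes "linear D"
  shows "D v = Re v *\<^sub>R D 1 + Im v *\<^sub>R D \<i>"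
proof -
  have "v = Re v *\<^sub>R 1 + Im v *\<^sub>R \<i>" by (simp add: complex_eq_iff)
  then have "D v = D (Re v *\<^sub>R 1 + Im v *\<^sub>R \<i>)" by simp
  also have "\<dots> = Re v *\<^sub>R D 1 + Im v *\<^sub>R D \<i>"
    by (simp only: linear_add[OF assms] linear_cmul[OF assms])
  finally show ?thesis .
qed

lemma has_field_derivative_complexI:
  fixes g :: "complex \<Rightarrow> complex"
  assumes "(g has_derivative D) (at z)" "D \<i> = \<i> * D 1"
  shows "(g has_field_derivative D 1) (at z)"
proof -
  have "D = (*) (D 1)"
  proof
    fix v
    show "D v = D 1 * v"
      using linear_complex_expand[OF has_derivative_linear[OF assms(1)], of v] assms(2)
      by (simp add: complex_eq_iff algebra_simps)
  qed
  then show ?thesis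
    using assms(1) by (metis has_field_derivative_def)
qed

text \<open>The Cauchy-Riemann defect is continuous on W and vanishes on S, hence also at limit
  points of S in W.\<close>

lemma smooth_complex_derivative_closure:
  fixes g :: "complex \<Rightarrow> complex"
  assumes "open W" "smooth_on W g" and d: "\<And>\<zeta>. \<zeta> \<in> W \<inter> S \<Longrightarrow> \<exists>b. (g has_field_derivative b) (at \<zeta>)"
    and z: "z \<in> W" "z \<in> closure S"
  shows "\<exists>b. (g has_field_derivative b) (at z)"
proof -
  let ?h = "\<lambda>\<zeta>. frechet_derivative g (at \<zeta>) \<i> - \<i> * frechet_derivative g (at \<zeta>) 1"
  have h0: "?h \<zeta> = 0" if "\<zeta> \<in> W \<inter> S" for \<zeta>
  proof -
    from d[OF that] obtain b where "(g has_derivative (*) b) (at \<zeta>)"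
      by (auto simp: has_field_derivative_def)
    then have "frechet_derivative g (at \<zeta>) = (*) b"
      using frechet_derivative_at by metis
    then show ?thesis by simp
  qed
  have ch: "continuous_on W ?h"
    by (intro continuous_intros smooth_on_continuous smooth_on_frechet_derivative assms(2))
  have "?h z = 0"
  proof (rule ccontr)
    assume "?h z \<noteq> 0"
    then have "z \<in> W \<inter> ?h -` (- {0})" using z by simp
    moreover have "open (W \<inter> ?h -` (- {0}))"
      by (rule continuous_open_preimage[OF ch assms(1)]) auto
    ultimately have "(W \<inter> ?h -` (- {0})) \<inter> S \<noteq> {}"
      using z(2) open_Int_closure_eq_empty[of "W \<inter> ?h -` (- {0})" S] by blast
    then show False using h0 by auto
  qed
  then show ?thesis
    using has_field_derivative_complexI[OF smooth_on_has_derivative[OF assms(2) z(1)]] by auto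
qed

lemma open_half_plane_interior: "open (half_plane s - \<real>)"
  and closure_half_plane_interior: "closure (half_plane s - \<real>) = half_plane s"
  and closed_half_plane: "closed (half_plane s)"
proof -
  have U: "half_plane Upper - \<real> = {z. Im z > 0}" and L: "half_plane Lower - \<real> = {z. Im z < 0}"
    by (auto simp: complex_is_Real_iff)
  show "open (half_plane s - \<real>)"
    by (cases s) (simp_all only: U L open_halfspace_Im_gt open_halfspace_Im_lt)
  have "closure {z. Im z > 0} = {z. Im z \<ge> 0}" "closure {z. Im z < 0} = {z. Im z \<le> 0}"
    using closure_halfspace_gt[of \<i> 0] closure_halfspace_lt[of \<i> 0] by (simp_all add: inner_complex_def)
  then show "closure (half_plane s - \<real>) = half_plane s"
    by (cases s) (simp_all only: U L, simp_all)
  show "closed (half_plane s)"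
    by (cases s) (simp_all add: closed_halfspace_Im_ge closed_halfspace_Im_le)
qed

text \<open>The interior of the half plane is dense in it, so the Cauchy-Riemann equation of the
  smooth extension persists at boundary points. Beyond the axis the extension is merely
  smooth.\<close>

lemma half_plane_smooth_extension:
  assumes T: "open T" and z: "z \<in> half_plane s \<inter> T"
    and sm: "smooth_up_to_boundary (half_plane s \<inter> T) f" and hol: "f holomorphic_on (half_plane s - \<real>) \<inter> T"
  obtains W g where "open W" "z \<in> W" "W \<subseteq> T" "smooth_on W g"
    "\<And>\<zeta>. \<zeta> \<in> half_plane s \<inter> W \<Longrightarrow> g \<zeta> = f \<zeta>"
    "\<And>\<zeta>. \<zeta> \<in> half_plane s \<inter> W \<Longrightarrow> \<exists>b. (g has_field_derivative b) (at \<zeta>)"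
proof -
  obtain W0 g where W0: "open W0" "z \<in> W0" "smooth_on W0 g" "\<forall>\<zeta>\<in>half_plane s \<inter> T \<inter> W0. g \<zeta> = f \<zeta>"
    using sm z unfolding smooth_up_to_boundary_def by blast
  define W where "W = W0 \<inter> T"
  have W: "open W" "z \<in> W" "W \<subseteq> T" "smooth_on W g"
    using W0 T z smooth_on_subset[OF W0(3)] by (auto simp: W_def)
  have eq: "g \<zeta> = f \<zeta>" if "\<zeta> \<in> half_plane s \<inter> W" for \<zeta>
    using that W0(4) by (auto simp: W_def)
  have int: "\<exists>b. (g has_field_derivative b) (at \<zeta>)" if "\<zeta> \<in> W \<inter> (half_plane s - \<real>)" for \<zeta>
  proof -
    have o: "open ((half_plane s - \<real>) \<inter> W)"
      by (intro open_Int open_half_plane_interior W(1))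
    have "f holomorphic_on (half_plane s - \<real>) \<inter> W"
      by (rule holomorphic_on_subset[OF hol]) (use W(3) in auto)
    then have "g holomorphic_on (half_plane s - \<real>) \<inter> W"
      by (rule holomorphic_transform) (use eq in auto)
    then show ?thesis
      using holomorphic_derivI[OF _ o] that by blast
  qed
  have "\<exists>b. (g has_field_derivative b) (at \<zeta>)" if "\<zeta> \<in> half_plane s \<inter> W" for \<zeta>
    by (rule smooth_complex_derivative_closure[where S = "half_plane s - \<real>", OF W(1,4) int]) (use that closure_half_plane_interior in auto)
  with W eq show ?thesis using that by blast
qed

section \<open>Local inverses of smooth maps\<close>

text \<open>The mean value inequality on a ball, applied to g(z) - c z. Controlling the directions 1
  and i to within \<eta>/2 each controls every direction to within \<eta>.\<close>

lemma strictly_differentiable: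
  fixes g :: "complex \<Rightarrow> complex"
  assumes "open W" "smooth_on W g" "x \<in> W" "(g has_field_derivative c) (at x)" "\<eta> > 0"
  obtains r where "r > 0" "ball x r \<subseteq> W"
    "\<And>z w. z \<in> ball x r \<Longrightarrow> w \<in> ball x r \<Longrightarrow> norm (g z - g w - c * (z - w)) \<le> \<eta> * norm (z - w)"
proof -
  have fd: "frechet_derivative g (at x) = (*) c"
    using assms(4) frechet_derivative_at unfolding has_field_derivative_def by metis
  have cont: "continuous_on W (\<lambda>z. frechet_derivative g (at z) v)" for v
    by (intro smooth_on_continuous smooth_on_frechet_derivative assms(2))
  define N where "N v = W \<inter> (\<lambda>z. frechet_derivative g (at z) v) -` ball (c * v) (\<eta> / 2)" for v
  have "open (N 1 \<inter> N \<i>)"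
    unfolding N_def by (intro open_Int continuous_open_preimage[OF cont assms(1)]) auto
  moreover have "x \<in> N 1 \<inter> N \<i>"
    using assms(3,5) fd by (simp add: N_def)
  ultimately obtain r where r: "r > 0" "ball x r \<subseteq> N 1 \<inter> N \<i>"
    using open_contains_ball by blast
  have "norm (g z - g w - c * (z - w)) \<le> \<eta> * norm (z - w)" if zw: "z \<in> ball x r" "w \<in> ball x r" for z w
  proof -
    have "norm ((g z - c * z) - (g w - c * w)) \<le> \<eta> * norm (z - w)"
    proof (rule differentiable_bound[where f' = "\<lambda>z v. frechet_derivative g (at z) v - c * v"])
      fix u assume u: "u \<in> ball x r"
      then have uO: "u \<in> N 1" "u \<in> N \<i>" and uW: "u \<in> W"
        using r(2) by (auto simp: N_def)
      have D: "(g has_derivative frechet_derivative g (at u)) (at u)"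
        by (rule smooth_on_has_derivative[OF assms(2) uW])
      have "((\<lambda>z. g z - c * z) has_derivative (\<lambda>v. frechet_derivative g (at u) v - c * v)) (at u)"
        by (intro has_derivative_diff D has_derivative_mult_right has_derivative_ident)
      then show "((\<lambda>z. g z - c * z) has_derivative (\<lambda>v. frechet_derivative g (at u) v - c * v)) (at u within ball x r)"
        by (rule has_derivative_at_withinI)
      show "onorm (\<lambda>v. frechet_derivative g (at u) v - c * v) \<le> \<eta>"
      proof (rule onorm_le)
        fix v :: complex
        have "frechet_derivative g (at u) v - c * v =
            Re v *\<^sub>R (frechet_derivative g (at u) 1 - c * 1) + Im v *\<^sub>R (frechet_derivative g (at u) \<i> - c * \<i>)"
          unfolding linear_complex_expand[OF has_derivative_linear[OF D], of v]
          by (simp add: complex_eq_iff algebra_simps)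
        also have "norm \<dots> \<le> \<bar>Re v\<bar> * norm (frechet_derivative g (at u) 1 - c * 1) + \<bar>Im v\<bar> * norm (frechet_derivative g (at u) \<i> - c * \<i>)"
          by (rule order_trans[OF norm_triangle_ineq]) simp
        also have "\<dots> \<le> norm v * (\<eta> / 2) + norm v * (\<eta> / 2)"
          using uO abs_Re_le_cmod[of v] abs_Im_le_cmod[of v]
          by (intro add_mono mult_mono) (auto simp: N_def dist_norm norm_minus_commute)
        finally show "norm (frechet_derivative g (at u) v - c * v) \<le> \<eta> * norm v" by (simp add: mult.commute)
      qed
    qed (use zw in auto)
    then show ?thesis by (simp add: algebra_simps)
  qed
  moreover have "ball x r \<subseteq> W" using r(2) by (auto simp: N_def)
  ultimately show ?thesis using that r(1) by blast
qed

lemma strictly_differentiable_inj: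
  fixes g :: "complex \<Rightarrow> complex"
  assumes "\<And>z w. z \<in> S \<Longrightarrow> w \<in> S \<Longrightarrow> norm (g z - g w - c * (z - w)) \<le> \<eta> * norm (z - w)" "\<eta> < norm c"
  shows "inj_on g S"
proof (rule inj_onI, rule ccontr)
  fix z w assume zw: "z \<in> S" "w \<in> S" "g z = g w" "z \<noteq> w"
  have "norm c * norm (z - w) \<le> \<eta> * norm (z - w)"
    using assms(1)[OF zw(1,2)] zw(3) by (simp add: norm_mult)
  then show False using assms(2) zw(4) by simp
qed

text \<open>The segment from w to z meets the axis in a point q where G and H agree. Since |z - q| +
  |q - w| = |z - w|, the two one-sided estimates add up without loss.\<close>

lemma cross_real_axis:
  assumes est: "\<And>z w. z \<in> ball x r \<Longrightarrow> w \<in> ball x r \<Longrightarrow> norm (G z - G w - c * (z - w)) \<le> \<eta> * norm (z - w)"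
      "\<And>z w. z \<in> ball x r \<Longrightarrow> w \<in> ball x r \<Longrightarrow> norm (H z - H w - c * (z - w)) \<le> \<eta> * norm (z - w)"
    and match: "\<And>t. of_real t \<in> ball x r \<Longrightarrow> G (of_real t) = H (of_real t)"
    and z: "z \<in> ball x r" "Im z \<ge> 0" and w: "w \<in> ball x r" "Im w \<le> 0"
  shows "norm (G z - H w - c * (z - w)) \<le> \<eta> * norm (z - w :: complex)"
proof (cases "Im z = Im w")
  case True
  then have "w = of_real (Re w)" using z(2) w(2) by (simp add: complex_eq_iff)
  then have "G w = H w" using match[of "Re w"] w(1) by simp
  then show ?thesis using est(1)[OF z(1) w(1)] by simp
next
  case False
  define t where "t = - Im w / (Im z - Im w)"
  have t: "0 \<le> t" "t \<le> 1" using False z(2) w(2) by (auto simp: t_def divide_simps)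
  define q where "q = w + t *\<^sub>R (z - w)"
  have "q = (1 - t) *\<^sub>R w + t *\<^sub>R z" by (simp add: q_def algebra_simps)
  then have q: "q \<in> ball x r"
    using t convexD[OF convex_ball w(1) z(1), of "1 - t" t] by simp
  have "Im q = 0" using False by (simp add: q_def t_def field_simps)
  then have "q = of_real (Re q)" by (simp add: complex_eq_iff)
  then have Gq: "G q = H q" using match[of "Re q"] q by simp
  have zq: "z - q = (1 - t) *\<^sub>R (z - w)" and qw: "q - w = t *\<^sub>R (z - w)"
    by (simp_all add: q_def algebra_simps)
  have "G z - H w - c * (z - w) = (G z - G q - c * (z - q)) + (H q - H w - c * (q - w))"
    by (simp add: Gq algebra_simps)
  also have "norm \<dots> \<le> \<eta> * norm (z - q) + \<eta> * norm (q - w)"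
    by (rule order_trans[OF norm_triangle_ineq add_mono[OF est(1)[OF z(1) q] est(2)[OF q w(1)]]])
  also have "norm (z - q) = (1 - t) * norm (z - w)"
    unfolding zq using t by simp
  also have "norm (q - w) = t * norm (z - w)"
    unfolding qw using t by simp
  also have "\<eta> * ((1 - t) * norm (z - w)) + \<eta> * (t * norm (z - w)) = \<eta> * norm (z - w)"
    by (simp add: algebra_simps)
  finally show ?thesis .
qed

text \<open>In the application g is complex differentiable on one side of the axis only, so a real
  inverse function theorem is required. The differential is written as \<alpha> v + \<beta> cnj v;
  its determinant is \<Delta> = |\<alpha>|^2 - |\<beta>|^2 and its inverse is v \<mapsto> (cnj
  \<alpha> v - \<beta> cnj v) / \<Delta>. The conclusion covers all smaller open sets because the
  neighbourhood is shrunk later.\<close>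

lemma smooth_local_inverse:
  fixes g :: "complex \<Rightarrow> complex"
  assumes W: "open W" "smooth_on W g" "x \<in> W" and b: "(g has_field_derivative b) (at x)" "b \<noteq> 0"
  obtains V \<Psi> where "open V" "x \<in> V" "V \<subseteq> W" "inj_on g V"
    "\<And>V'. open V' \<Longrightarrow> V' \<subseteq> V \<Longrightarrow> open (g ` V') \<and> homeomorphism V' (g ` V') g \<Psi> \<and> smooth_on (g ` V') \<Psi>"
proof -
  let ?D = "\<lambda>z. frechet_derivative g (at z)"
  define \<alpha> where "\<alpha> = (\<lambda>z. (?D z 1 - \<i> * ?D z \<i>) * (1 / 2))"
  define \<beta> where "\<beta> = (\<lambda>z. (?D z 1 + \<i> * ?D z \<i>) * (1 / 2))"
  define \<Delta> where "\<Delta> = (\<lambda>z. \<alpha> z * cnj (\<alpha> z) - \<beta> z * cnj (\<beta> z))"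
  have sD: "smooth_on W (\<lambda>z. ?D z v)" for v
    by (rule smooth_on_frechet_derivative[OF W(2)])
  have s\<alpha>: "smooth_on W \<alpha>" and s\<beta>: "smooth_on W \<beta>"
    unfolding \<alpha>_def \<beta>_def by (intro smooth_on_mult smooth_on_diff smooth_on_add smooth_on_const sD W(1))+
  have s\<Delta>: "smooth_on W \<Delta>"
    unfolding \<Delta>_def
    by (intro smooth_on_diff smooth_on_mult s\<alpha> s\<beta> W(1) smooth_on_linear_compose[OF W(1) bounded_linear_cnj])
  have fdx: "?D x = (*) b"
    using b(1) frechet_derivative_at unfolding has_field_derivative_def by metis
  have "\<alpha> x = b" "\<beta> x = 0"
    by (simp_all add: \<alpha>_def \<beta>_def fdx complex_eq_iff)
  then have "\<Delta> x \<noteq> 0"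
    using b(2) by (simp add: \<Delta>_def)
  obtain r where r: "r > 0" "ball x r \<subseteq> W"
    "\<And>z w. z \<in> ball x r \<Longrightarrow> w \<in> ball x r \<Longrightarrow> norm (g z - g w - b * (z - w)) \<le> norm b / 2 * norm (z - w)"
    using strictly_differentiable[OF W b(1), of "norm b / 2"] b(2) by auto
  define V where "V = ball x r \<inter> (W \<inter> \<Delta> -` (- {0}))"
  have "open V"
    unfolding V_def by (intro open_Int open_ball continuous_open_preimage[OF smooth_on_continuous[OF s\<Delta>] W(1)]) auto
  have "x \<in> V" "V \<subseteq> W"
    using r(1) W(3) \<open>\<Delta> x \<noteq> 0\<close> by (auto simp: V_def)
  have inj: "inj_on g V"
    by (rule strictly_differentiable_inj[of _ _ b "norm b / 2"]) (use r(3) b(2) in \<open>auto simp: V_def\<close>)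
  have contg: "continuous_on V g"
    using smooth_on_continuous[OF W(2)] \<open>V \<subseteq> W\<close> continuous_on_subset by blast
  define \<Psi> where "\<Psi> = inv_into V g"
  have \<Psi>: "\<Psi> (g z) = z" if "z \<in> V" for z
    using inj that by (simp add: \<Psi>_def)
  have homeo: "open (g ` V')" "homeomorphism V' (g ` V') g \<Psi>" if V': "open V'" "V' \<subseteq> V" for V'
  proof -
    have c: "continuous_on V' g" and i: "inj_on g V'"
      using contg inj V'(2) continuous_on_subset inj_on_subset by blast+
    show "open (g ` V')" by (rule invariance_of_domain[OF c V'(1) i])
    have "continuous_on (g ` V') \<Psi>"
      by (rule continuous_on_inverse_open[OF V'(1) c]) (use \<Psi> V'(2) in auto)
    then show "homeomorphism V' (g ` V') g \<Psi>"
      using c \<Psi> V'(2) by (force simp: homeomorphism_def)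
  qed
  define D' where "D' = (\<lambda>y v. (cnj (\<alpha> (\<Psi> y)) * v - \<beta> (\<Psi> y) * cnj v) * inverse (\<Delta> (\<Psi> y)))"
  have der: "(\<Psi> has_derivative D' y) (at y)" if y: "y \<in> g ` V" for y
  proof -
    obtain z where z: "z \<in> V" "y = g z" using y by blast
    have "(\<Psi> has_derivative D' (g z)) (at (g z))"
    proof (rule has_derivative_inverse_on[where f = g and f' = ?D and g' = "\<lambda>u. D' (g u)" and x = z, OF \<open>open V\<close>])
      show "(g has_derivative ?D u) (at u)" if "u \<in> V" for u
        using smooth_on_has_derivative[OF W(2)] that \<open>V \<subseteq> W\<close> by blast
      show "\<Psi> (g u) = u" if "u \<in> V" for u by (rule \<Psi>[OF that])
      have Dz: "?D z v = \<alpha> z * v + \<beta> z * cnj v" for v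
      proof -
        have "linear (?D z)"
          using smooth_on_has_derivative[OF W(2)] z(1) \<open>V \<subseteq> W\<close> has_derivative_linear by blast
        from linear_complex_expand[OF this, of v] show ?thesis
          by (simp add: \<alpha>_def \<beta>_def complex_eq_iff field_simps)
      qed
      have nz: "\<Delta> z \<noteq> 0" using z(1) by (simp add: V_def)
      have cd: "cnj (\<Delta> z) = \<Delta> z" by (simp add: \<Delta>_def mult.commute)
      show "?D z \<circ> D' (g z) = id"
      proof
        fix v
        have "(?D z \<circ> D' (g z)) v = (\<alpha> z * (cnj (\<alpha> z) * v - \<beta> z * cnj v) + \<beta> z * (\<alpha> z * cnj v - cnj (\<beta> z) * v)) * inverse (\<Delta> z)"
          by (simp add: Dz D'_def \<Psi>[OF z(1)] cd distrib_right mult.assoc)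
        also have "\<alpha> z * (cnj (\<alpha> z) * v - \<beta> z * cnj v) + \<beta> z * (\<alpha> z * cnj v - cnj (\<beta> z) * v) = \<Delta> z * v"
          by (simp add: \<Delta>_def algebra_simps)
        finally show "(?D z \<circ> D' (g z)) v = id v" using nz by simp
      qed
    qed (rule z(1))
    then show ?thesis by (simp add: z(2))
  qed
  have o: "open (g ` V)" by (rule homeo(1)[OF \<open>open V\<close>]) simp
  have im: "\<Psi> ` (g ` V) \<subseteq> V" using \<Psi> by auto
  have sub: "Ck_on k V f" if "smooth_on W f" for k f
    using that \<open>V \<subseteq> W\<close> Ck_on_subset smooth_onD by blast
  \<comment> \<open>Bootstrap: the derivative of \<Psi> is a smooth expression in \<Psi>, so each
    order of differentiability yields the next.\<close>
  have "Ck_on k (g ` V) \<Psi>" for k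
  proof (induction k)
    case 0
    then show ?case using homeo(2)[OF \<open>open V\<close>] by (simp add: homeomorphism_def)
  next
    case (Suc k)
    have comp: "Ck_on k (g ` V) (\<lambda>y. f (\<Psi> y))" if "smooth_on W f" for f
      by (rule Ck_on_compose[OF o \<open>open V\<close> im Suc.IH sub[OF that]])
    have inv: "Ck_on k (g ` V) (\<lambda>y. inverse (\<Delta> (\<Psi> y)))"
    proof (rule Ck_on_compose[OF o, where T = "- {0}" and f = "\<lambda>y. \<Delta> (\<Psi> y)" and g = inverse])
      show "Ck_on k (- {0}) (inverse :: complex \<Rightarrow> complex)"
        by (rule Ck_on_holomorphic) (auto intro!: holomorphic_intros)
      show "(\<lambda>y. \<Delta> (\<Psi> y)) ` g ` V \<subseteq> - {0}"
      proof clarify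
        fix z assume "z \<in> V" "\<Delta> (\<Psi> (g z)) = 0"
        then show False using \<Psi> by (simp add: V_def)
      qed
    qed (use comp[OF s\<Delta>] in auto)
    have D': "Ck_on k (g ` V) (\<lambda>y. D' y v)" for v
      unfolding D'_def
      by (rule Ck_on_mult[OF o Ck_on_diff[OF o Ck_on_mult[OF o _ Ck_on_const[OF o]] Ck_on_mult[OF o comp[OF s\<beta>] Ck_on_const[OF o]]] inv])
         (rule Ck_on_bounded_linear_compose[OF o bounded_linear_cnj comp[OF s\<alpha>]])
    show ?case
      by (rule Ck_on_SucI[OF o der D'])
  qed
  then have sm: "smooth_on (g ` V) \<Psi>" by (rule smooth_onI)
  show ?thesis
  proof (rule that[OF \<open>open V\<close> \<open>x \<in> V\<close> \<open>V \<subseteq> W\<close> inj])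
    fix V' assume V': "open V'" "V' \<subseteq> V"
    have "smooth_on (g ` V') \<Psi>"
      by (rule smooth_on_subset[OF sm image_mono[OF V'(2)]])
    with homeo[OF V'] show "open (g ` V') \<and> homeomorphism V' (g ` V') g \<Psi> \<and> smooth_on (g ` V') \<Psi>"
      by simp
  qed
qed

section \<open>The topology of the glued surface\<close>

locale welding_map =
  fixes \<rho> :: "real \<Rightarrow> real"
  assumes mono: "strict_mono \<rho>" and diffeo: "diffeomorphism_of_reals \<rho>"
begin

abbreviation "X \<equiv> glued_surface \<rho>"

abbreviation "h \<equiv> half_plane_map \<rho>"

lemma \<rho>_inj: "inj \<rho>" and \<rho>_smooth: "smooth_on UNIV \<rho>" and \<rho>_inv_smooth: "smooth_on UNIV (inv \<rho>)"
  using diffeo by (auto simp: diffeomorphism_of_reals_def bij_is_inj)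

lemma \<rho>_inv [simp]: "inv \<rho> (\<rho> x) = x" "\<rho> (inv \<rho> x) = x"
  using diffeo by (auto simp: diffeomorphism_of_reals_def bij_is_inj bij_is_surj surj_f_inv_f)

lemma \<rho>_cont: "continuous_on UNIV \<rho>" "continuous_on UNIV (inv \<rho>)"
  by (rule smooth_on_continuous[OF \<rho>_smooth], rule smooth_on_continuous[OF \<rho>_inv_smooth])

lemma \<rho>_derivative: "(\<rho> has_real_derivative rderiv \<rho> x) (at x)"
  by (rule smooth_on_has_real_derivative[OF \<rho>_smooth])

text \<open>Nonzero because the inverse is differentiable as well, and nonnegative by
  monotonicity.\<close>

lemma \<rho>_derivative_pos: "rderiv \<rho> x > 0"
proof -
  have "((\<lambda>x. inv \<rho> (\<rho> x)) has_real_derivative rderiv (inv \<rho>) (\<rho> x) * rderiv \<rho> x) (at x)"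
    by (rule DERIV_chain2[OF smooth_on_has_real_derivative[OF \<rho>_inv_smooth] \<rho>_derivative])
  then have "((\<lambda>x. x) has_real_derivative rderiv (inv \<rho>) (\<rho> x) * rderiv \<rho> x) (at x)"
    by simp
  then have "rderiv (inv \<rho>) (\<rho> x) * rderiv \<rho> x = 1"
    using DERIV_unique DERIV_ident by blast
  then have "rderiv \<rho> x \<noteq> 0" by auto
  moreover have "rderiv \<rho> x \<ge> 0"
    by (rule mono_on_imp_deriv_nonneg[OF _ \<rho>_derivative, of UNIV]) (use strict_mono_mono[OF mono] in auto)
  ultimately show ?thesis by simp
qed

lemma topspace_half_planes: "topspace half_planes = Sigma UNIV half_plane"
  by (simp add: half_planes_def o_def)

lemma half_plane_map_eq_iff:
  assumes "z \<in> half_plane s" "w \<in> half_plane s'"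
  shows "h s z = h s' w \<longleftrightarrow> ((s, z), (s', w)) \<in> gluing \<rho>"
  unfolding half_plane_map_def
  by (rule eq_equiv_class_iff[OF equiv_gluing[OF \<rho>_inj]]) (use assms in \<open>auto simp: topspace_half_planes\<close>)

lemma half_plane_map_same:
  assumes "z \<in> half_plane s" "w \<in> half_plane s" "h s z = h s w"
  shows "z = w"
  using assms half_plane_map_eq_iff[OF assms(1,2)] by (auto simp: gluing_def)

lemma half_plane_map_cross:
  assumes "z \<in> half_plane Upper" "w \<in> half_plane Lower" "h Upper z = h Lower w"
  shows "z = of_real (Re z) \<and> w = of_real (\<rho> (Re z))"
  using assms(3) half_plane_map_eq_iff[OF assms(1,2)] by (auto simp: gluing_def)

lemma half_plane_map_real: "h Upper (of_real x) = h Lower (of_real (\<rho> x))"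
proof -
  have "h Upper (of_real x) = h Lower (of_real (\<rho> x)) \<longleftrightarrow> ((Upper, complex_of_real x), (Lower, of_real (\<rho> x))) \<in> gluing \<rho>"
    by (rule half_plane_map_eq_iff) auto
  then show ?thesis by (auto simp: gluing_def)
qed

lemma topspace_glued: "topspace X = (\<Union>s. h s ` half_plane s)"
  unfolding glued_surface_def topspace_quotient_topology topspace_half_planes quotient_def half_plane_map_def
  by auto

lemma half_plane_map_in_topspace: "z \<in> half_plane s \<Longrightarrow> h s z \<in> topspace X"
  by (auto simp: topspace_glued)

definition side_dom :: "side \<Rightarrow> (side \<times> complex) set set \<Rightarrow> complex set" where
  "side_dom s U = {z \<in> half_plane s. h s z \<in> U}"

lemma openin_glued:
  "openin X U \<longleftrightarrow> U \<subseteq> topspace X \<and> (\<forall>s. openin (top_of_set (half_plane s)) (side_dom s U))"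
proof -
  have "{x \<in> topspace half_planes. gluing \<rho> `` {x} \<in> U} = (SIGMA s:UNIV. side_dom s U)"
    by (auto simp: topspace_half_planes side_dom_def half_plane_map_def)
  moreover have "openin half_planes (SIGMA s:UNIV. side_dom s U) \<longleftrightarrow> (\<forall>s. openin (top_of_set (half_plane s)) (side_dom s U))"
    unfolding half_planes_def openin_sum_topology by (auto simp: side_dom_def)
  moreover have "topspace X = topspace half_planes // gluing \<rho>"
    unfolding glued_surface_def topspace_quotient_topology ..
  ultimately show ?thesis
    unfolding glued_surface_def openin_quotient_topology by simp
qed

lemma side_dom_open:
  assumes "openin X U"
  obtains T where "open T" "side_dom s U = half_plane s \<inter> T"
  using assms unfolding openin_glued openin_open by blast

section \<open>A planar model of the glued surface\<close>

definition shear :: "real \<Rightarrow> complex \<Rightarrow> complex" where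
  "shear a z = Complex (\<rho> (Re z)) (a * Im z)"

definition unshear :: "real \<Rightarrow> complex \<Rightarrow> complex" where
  "unshear a w = Complex (inv \<rho> (Re w)) (Im w / a)"

lemma shear_unshear [simp]: "a > 0 \<Longrightarrow> shear a (unshear a w) = w" "a > 0 \<Longrightarrow> unshear a (shear a z) = z"
  by (simp_all add: shear_def unshear_def complex_eq_iff)

lemma continuous_on_shear: "continuous_on S (shear a)" "continuous_on S (unshear a)"
proof -
  have "continuous_on S (\<lambda>z. Complex (\<rho> (Re z)) (a * Im z))" "continuous_on S (\<lambda>z. Complex (inv \<rho> (Re z)) (Im z / a))"
    unfolding Complex_eq divide_inverse
    by (intro continuous_intros continuous_on_compose2[OF \<rho>_cont(1)] continuous_on_compose2[OF \<rho>_cont(2)]; simp)+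
  then show "continuous_on S (shear a)" "continuous_on S (unshear a)"
    by (simp_all add: shear_def[abs_def] unshear_def[abs_def])
qed

text \<open>A homeomorphism of the plane onto the glued surface. The parameter will be chosen so that the map is differentiable at a given point.\<close>

definition plane_map :: "real \<Rightarrow> complex \<Rightarrow> (side \<times> complex) set" where
  "plane_map a z = (if Im z \<ge> 0 then h Upper z else h Lower (shear a z))"

lemma plane_map_lower:
  assumes "Im z \<le> 0"
  shows "plane_map a z = h Lower (shear a z)"
proof (cases "Im z = 0")
  case True
  then have "z = of_real (Re z)" "shear a z = of_real (\<rho> (Re z))"
    by (simp_all add: shear_def complex_eq_iff)
  then show ?thesis
    using half_plane_map_real[of "Re z"] True by (simp add: plane_map_def)
qed (use assms in \<open>simp add: plane_map_def\<close>)

lemma plane_map_unshear: "a > 0 \<Longrightarrow> Im w \<le> 0 \<Longrightarrow> plane_map a (unshear a w) = h Lower w"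
  by (subst plane_map_lower) (simp_all add: unshear_def divide_nonpos_pos, simp add: unshear_def[symmetric])

lemma plane_map_inj:
  assumes a: "a > 0"
  shows "inj (plane_map a)"
proof -
  have cross: False if "Im z \<ge> 0" "Im w < 0" "plane_map a z = plane_map a w" for z w
  proof -
    have "h Upper z = h Lower (shear a w)"
      using that by (simp add: plane_map_def)
    then have "shear a w = of_real (\<rho> (Re z))"
      by (intro half_plane_map_cross[THEN conjunct2]) (use that a in \<open>auto simp: shear_def mult_nonneg_nonpos\<close>)
    then have "a * Im w = 0" by (simp add: shear_def complex_eq_iff)
    then show False using that a by simp
  qed
  show ?thesis
  proof (rule injI)
    fix z w assume eq: "plane_map a z = plane_map a w"
    consider "Im z \<ge> 0" "Im w \<ge> 0" | "Im z < 0" "Im w < 0" | "Im z \<ge> 0" "Im w < 0" | "Im z < 0" "Im w \<ge> 0"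
      by linarith
    then show "z = w"
    proof cases
      case 1
      then show ?thesis
        using eq half_plane_map_same[of z Upper w] by (simp add: plane_map_def)
    next
      case 2
      then have "h Lower (shear a z) = h Lower (shear a w)"
        using eq by (simp add: plane_map_def)
      then have "shear a z = shear a w"
        by (rule half_plane_map_same[rotated 2]) (use 2 a in \<open>auto simp: shear_def mult_nonneg_nonpos\<close>)
      then show ?thesis using shear_unshear(2)[OF a] by metis
    qed (use cross eq in metis)+
  qed
qed

lemma plane_map_range:
  assumes a: "a > 0"
  shows "range (plane_map a) = topspace X"
proof
  show "range (plane_map a) \<subseteq> topspace X"
  proof clarify
    fix z show "plane_map a z \<in> topspace X"
      unfolding plane_map_def using a
      by (auto intro!: half_plane_map_in_topspace simp: shear_def mult_nonneg_nonpos)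
  qed
  show "topspace X \<subseteq> range (plane_map a)"
  proof
    fix p assume "p \<in> topspace X"
    then obtain s z where "p = h s z" "z \<in> half_plane s" by (auto simp: topspace_glued)
    then show "p \<in> range (plane_map a)"
    proof (cases s)
      case Upper
      then have "p = plane_map a z" using \<open>p = h s z\<close> \<open>z \<in> half_plane s\<close> by (simp add: plane_map_def)
      then show ?thesis by blast
    next
      case Lower
      then have "p = plane_map a (unshear a z)"
        using \<open>p = h s z\<close> \<open>z \<in> half_plane s\<close> plane_map_unshear[OF a] by simp
      then show ?thesis by blast
    qed
  qed
qed

lemma side_dom_plane_map:
  assumes a: "a > 0"
  shows "side_dom Upper (plane_map a ` S) = half_plane Upper \<inter> S"
    "side_dom Lower (plane_map a ` S) = half_plane Lower \<inter> unshear a -` S"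
proof -
  have "h Upper z \<in> plane_map a ` S \<longleftrightarrow> z \<in> S" if "Im z \<ge> 0" for z
    using inj_image_mem_iff[OF plane_map_inj[OF a], of z S] that by (simp add: plane_map_def)
  moreover have "h Lower w \<in> plane_map a ` S \<longleftrightarrow> unshear a w \<in> S" if "Im w \<le> 0" for w
    using inj_image_mem_iff[OF plane_map_inj[OF a], of "unshear a w" S] plane_map_unshear[OF a that] by simp
  ultimately show "side_dom Upper (plane_map a ` S) = half_plane Upper \<inter> S"
    "side_dom Lower (plane_map a ` S) = half_plane Lower \<inter> unshear a -` S"
    unfolding side_dom_def half_plane.simps by blast+
qed

lemma openin_plane_map:
  assumes a: "a > 0"
  shows "openin X (plane_map a ` S) \<longleftrightarrow> open S"
proof
  assume "open S"
  have "openin (top_of_set (half_plane s)) (side_dom s (plane_map a ` S))" for s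
  proof (cases s)
    case Upper
    then show ?thesis
      using side_dom_plane_map(1)[OF a] \<open>open S\<close> by (simp add: openin_open_Int del: half_plane.simps)
  next
    case Lower
    have "open (unshear a -` S)"
      using continuous_open_preimage[OF continuous_on_shear(2) open_UNIV \<open>open S\<close>] by simp
    then show ?thesis
      using side_dom_plane_map(2)[OF a] Lower by (simp add: openin_open_Int del: half_plane.simps)
  qed
  then show "openin X (plane_map a ` S)"
    unfolding openin_glued using plane_map_range[OF a] by blast
next
  assume o: "openin X (plane_map a ` S)"
  obtain T where T: "open T" "half_plane Upper \<inter> S = half_plane Upper \<inter> T"
    using side_dom_open[OF o] side_dom_plane_map(1)[OF a] by metis
  obtain T' where T': "open T'" "half_plane Lower \<inter> unshear a -` S = half_plane Lower \<inter> T'"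
    using side_dom_open[OF o] side_dom_plane_map(2)[OF a] by metis
  \<comment> \<open>Information on two closed half planes is glued best through complements: a union
    of two closed pieces is closed.\<close>
  have "- S = (half_plane Upper - T) \<union> (half_plane Lower - shear a -` T')"
  proof -
    have 1: "z \<in> S \<longleftrightarrow> z \<in> T" if "Im z \<ge> 0" for z using T(2) that by auto
    have 2: "z \<in> S \<longleftrightarrow> shear a z \<in> T'" if "Im z \<le> 0" for z
    proof -
      have "shear a z \<in> half_plane Lower" using that a by (simp add: shear_def mult_nonneg_nonpos)
      then have "unshear a (shear a z) \<in> S \<longleftrightarrow> shear a z \<in> T'" using T'(2) by blast
      then show ?thesis using a by simp
    qed
    show ?thesis
    proof (rule set_eqI)
      fix z
      show "z \<in> - S \<longleftrightarrow> z \<in> (half_plane Upper - T) \<union> (half_plane Lower - shear a -` T')"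
        using 1[of z] 2[of z] by (cases "Im z \<ge> 0") auto
    qed
  qed
  moreover have "open (shear a -` T')"
    using continuous_open_preimage[OF continuous_on_shear(1) open_UNIV T'(1)] by simp
  ultimately have "closed (- S)"
    using T(1) closed_half_plane by (simp add: closed_Un closed_Diff del: half_plane.simps)
  then show "open S" by (simp add: open_closed)
qed

definition plane_coord :: "(side \<times> complex) set \<Rightarrow> complex" where
  "plane_coord = inv (plane_map 1)"

lemma plane_coord [simp]: "plane_coord (plane_map 1 z) = z" "p \<in> topspace X \<Longrightarrow> plane_map 1 (plane_coord p) = p"
  unfolding plane_coord_def using plane_map_inj[of 1] plane_map_range[of 1]
  by (simp_all add: f_inv_into_f)

text \<open>A continuous retraction of the glued surface onto each of the half planes.\<close>

definition side_proj :: "side \<Rightarrow> (side \<times> complex) set \<Rightarrow> complex" where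
  "side_proj s p = (case s of Upper \<Rightarrow> Complex (Re (plane_coord p)) (max 0 (Im (plane_coord p)))
      | Lower \<Rightarrow> shear 1 (Complex (Re (plane_coord p)) (min 0 (Im (plane_coord p)))))"

lemma side_proj_half_plane_map:
  assumes "z \<in> half_plane s"
  shows "side_proj s (h s z) = z"
proof (cases s)
  case Upper
  then have "h s z = plane_map 1 z" using assms by (simp add: plane_map_def)
  then show ?thesis using Upper assms by (simp add: side_proj_def)
next
  case Lower
  then have "h s z = plane_map 1 (unshear 1 z)" using assms plane_map_unshear[of 1] by simp
  then have "side_proj s (h s z) = shear 1 (unshear 1 z)"
    using Lower assms by (simp add: side_proj_def unshear_def)
  then show ?thesis by simp
qed

lemma openin_side_proj:
  assumes "open S"
  shows "openin X {p \<in> topspace X. side_proj s p \<in> S}"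
proof -
  define k where "k = (\<lambda>z. case s of Upper \<Rightarrow> Complex (Re z) (max 0 (Im z))
      | Lower \<Rightarrow> shear 1 (Complex (Re z) (min 0 (Im z))))"
  have "continuous_on UNIV k"
  proof (cases s)
    case Upper
    then show ?thesis
      by (simp add: k_def Complex_eq) (intro continuous_intros)
  next
    case Lower
    have "continuous_on UNIV (\<lambda>z. Complex (Re z) (min 0 (Im z)))"
      unfolding Complex_eq by (intro continuous_intros)
    from continuous_on_compose2[OF continuous_on_shear(1)[of UNIV 1] this] show ?thesis
      using Lower by (simp add: k_def)
  qed
  then have "open (k -` S)"
    using continuous_open_preimage[OF _ open_UNIV assms] by simp
  moreover have "{p \<in> topspace X. side_proj s p \<in> S} = plane_map 1 ` (k -` S)"
  proof -
    have k: "side_proj s p = k (plane_coord p)" for p by (simp add: side_proj_def k_def)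
    show ?thesis
    proof (intro equalityI subsetI)
      fix p assume "p \<in> {p \<in> topspace X. side_proj s p \<in> S}"
      then show "p \<in> plane_map 1 ` (k -` S)"
        by (intro image_eqI[of _ _ "plane_coord p"]) (simp_all add: k)
    next
      fix p assume "p \<in> plane_map 1 ` (k -` S)"
      then show "p \<in> {p \<in> topspace X. side_proj s p \<in> S}"
        using plane_map_range[of 1] by (auto simp: k)
    qed
  qed
  ultimately show ?thesis using openin_plane_map[of 1] by simp
qed

section \<open>Charts and piecewise analytic functions\<close>

lemma chart_subset: "complex_chart X (U, \<phi>) \<Longrightarrow> U \<subseteq> topspace X"
  and chart_openin: "complex_chart X (U, \<phi>) \<Longrightarrow> openin X U"
  and chart_open: "complex_chart X (U, \<phi>) \<Longrightarrow> open (\<phi> ` U)"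
  by (auto simp: complex_chart_def openin_subset dest: openin_subset)

lemma chart_inj:
  assumes "complex_chart X (U, \<phi>)"
  shows "inj_on \<phi> U"
  using assms chart_subset[OF assms] unfolding complex_chart_def
  by (auto dest!: homeomorphic_imp_injective_map simp: Int_absorb1)

lemma chart_open_image:
  assumes c: "complex_chart X (U, \<phi>)" and "V \<subseteq> U"
  shows "open (\<phi> ` V) \<longleftrightarrow> openin X V"
proof -
  have t: "topspace (subtopology X U) = U"
    using chart_subset[OF c] by auto
  have "openin (top_of_set (\<phi> ` U)) (\<phi> ` V) \<longleftrightarrow> openin (subtopology X U) V"
    by (rule homeomorphic_map_openness) (use c t assms(2) in \<open>auto simp: complex_chart_def\<close>)
  moreover have "openin (top_of_set (\<phi> ` U)) (\<phi> ` V) \<longleftrightarrow> open (\<phi> ` V)"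
    using openin_open_eq[OF chart_open[OF c]] assms(2) by auto
  moreover have "openin (subtopology X U) V \<longleftrightarrow> openin X V"
    using openin_open_subtopology[OF chart_openin[OF c]] assms(2) by auto
  ultimately show ?thesis by simp
qed

lemma chart_openI:
  assumes c: "complex_chart X (U, \<phi>)" and "openin X V"
  shows "open (\<phi> ` (U \<inter> V))"
  using chart_open_image[OF c] chart_openin[OF c] assms(2) by (simp add: openin_Int)

section \<open>One-sided derivatives of piecewise analytic functions\<close>

lemma piecewise_analytic_iff:
  "piecewise_analytic \<rho> U f \<longleftrightarrow> (\<forall>s. smooth_up_to_boundary (side_dom s U) (f \<circ> h s) \<and>
     (f \<circ> h s) holomorphic_on (side_dom s U - \<real>))"
proof -
  have "{z \<in> half_plane s - \<real>. h s z \<in> U} = side_dom s U - \<real>" for s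
    by (auto simp: side_dom_def)
  then show ?thesis by (simp add: piecewise_analytic_def side_dom_def)
qed

lemma piecewise_analytic_extension:
  assumes U: "openin X U" and f: "piecewise_analytic \<rho> U f" and z: "z \<in> side_dom s U"
  obtains W g where "open W" "z \<in> W" "half_plane s \<inter> W \<subseteq> side_dom s U" "smooth_on W g"
    "\<And>\<zeta>. \<zeta> \<in> half_plane s \<inter> W \<Longrightarrow> g \<zeta> = f (h s \<zeta>)"
    "\<And>\<zeta>. \<zeta> \<in> half_plane s \<inter> W \<Longrightarrow> \<exists>b. (g has_field_derivative b) (at \<zeta>)"
proof -
  obtain T where T: "open T" "side_dom s U = half_plane s \<inter> T" using side_dom_open[OF U] .
  have i: "side_dom s U - \<real> = (half_plane s - \<real>) \<inter> T" using T(2) by auto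
  have 1: "z \<in> half_plane s \<inter> T" using z T(2) by simp
  have 2: "smooth_up_to_boundary (half_plane s \<inter> T) (f \<circ> h s)"
    using f unfolding piecewise_analytic_iff T(2)[symmetric] by blast
  have 3: "(f \<circ> h s) holomorphic_on (half_plane s - \<real>) \<inter> T"
    using f unfolding piecewise_analytic_iff i[symmetric] by blast
  obtain W g where W: "open W" "z \<in> W" "W \<subseteq> T" "smooth_on W g"
    "\<And>\<zeta>. \<zeta> \<in> half_plane s \<inter> W \<Longrightarrow> g \<zeta> = (f \<circ> h s) \<zeta>"
    "\<And>\<zeta>. \<zeta> \<in> half_plane s \<inter> W \<Longrightarrow> \<exists>b. (g has_field_derivative b) (at \<zeta>)"
    using half_plane_smooth_extension[OF T(1) 1 2 3] by blast
  have "half_plane s \<inter> W \<subseteq> side_dom s U" using W(3) T(2) by auto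
  from that[OF W(1,2) this W(4) _ W(6)] W(5) show ?thesis by simp
qed

lemma piecewise_analytic_derivative:
  assumes U: "openin X U" and f: "piecewise_analytic \<rho> U f" and z: "z \<in> side_dom s U"
  obtains b where "((f \<circ> h s) has_field_derivative b) (at z within half_plane s)"
proof -
  obtain W g where W: "open W" "z \<in> W" "half_plane s \<inter> W \<subseteq> side_dom s U" "smooth_on W g"
    "\<And>\<zeta>. \<zeta> \<in> half_plane s \<inter> W \<Longrightarrow> g \<zeta> = f (h s \<zeta>)"
    "\<And>\<zeta>. \<zeta> \<in> half_plane s \<inter> W \<Longrightarrow> \<exists>b. (g has_field_derivative b) (at \<zeta>)"
    using piecewise_analytic_extension[OF assms] by blast
  have zh: "z \<in> half_plane s" using z by (simp add: side_dom_def)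
  then obtain b where "(g has_field_derivative b) (at z)" using W(2,6) by blast
  then have g: "(g has_field_derivative b) (at z within half_plane s)"
    by (rule has_field_derivative_at_within)
  obtain d where "d > 0" "ball z d \<subseteq> W" using W(1,2) open_contains_ball by blast
  have "((f \<circ> h s) has_field_derivative b) (at z within half_plane s)"
    by (rule has_field_derivative_transform_within[OF g \<open>d > 0\<close> zh])
       (use \<open>ball z d \<subseteq> W\<close> W(5) in \<open>auto simp: dist_commute subset_iff\<close>)
  then show ?thesis by (rule that)
qed

text \<open>Gives uniqueness of one-sided derivatives.\<close>

lemma at_half_plane_nontrivial: "z \<in> half_plane s \<Longrightarrow> at z within half_plane s \<noteq> bot"
proof -
  assume z: "z \<in> half_plane s"
  have "convex (half_plane s)"
    by (cases s) (simp_all add: convex_halfspace_Im_ge convex_halfspace_Im_le)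
  then have c: "connected (half_plane s)" by (rule convex_connected)
  have "z + 1 \<in> half_plane s" "z + 1 \<noteq> z" using z by (cases s; simp)+
  then have "\<nexists>x. half_plane s = {x}" using z by (metis singletonD)
  then have "z islimpt half_plane s"
    by (intro connected_imp_perfect[OF c z]) blast
  then show ?thesis by (simp add: trivial_limit_within)
qed

text \<open>Both coordinate expressions restrict to the same function of x on the axis; the chain
  rule along it produces the factor \<rho>'(x).\<close>

lemma boundary_derivatives:
  assumes "((f \<circ> h Upper) has_field_derivative b) (at (of_real x) within half_plane Upper)"
    "((f \<circ> h Lower) has_field_derivative b') (at (of_real (\<rho> x)) within half_plane Lower)"
  shows "b = b' * of_real (rderiv \<rho> x)"
proof -
  have r: "((\<lambda>t. f (h s (of_real (k t)))) has_vector_derivative c * of_real k') (at x)"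
    if "((f \<circ> h s) has_field_derivative c) (at (of_real (k x)) within half_plane s)" "(k has_real_derivative k') (at x)" for s c k k'
  proof -
    have "((complex_of_real \<circ> k) has_vector_derivative of_real k') (at x)"
      using has_vector_derivative_of_real[OF that(2)] by (simp add: o_def)
    moreover have "((f \<circ> h s) has_field_derivative c) (at ((complex_of_real \<circ> k) x) within (complex_of_real \<circ> k) ` UNIV)"
    proof (rule DERIV_subset)
      show "((f \<circ> h s) has_field_derivative c) (at ((complex_of_real \<circ> k) x) within half_plane s)"
        using that(1) by simp
      show "range (complex_of_real \<circ> k) \<subseteq> half_plane s" by (cases s) auto
    qed
    ultimately show ?thesis
      using field_vector_diff_chain_within[of "complex_of_real \<circ> k" "of_real k'" x UNIV "f \<circ> h s" c]
      by (simp add: o_def mult.commute)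
  qed
  have "((\<lambda>t. f (h Upper (of_real t))) has_vector_derivative b * of_real 1) (at x)"
    by (rule r) (use assms(1) in auto)
  moreover have "((\<lambda>t. f (h Lower (of_real (\<rho> t)))) has_vector_derivative b' * of_real (rderiv \<rho> x)) (at x)"
    by (rule r[OF assms(2) \<rho>_derivative])
  ultimately show ?thesis
    using vector_derivative_unique_at by (auto simp: half_plane_map_real)
qed

text \<open>Nonvanishing one-sided derivatives permit division by them in transition maps. Charts of
  this kind are constructed around every point and serve as references for arbitrary charts.\<close>

definition nice_chart :: "(side \<times> complex) set set \<Rightarrow> ((side \<times> complex) set \<Rightarrow> complex) \<Rightarrow> bool" where
  "nice_chart U \<phi> \<longleftrightarrow> complex_chart X (U, \<phi>) \<and> piecewise_analytic \<rho> U \<phi> \<and>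
     (\<forall>s. \<forall>z\<in>side_dom s U. \<exists>a. a \<noteq> 0 \<and> ((\<phi> \<circ> h s) has_field_derivative a) (at z within half_plane s))"

text \<open>The chart is inverted on one side: the inverse chart followed by the retraction
  \<open>side_proj\<close> is a continuous left inverse of the coordinate expression, and so has
  derivative 1/a within the image of that side.\<close>

lemma side_derivative:
  assumes c: "complex_chart X (U, \<phi>)" and U': "openin X U'" "U' \<subseteq> U" and z: "z \<in> side_dom s U'"
    and a: "((\<phi> \<circ> h s) has_field_derivative a) (at z within half_plane s)" "a \<noteq> 0"
    and b: "((f \<circ> h s) has_field_derivative b) (at z within half_plane s)"
  shows "((f \<circ> inv_into U \<phi>) has_field_derivative b / a) (at (\<phi> (h s z)) within (\<phi> \<circ> h s) ` side_dom s U')"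
proof -
  note inj = chart_inj[OF c]
  define g where "g = side_proj s \<circ> inv_into U \<phi>"
  have g: "g ((\<phi> \<circ> h s) \<zeta>) = \<zeta>" if "\<zeta> \<in> side_dom s U'" for \<zeta>
    using that U'(2) inv_into_f_f[OF inj] by (auto simp: g_def side_dom_def side_proj_half_plane_map)
  have cg: "continuous_on (\<phi> ` U) g"
  proof (subst continuous_on_open_vimage[OF chart_open[OF c]], intro allI impI)
    fix S :: "complex set" assume "open S"
    have "g -` S \<inter> \<phi> ` U = \<phi> ` (U \<inter> {p \<in> topspace X. side_proj s p \<in> S})"
      using inv_into_f_f[OF inj] chart_subset[OF c] by (auto simp: g_def)
    then show "open (g -` S \<inter> \<phi> ` U)"
      using chart_openI[OF c openin_side_proj[OF \<open>open S\<close>]] by simp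
  qed
  have sub: "(\<phi> \<circ> h s) ` side_dom s U' \<subseteq> \<phi> ` U"
    using U'(2) by (auto simp: side_dom_def)
  have zd: "z \<in> side_dom s U'" by (rule z)
  have dsub: "side_dom s U' \<subseteq> half_plane s" by (auto simp: side_dom_def)
  have "(g has_derivative (*) (1 / a)) (at ((\<phi> \<circ> h s) z) within (\<phi> \<circ> h s) ` side_dom s U')"
  proof (rule has_derivative_inverse_within[where f' = "(*) a"])
    show "((\<phi> \<circ> h s) has_derivative (*) a) (at z within side_dom s U')"
      using has_field_derivative_subset[OF a(1) dsub] by (simp add: has_field_derivative_def)
    have "continuous_on ((\<phi> \<circ> h s) ` side_dom s U') g"
      by (rule continuous_on_subset[OF cg sub])
    then show "continuous (at ((\<phi> \<circ> h s) z) within (\<phi> \<circ> h s) ` side_dom s U') g"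
      using zd by (auto simp: continuous_on_eq_continuous_within)
    show "linear ((*) (1 / a))" by (rule linear_times)
    show "(*) (1 / a) \<circ> (*) a = id" using a(2) by auto
  qed (use zd g in auto)
  then have dg: "(g has_field_derivative 1 / a) (at ((\<phi> \<circ> h s) z) within (\<phi> \<circ> h s) ` side_dom s U')"
    by (simp add: has_field_derivative_def)
  have img: "g ` (\<phi> \<circ> h s) ` side_dom s U' = side_dom s U'"
    using g by (force simp: image_iff)
  have "((f \<circ> h s) has_field_derivative b) (at (g ((\<phi> \<circ> h s) z)) within g ` (\<phi> \<circ> h s) ` side_dom s U')"
    unfolding img g[OF zd] by (rule has_field_derivative_subset[OF b dsub])
  from DERIV_image_chain[OF this dg]
  have *: "(((f \<circ> h s) \<circ> g) has_field_derivative b / a) (at ((\<phi> \<circ> h s) z) within (\<phi> \<circ> h s) ` side_dom s U')"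
    by simp
  have eq: "((f \<circ> h s) \<circ> g) y = (f \<circ> inv_into U \<phi>) y" if "y \<in> (\<phi> \<circ> h s) ` side_dom s U'" for y
    using that g U'(2) inv_into_f_f[OF inj] by (auto simp: side_dom_def)
  have "((f \<circ> inv_into U \<phi>) has_field_derivative b / a) (at ((\<phi> \<circ> h s) z) within (\<phi> \<circ> h s) ` side_dom s U')"
    by (rule has_field_derivative_transform_within[OF * zero_less_one imageI[OF zd] eq])
  then show ?thesis by simp
qed

lemma in_side_dom: "p \<in> U \<Longrightarrow> p \<in> topspace X \<Longrightarrow> \<exists>s. \<exists>z\<in>side_dom s U. p = h s z"
  by (auto simp: topspace_glued side_dom_def)

lemma openin_half_plane_interior: "openin X (h s ` (half_plane s - \<real>))"
proof (cases s)
  case Upper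
  have "h Upper ` (half_plane Upper - \<real>) = plane_map 1 ` {z. Im z > 0}"
    by (auto simp: plane_map_def complex_is_Real_iff image_iff)
  then show ?thesis
    using openin_plane_map[of 1] Upper by (simp add: open_halfspace_Im_gt)
next
  case Lower
  have "h Lower ` (half_plane Lower - \<real>) = plane_map 1 ` {z. Im z < 0}"
  proof (intro equalityI subsetI)
    fix p assume "p \<in> h Lower ` (half_plane Lower - \<real>)"
    then obtain w where "p = h Lower w" "Im w < 0" by (auto simp: complex_is_Real_iff)
    then show "p \<in> plane_map 1 ` {z. Im z < 0}"
      using plane_map_unshear[of 1 w] by (intro image_eqI[of _ _ "unshear 1 w"]) (auto simp: unshear_def)
  next
    fix p assume "p \<in> plane_map 1 ` {z. Im z < 0}"
    then obtain z where "p = plane_map 1 z" "Im z < 0" by auto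
    then show "p \<in> h Lower ` (half_plane Lower - \<real>)"
      by (intro image_eqI[of _ _ "shear 1 z"]) (auto simp: plane_map_def shear_def complex_is_Real_iff)
  qed
  then show ?thesis
    using openin_plane_map[of 1] Lower by (simp add: open_halfspace_Im_lt)
qed

text \<open>
  Across the real axis, the two one-sided complex derivatives agree because the derivatives
  along the axis do.
\<close>

lemma nice_chart_holomorphic:
  assumes n: "nice_chart U \<phi>" and V: "openin X V" and f: "piecewise_analytic \<rho> V f"
  shows "(f \<circ> inv_into U \<phi>) holomorphic_on \<phi> ` (U \<inter> V)"
proof -
  let ?F = "f \<circ> inv_into U \<phi>"
  have c: "complex_chart X (U, \<phi>)" using n by (simp add: nice_chart_def)
  note inj = chart_inj[OF c]
  define U' where "U' = U \<inter> V"
  have U': "openin X U'" "U' \<subseteq> U"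
    using chart_openin[OF c] V by (auto simp: U'_def openin_Int)
  have opU': "open (\<phi> ` U')" using chart_open_image[OF c U'(2)] U'(1) by simp
  have side: "\<exists>a b. a \<noteq> 0 \<and> ((\<phi> \<circ> h s) has_field_derivative a) (at z within half_plane s) \<and>
      ((f \<circ> h s) has_field_derivative b) (at z within half_plane s) \<and>
      (?F has_field_derivative b / a) (at (\<phi> (h s z)) within (\<phi> \<circ> h s) ` side_dom s U')"
    if z: "z \<in> side_dom s U'" for s z
  proof -
    have zU: "z \<in> side_dom s U" "z \<in> side_dom s V" using z by (auto simp: side_dom_def U'_def)
    obtain a where a: "a \<noteq> 0" "((\<phi> \<circ> h s) has_field_derivative a) (at z within half_plane s)"
      using n zU(1) unfolding nice_chart_def by blast
    obtain b where b: "((f \<circ> h s) has_field_derivative b) (at z within half_plane s)"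
      using piecewise_analytic_derivative[OF V f zU(2)] by blast
    show ?thesis
      using a b side_derivative[OF c U' z a(2,1) b] by blast
  qed
  have cover: "\<phi> ` U' = (\<phi> \<circ> h Upper) ` side_dom Upper U' \<union> (\<phi> \<circ> h Lower) ` side_dom Lower U'"
  proof (intro equalityI subsetI)
    fix y assume "y \<in> \<phi> ` U'"
    then obtain p where p: "p \<in> U'" "y = \<phi> p" by blast
    then obtain s z where "z \<in> side_dom s U'" "p = h s z"
      using in_side_dom openin_subset[OF U'(1)] by blast
    then show "y \<in> (\<phi> \<circ> h Upper) ` side_dom Upper U' \<union> (\<phi> \<circ> h Lower) ` side_dom Lower U'"
      using p(2) by (cases s) auto
  qed (auto simp: side_dom_def)
  have "?F field_differentiable (at (\<phi> p))" if p: "p \<in> U'" for p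
  proof -
    obtain s z where z: "z \<in> side_dom s U'" "p = h s z"
      using in_side_dom p openin_subset[OF U'(1)] by blast
    show ?thesis
    proof (cases "z \<in> \<real>")
      case False
      let ?N = "U' \<inter> h s ` (half_plane s - \<real>)"
      have "open (\<phi> ` ?N)"
        using chart_open_image[OF c, of ?N] U' openin_half_plane_interior by (simp add: openin_Int le_infI1)
      moreover have "\<phi> (h s z) \<in> \<phi> ` ?N"
        using z False by (auto simp: side_dom_def)
      moreover have "\<phi> ` ?N \<subseteq> (\<phi> \<circ> h s) ` side_dom s U'"
        by (auto simp: side_dom_def)
      moreover obtain d where "(?F has_field_derivative d) (at (\<phi> (h s z)) within (\<phi> \<circ> h s) ` side_dom s U')"
        using side[OF z(1)] by blast
      ultimately have "(?F has_field_derivative d) (at (\<phi> (h s z)))"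
        using has_field_derivative_subset at_within_open by metis
      then show ?thesis using z(2) field_differentiable_def by blast
    next
      case True
      have "\<exists>x. p = h Upper (of_real x) \<and> p = h Lower (of_real (\<rho> x))"
      proof (cases s)
        case Upper
        then show ?thesis using True z(2) half_plane_map_real by (auto elim!: Reals_cases)
      next
        case Lower
        obtain y where "z = of_real y" using True Reals_cases by blast
        then show ?thesis using Lower z(2) half_plane_map_real[of "inv \<rho> y"] by auto
      qed
      then obtain x where x: "p = h Upper (of_real x)" "p = h Lower (of_real (\<rho> x))" by blast
      have dU: "of_real x \<in> side_dom Upper U'" and dL: "of_real (\<rho> x) \<in> side_dom Lower U'"
        using p x by (auto simp: side_dom_def)
      obtain a b where ab: "a \<noteq> 0" "((\<phi> \<circ> h Upper) has_field_derivative a) (at (of_real x) within half_plane Upper)"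
        "((f \<circ> h Upper) has_field_derivative b) (at (of_real x) within half_plane Upper)"
        "(?F has_field_derivative b / a) (at (\<phi> p) within (\<phi> \<circ> h Upper) ` side_dom Upper U')"
        using side[OF dU] x by metis
      obtain a' b' where ab': "a' \<noteq> 0" "((\<phi> \<circ> h Lower) has_field_derivative a') (at (of_real (\<rho> x)) within half_plane Lower)"
        "((f \<circ> h Lower) has_field_derivative b') (at (of_real (\<rho> x)) within half_plane Lower)"
        "(?F has_field_derivative b' / a') (at (\<phi> p) within (\<phi> \<circ> h Lower) ` side_dom Lower U')"
        using side[OF dL] x by metis
      \<comment> \<open>The factor \<rho>'(x) relates a to a' and b to b' alike, so it
        cancels.\<close>
      have "b / a = b' / a'"
        using boundary_derivatives[OF ab(2) ab'(2)] boundary_derivatives[OF ab(3) ab'(3)] ab(1) by auto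
      \<comment> \<open>The images of the two sides together fill the open set, so the two one-sided
        limits combine into a full derivative.\<close>
      then have "(?F has_field_derivative b / a) (at (\<phi> p) within \<phi> ` U')"
        using ab(4) ab'(4) unfolding has_field_derivative_iff
        unfolding cover at_within_union by (intro filterlim_sup) simp_all
      then have "(?F has_field_derivative b / a) (at (\<phi> p))"
        using at_within_open[OF _ opU', of "\<phi> p"] p by simp
      then show ?thesis using field_differentiable_def by blast
    qed
  qed
  then show ?thesis
    unfolding holomorphic_on_def U'_def[symmetric]
    by (auto intro: field_differentiable_at_within)
qed

text \<open>The smooth extension of a piecewise analytic chart, followed by the holomorphic
  expression of f in that chart, extends f smoothly past the axis and is complex differentiable at
  the point.\<close>

lemma piecewise_analytic_local:
  assumes V: "openin X V"
    and loc: "\<And>p. p \<in> V \<Longrightarrow> \<exists>U \<phi>. p \<in> U \<and> complex_chart X (U, \<phi>) \<and> piecewise_analytic \<rho> U \<phi> \<and>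
      (f \<circ> inv_into U \<phi>) holomorphic_on \<phi> ` (U \<inter> V)"
  shows "piecewise_analytic \<rho> V f"
proof -
  have main: "\<exists>W g. open W \<and> z \<in> W \<and> smooth_on W g \<and> (\<forall>\<zeta>\<in>half_plane s \<inter> W. g \<zeta> = f (h s \<zeta>)) \<and>
      (\<exists>b. (g has_field_derivative b) (at z))"
    if z: "z \<in> side_dom s V" for s z
  proof -
    obtain U \<phi> where U: "h s z \<in> U" "complex_chart X (U, \<phi>)" "piecewise_analytic \<rho> U \<phi>"
      "(f \<circ> inv_into U \<phi>) holomorphic_on \<phi> ` (U \<inter> V)"
      using loc[of "h s z"] z by (auto simp: side_dom_def)
    note oU = chart_openin[OF U(2)]
    let ?F = "f \<circ> inv_into U \<phi>" and ?N = "\<phi> ` (U \<inter> V)"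
    have oN: "open ?N" by (rule chart_openI[OF U(2) V])
    have zU: "z \<in> side_dom s U" using U(1) z by (simp add: side_dom_def)
    obtain W g where W: "open W" "z \<in> W" "half_plane s \<inter> W \<subseteq> side_dom s U" "smooth_on W g"
      "\<And>\<zeta>. \<zeta> \<in> half_plane s \<inter> W \<Longrightarrow> g \<zeta> = \<phi> (h s \<zeta>)"
      "\<And>\<zeta>. \<zeta> \<in> half_plane s \<inter> W \<Longrightarrow> \<exists>b. (g has_field_derivative b) (at \<zeta>)"
      using piecewise_analytic_extension[OF oU U(3) zU] by blast
    have zh: "z \<in> half_plane s" using z by (simp add: side_dom_def)
    have gz: "g z \<in> ?N" using W(2,5) zh U(1) z by (auto simp: side_dom_def)
    define W' where "W' = W \<inter> g -` ?N"
    have W': "open W'" "z \<in> W'" "W' \<subseteq> W"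
      using continuous_open_preimage[OF smooth_on_continuous[OF W(4)] W(1) oN] W(2) gz by (auto simp: W'_def)
    have "smooth_on W' (\<lambda>\<zeta>. ?F (g \<zeta>))"
      by (rule smooth_on_compose[OF W'(1) oN _ smooth_on_subset[OF W(4) W'(3)] smooth_on_holomorphic[OF oN U(4)]])
         (auto simp: W'_def)
    moreover have "?F (g \<zeta>) = f (h s \<zeta>)" if "\<zeta> \<in> half_plane s \<inter> W'" for \<zeta>
    proof -
      have "h s \<zeta> \<in> U" "g \<zeta> = \<phi> (h s \<zeta>)" using that W(3,5) W'(3) by (auto simp: side_dom_def)
      then show ?thesis using inv_into_f_f[OF chart_inj[OF U(2)]] by simp
    qed
    moreover have "\<exists>b. ((\<lambda>\<zeta>. ?F (g \<zeta>)) has_field_derivative b) (at z)"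
    proof -
      obtain b where "(g has_field_derivative b) (at z)" using W(2,6) zh by blast
      moreover have "(?F has_field_derivative deriv ?F (g z)) (at (g z))"
        by (rule holomorphic_derivI[OF U(4) oN gz])
      ultimately show ?thesis using DERIV_chain2 by blast
    qed
    ultimately show ?thesis using W'(1,2) by blast
  qed
  show ?thesis
    unfolding piecewise_analytic_iff
  proof (intro allI conjI)
    fix s
    show "smooth_up_to_boundary (side_dom s V) (f \<circ> h s)"
      unfolding smooth_up_to_boundary_def
    proof
      fix z assume "z \<in> side_dom s V"
      from main[OF this] obtain W g where "open W" "z \<in> W" "smooth_on W g" "\<forall>\<zeta>\<in>half_plane s \<inter> W. g \<zeta> = f (h s \<zeta>)"
        by blast
      then show "\<exists>W g. open W \<and> z \<in> W \<and> smooth_on W g \<and> (\<forall>z\<in>side_dom s V \<inter> W. g z = (f \<circ> h s) z)"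
        by (intro exI[of _ W] exI[of _ g]) (auto simp: side_dom_def)
    qed
    show "(f \<circ> h s) holomorphic_on side_dom s V - \<real>"
      unfolding holomorphic_on_def
    proof
      fix z assume z: "z \<in> side_dom s V - \<real>"
      then have "z \<in> side_dom s V" by blast
      from main[OF this] obtain W g b where W: "open W" "z \<in> W" "\<forall>\<zeta>\<in>half_plane s \<inter> W. g \<zeta> = f (h s \<zeta>)"
        "(g has_field_derivative b) (at z)"
        by blast
      have o: "open (W \<inter> (half_plane s - \<real>))" by (intro open_Int W(1) open_half_plane_interior)
      have zo: "z \<in> W \<inter> (half_plane s - \<real>)" using z W(2) by (auto simp: side_dom_def)
      have "((f \<circ> h s) has_field_derivative b) (at z)"
        by (rule has_field_derivative_transform_within_open[OF W(4) o zo]) (use W(3) in auto)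
      then show "(f \<circ> h s) field_differentiable at z within side_dom s V - \<real>"
        using field_differentiable_at_within field_differentiable_def by blast
    qed
  qed
qed

section \<open>The candidate for the maximal atlas, and uniqueness\<close>

definition smooth_atlas :: "((side \<times> complex) set set \<times> ((side \<times> complex) set \<Rightarrow> complex)) set" where
  "smooth_atlas = {(U, \<phi>). complex_chart X (U, \<phi>) \<and> piecewise_analytic \<rho> U \<phi>}"

text \<open>An injective holomorphic map on an open set has a holomorphic inverse, so transition
  maps need to be checked in one direction only.\<close>

lemma injective_transition_inverse:
  assumes c: "complex_chart X (U, \<phi>)" and d: "complex_chart X (V, \<psi>)"
    and hol: "(\<phi> \<circ> inv_into V \<psi>) holomorphic_on \<psi> ` (V \<inter> U)"
  shows "(\<psi> \<circ> inv_into U \<phi>) holomorphic_on \<phi> ` (U \<inter> V)"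
proof -
  note ic = chart_inj[OF c] and id = chart_inj[OF d]
  have o: "open (\<psi> ` (V \<inter> U))" by (rule chart_openI[OF d chart_openin[OF c]])
  have eq: "(\<phi> \<circ> inv_into V \<psi>) (\<psi> p) = \<phi> p" if "p \<in> V \<inter> U" for p
    using that inv_into_f_f[OF id] by simp
  have inj: "inj_on (\<phi> \<circ> inv_into V \<psi>) (\<psi> ` (V \<inter> U))"
  proof (rule inj_onI)
    fix x y assume "x \<in> \<psi> ` (V \<inter> U)" "y \<in> \<psi> ` (V \<inter> U)" "(\<phi> \<circ> inv_into V \<psi>) x = (\<phi> \<circ> inv_into V \<psi>) y"
    then obtain p q where "p \<in> V \<inter> U" "q \<in> V \<inter> U" "x = \<psi> p" "y = \<psi> q" "\<phi> p = \<phi> q"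
      using eq by (auto simp del: o_apply)
    then show "x = y" using inj_onD[OF ic, of p q] by simp
  qed
  obtain g where g: "g holomorphic_on ((\<phi> \<circ> inv_into V \<psi>) ` (\<psi> ` (V \<inter> U)))"
    "\<And>y. y \<in> \<psi> ` (V \<inter> U) \<Longrightarrow> g ((\<phi> \<circ> inv_into V \<psi>) y) = y"
    using holomorphic_has_inverse[OF hol o inj] by metis
  have "(\<phi> \<circ> inv_into V \<psi>) ` (\<psi> ` (V \<inter> U)) = \<phi> ` (U \<inter> V)"
    using eq by (force simp del: o_apply simp: image_iff)
  with g(1) have "g holomorphic_on \<phi> ` (U \<inter> V)" by simp
  then show ?thesis
  proof (rule holomorphic_transform)
    fix y assume "y \<in> \<phi> ` (U \<inter> V)"
    then obtain p where p: "p \<in> U" "p \<in> V" "y = \<phi> p" by blast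
    then have "g y = \<psi> p" using g(2)[of "\<psi> p"] eq[of p] by auto
    then show "g y = (\<psi> \<circ> inv_into U \<phi>) y" using p inv_into_f_f[OF ic] by simp
  qed
qed

text \<open>By compatibility, a chart of the atlas is an analytic function on its own domain, hence
  piecewise analytic. Conversely, a piecewise analytic chart is analytic for the atlas, hence
  compatible with it, and maximality admits it.\<close>

lemma unique_structure:
  assumes "welding_structure \<rho> \<B>"
  shows "\<B> = smooth_atlas"
proof -
  have cs: "complex_structure X \<B>" and iff: "\<And>U f. openin X U \<Longrightarrow> analytic_wrt \<B> U f \<longleftrightarrow> piecewise_analytic \<rho> U f"
    using assms by (auto simp: welding_structure_def)
  have charts: "\<And>c. c \<in> \<B> \<Longrightarrow> complex_chart X c"
    and compat: "\<And>c d. c \<in> \<B> \<Longrightarrow> d \<in> \<B> \<Longrightarrow> compatible_charts c d"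
    and max: "\<And>c. complex_chart X c \<Longrightarrow> (\<And>d. d \<in> \<B> \<Longrightarrow> compatible_charts c d) \<Longrightarrow> c \<in> \<B>"
    using cs unfolding complex_structure_def by blast+
  show ?thesis
  proof (intro equalityI subsetI)
    fix c assume c: "c \<in> \<B>"
    obtain U \<phi> where [simp]: "c = (U, \<phi>)" by (cases c)
    have "analytic_wrt \<B> U \<phi>"
      unfolding analytic_wrt_def
    proof clarify
      fix V \<psi> assume "(V, \<psi>) \<in> \<B>"
      then have "compatible_charts (U, \<phi>) (V, \<psi>)" using compat c by simp
      then show "(\<phi> \<circ> inv_into V \<psi>) holomorphic_on \<psi> ` (U \<inter> V)"
        by (simp add: compatible_charts_def)
    qed
    then show "c \<in> smooth_atlas"
      using iff charts[OF c] chart_openin[of U \<phi>] by (simp add: smooth_atlas_def)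
  next
    fix c assume c: "c \<in> smooth_atlas"
    obtain U \<phi> where [simp]: "c = (U, \<phi>)" by (cases c)
    have ch: "complex_chart X (U, \<phi>)" and "piecewise_analytic \<rho> U \<phi>"
      using c by (auto simp: smooth_atlas_def)
    then have an: "analytic_wrt \<B> U \<phi>" using iff chart_openin by blast
    show "c \<in> \<B>"
    proof (rule max)
      show "complex_chart X c" using ch by simp
      fix d assume d: "d \<in> \<B>"
      obtain V \<psi> where [simp]: "d = (V, \<psi>)" by (cases d)
      have 1: "(\<phi> \<circ> inv_into V \<psi>) holomorphic_on \<psi> ` (U \<inter> V)"
        using an d by (auto simp: analytic_wrt_def)
      then have "(\<psi> \<circ> inv_into U \<phi>) holomorphic_on \<phi> ` (U \<inter> V)"
        using injective_transition_inverse[OF ch, of V \<psi>] charts[OF d] by (simp add: Int_commute[of V U])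
      with 1 show "compatible_charts c d" by (simp add: compatible_charts_def)
    qed
  qed
qed

section \<open>Construction of charts\<close>

lemma smooth_on_shear: "smooth_on UNIV (shear a)"
proof -
  have 1: "smooth_on UNIV (\<lambda>z. \<rho> (Re z))"
    by (rule smooth_on_compose[OF _ _ _ smooth_on_linear[OF _ bounded_linear_Re] \<rho>_smooth]) auto
  have "smooth_on UNIV (\<lambda>z. complex_of_real (\<rho> (Re z)) + \<i> * complex_of_real (a * Im z))"
    by (intro smooth_on_add smooth_on_mult smooth_on_const smooth_on_linear_compose[OF _ bounded_linear_of_real 1]
        smooth_on_linear_compose[OF _ bounded_linear_of_real] smooth_on_linear bounded_linear_Im open_UNIV)
  then show ?thesis
    by (simp add: shear_def[abs_def] Complex_eq)
qed

text \<open>With vertical factor \<rho>'(x) the differential at x stretches both directions equally;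
  this makes the shear complex differentiable at that point, though in general not nearby.\<close>

lemma shear_has_field_derivative:
  "(shear (rderiv \<rho> x) has_field_derivative of_real (rderiv \<rho> x)) (at (of_real x))"
proof -
  have "((\<lambda>z. \<rho> (Re z)) has_derivative (\<lambda>v. rderiv \<rho> x * Re v)) (at (complex_of_real x))"
    by (rule has_derivative_compose[OF bounded_linear_imp_has_derivative[OF bounded_linear_Re], of \<rho> _ , simplified])
       (use \<rho>_derivative[of x] in \<open>simp add: has_field_derivative_def\<close>)
  then have "((\<lambda>z. complex_of_real (\<rho> (Re z)) + \<i> * complex_of_real (rderiv \<rho> x * Im z)) has_derivative
      (\<lambda>v. of_real (rderiv \<rho> x * Re v) + \<i> * of_real (rderiv \<rho> x * Im v))) (at (complex_of_real x))"
    by (intro derivative_intros bounded_linear_imp_has_derivative bounded_linear_Im has_derivative_of_real)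
  moreover have "of_real (rderiv \<rho> x * Re v) + \<i> * of_real (rderiv \<rho> x * Im v) = of_real (rderiv \<rho> x) * v" for v
    by (simp add: complex_eq_iff)
  ultimately show ?thesis
    by (simp add: has_field_derivative_def shear_def[abs_def] Complex_eq)
qed

text \<open>Continuity and injectivity in the planar model are enough; invariance of domain supplies
  openness.\<close>

lemma complex_chart_plane_map:
  assumes a: "a > 0" and S: "open S" and \<Phi>: "continuous_on S \<Phi>" "inj_on \<Phi> S"
    and \<phi>: "\<phi> \<in> extensional (plane_map a ` S)" "\<And>z. z \<in> S \<Longrightarrow> \<phi> (plane_map a z) = \<Phi> z"
  shows "complex_chart X (plane_map a ` S, \<phi>)"
proof -
  let ?U = "plane_map a ` S"
  have oU: "openin X ?U" using openin_plane_map[OF a] S by simp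
  have img: "\<phi> ` plane_map a ` T = \<Phi> ` T" if "T \<subseteq> S" for T
    using \<phi>(2) that by (force simp: image_iff)
  have oT: "open (\<Phi> ` T)" if "open T" "T \<subseteq> S" for T
    using that invariance_of_domain[of T \<Phi>] \<Phi> continuous_on_subset inj_on_subset by blast
  have sub: "W \<subseteq> ?U \<Longrightarrow> \<exists>T\<subseteq>S. W = plane_map a ` T" for W
    by (meson subset_imageE)
  have ot: "openin (top_of_set (\<phi> ` ?U)) (\<Phi> ` T)" if "open T" "T \<subseteq> S" for T
    using oT[OF that] img[of S] that by (auto simp: openin_open_eq oT[OF S])
  have "homeomorphic_map (subtopology X ?U) (top_of_set (\<phi> ` ?U)) \<phi>"
  proof (rule bijective_open_imp_homeomorphic_map)
    have top: "topspace (subtopology X ?U) = ?U"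
      using openin_subset[OF oU] by auto
    show "continuous_map (subtopology X ?U) (top_of_set (\<phi> ` ?U)) \<phi>"
      unfolding continuous_map_def top
    proof (intro conjI allI impI)
      fix V assume "openin (top_of_set (\<phi> ` ?U)) V"
      then have "open V" using openin_open_eq[of "\<phi> ` ?U" V] img[of S] oT[OF S] by auto
      have "{x \<in> ?U. \<phi> x \<in> V} = plane_map a ` (S \<inter> \<Phi> -` V)"
        using \<phi>(2) by auto
      moreover have "open (S \<inter> \<Phi> -` V)"
        by (rule continuous_open_preimage[OF \<Phi>(1) S \<open>open V\<close>])
      ultimately have "openin X {x \<in> ?U. \<phi> x \<in> V}"
        using openin_plane_map[OF a] by simp
      then show "openin (subtopology X ?U) {x \<in> ?U. \<phi> x \<in> V}"
        using openin_open_subtopology[OF oU] by auto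
    qed auto
    show "open_map (subtopology X ?U) (top_of_set (\<phi> ` ?U)) \<phi>"
      unfolding open_map_def
    proof (intro allI impI)
      fix W assume "openin (subtopology X ?U) W"
      then have W: "openin X W" "W \<subseteq> ?U" using openin_open_subtopology[OF oU] by auto
      obtain T where T: "T \<subseteq> S" "W = plane_map a ` T" using sub[OF W(2)] by blast
      have "open T" using W(1) openin_plane_map[OF a] T(2) by simp
      then show "openin (top_of_set (\<phi> ` ?U)) (\<phi> ` W)"
        using ot T img by simp
    qed
    show "\<phi> ` topspace (subtopology X ?U) = topspace (top_of_set (\<phi> ` ?U))"
      by (simp only: top topspace_euclidean_subtopology)
    show "inj_on \<phi> (topspace (subtopology X ?U))"
      unfolding top using \<Phi>(2) \<phi>(2) by (auto simp: inj_on_def)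
  qed
  then show ?thesis
    using oU \<phi>(1) oT[OF S] img[of S] by (simp add: complex_chart_def)
qed

text \<open>The chart is \<open>G Upper\<close> above and \<open>G Lower\<close> below, the latter
  reached through the shear. As each \<open>G s\<close> is smooth in the whole plane, it serves as
  the extension across the axis.\<close>

lemma nice_chart_plane_map:
  assumes a: "a > 0" and S: "open S" and G: "\<And>s. smooth_on UNIV (G s)"
    and dU: "\<And>z. z \<in> S \<Longrightarrow> Im z \<ge> 0 \<Longrightarrow> \<exists>b. b \<noteq> 0 \<and> (G Upper has_field_derivative b) (at z)"
    and dL: "\<And>z. z \<in> S \<Longrightarrow> Im z \<le> 0 \<Longrightarrow> \<exists>b. b \<noteq> 0 \<and> (G Lower has_field_derivative b) (at (shear a z))"
    and match: "\<And>x. of_real x \<in> S \<Longrightarrow> G Upper (of_real x) = G Lower (of_real (\<rho> x))"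
    and inj: "inj_on (\<lambda>z. if Im z \<ge> 0 then G Upper z else G Lower (shear a z)) S"
  shows "\<exists>\<phi>. nice_chart (plane_map a ` S) \<phi>"
proof -
  \<comment> \<open>The test has the form \<open>- Im z \<le> 0\<close> to fit
    \<open>continuous_on_cases_le\<close>.\<close>
  define \<Phi> where "\<Phi> = (\<lambda>z. if - Im z \<le> 0 then G Upper z else G Lower (shear a z))"
  define \<phi> where "\<phi> = restrict (\<lambda>p. \<Phi> (inv (plane_map a) p)) (plane_map a ` S)"
  let ?U = "plane_map a ` S"
  have \<phi>: "\<phi> (plane_map a z) = \<Phi> z" if "z \<in> S" for z
    using that plane_map_inj[OF a] by (simp add: \<phi>_def)
  have lower: "\<Phi> z = G Lower (shear a z)" if "z \<in> S" "Im z \<le> 0" for z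
  proof (cases "Im z = 0")
    case True
    then have "z = of_real (Re z)" "shear a z = of_real (\<rho> (Re z))"
      by (simp_all add: shear_def complex_eq_iff)
    then show ?thesis using match[of "Re z"] that(1) True by (simp add: \<Phi>_def)
  qed (use that in \<open>simp add: \<Phi>_def\<close>)
  have cont: "continuous_on S \<Phi>"
    unfolding \<Phi>_def
  proof (rule continuous_on_cases_le)
    show "continuous_on {t \<in> S. - Im t \<le> 0} (G Upper)"
      by (rule continuous_on_subset[OF smooth_on_continuous[OF G]]) simp
    show "continuous_on S (\<lambda>z. - Im z)"
      by (intro continuous_intros)
    show "continuous_on {t \<in> S. 0 \<le> - Im t} (\<lambda>z. G Lower (shear a z))"
      by (rule continuous_on_compose2[OF smooth_on_continuous[OF G] continuous_on_shear(1)]) auto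
    show "G Upper t = G Lower (shear a t)" if "t \<in> S" "- Im t = 0" for t
      using lower[OF that(1)] that(2) by (simp add: \<Phi>_def)
  qed
  have inj\<Phi>: "inj_on \<Phi> S" using inj by (simp add: \<Phi>_def)
  have chart: "complex_chart X (?U, \<phi>)"
    by (rule complex_chart_plane_map[OF a S cont inj\<Phi> _ \<phi>]) (unfold \<phi>_def, rule restrict_extensional)
  have side: "\<phi> (h s z) = G s z \<and> (\<exists>b. b \<noteq> 0 \<and> (G s has_field_derivative b) (at z))" if z: "z \<in> side_dom s ?U" for s z
  proof (cases s)
    case Upper
    then have "z \<in> S" "Im z \<ge> 0" using z side_dom_plane_map(1)[OF a] by auto
    then show ?thesis using \<phi>[of z] dU Upper by (simp add: plane_map_def \<Phi>_def)
  next
    case Lower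
    then have "unshear a z \<in> S" "Im z \<le> 0" using z side_dom_plane_map(2)[OF a] by auto
    moreover from this have "Im (unshear a z) \<le> 0" using a by (simp add: unshear_def divide_nonpos_pos)
    ultimately show ?thesis
      using \<phi>[of "unshear a z"] lower[of "unshear a z"] dL[of "unshear a z"] plane_map_unshear[OF a, of z] a Lower by simp
  qed
  have "piecewise_analytic \<rho> ?U \<phi>"
    unfolding piecewise_analytic_iff
  proof (intro allI conjI)
    fix s
    show "smooth_up_to_boundary (side_dom s ?U) (\<phi> \<circ> h s)"
      unfolding smooth_up_to_boundary_def using G[of s] side[of _ s]
      by (intro ballI exI[of _ UNIV] exI[of _ "G s"]) auto
    have "G s holomorphic_on side_dom s ?U - \<real>"
      unfolding holomorphic_on_def
      using side[of _ s] field_differentiable_at_within field_differentiable_def by blast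
    then show "(\<phi> \<circ> h s) holomorphic_on side_dom s ?U - \<real>"
      by (rule holomorphic_transform) (use side in auto)
  qed
  moreover have "\<exists>b. b \<noteq> 0 \<and> ((\<phi> \<circ> h s) has_field_derivative b) (at z within half_plane s)" if z: "z \<in> side_dom s ?U" for s z
  proof -
    obtain b where b: "b \<noteq> 0" "(G s has_field_derivative b) (at z)" using side[OF z] by blast
    obtain T where T: "open T" "side_dom s ?U = half_plane s \<inter> T" using side_dom_open[OF chart_openin[OF chart]] .
    obtain d where d: "d > 0" "ball z d \<subseteq> T" using T z open_contains_ball by blast
    have "((\<phi> \<circ> h s) has_field_derivative b) (at z within half_plane s)"
    proof (rule has_field_derivative_transform_within[OF has_field_derivative_at_within[OF b(2)] d(1)])
      show "z \<in> half_plane s" using z by (simp add: side_dom_def)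
      fix \<zeta> assume "\<zeta> \<in> half_plane s" "dist \<zeta> z < d"
      then have "\<zeta> \<in> side_dom s ?U" using T(2) d(2) by (auto simp: dist_commute subset_iff)
      then show "G s \<zeta> = (\<phi> \<circ> h s) \<zeta>" using side by simp
    qed
    then show ?thesis using b(1) by blast
  qed
  ultimately have "nice_chart ?U \<phi>" using chart by (simp add: nice_chart_def)
  then show ?thesis by blast
qed

text \<open>Off the axis the coordinate of the half plane is itself the chart; in the planar model
  of the lower half it appears as the shear with factor 1.\<close>

lemma nice_chart_interior:
  assumes "z \<in> half_plane s" "z \<notin> \<real>"
  shows "\<exists>U \<phi>. h s z \<in> U \<and> nice_chart U \<phi>"
proof (cases s)
  case Upper
  have ex: "\<exists>\<phi>. nice_chart (plane_map 1 ` {z. Im z > 0}) \<phi>"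
    by (rule nice_chart_plane_map[where G = "\<lambda>_ z. z"])
       (auto simp: open_halfspace_Im_gt inj_on_def intro!: smooth_on_linear[OF open_UNIV bounded_linear_ident] exI[of _ 1] DERIV_ident)
  have mem: "h s z \<in> plane_map 1 ` {z. Im z > 0}"
    using assms Upper by (auto simp: plane_map_def complex_is_Real_iff intro!: image_eqI[of _ _ z])
  show ?thesis using ex by (elim exE) (rule exI, rule exI, rule conjI[OF mem])
next
  case Lower
  have ex: "\<exists>\<phi>. nice_chart (plane_map 1 ` {z. Im z < 0}) \<phi>"
  proof (rule nice_chart_plane_map[where G = "\<lambda>_ z. z"])
    show "inj_on (\<lambda>z. if 0 \<le> Im z then z else shear 1 z) {z. Im z < 0}"
    proof (rule inj_onI)
      fix z w assume "z \<in> {z. Im z < 0}" "w \<in> {z. Im z < 0}"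
        "(if 0 \<le> Im z then z else shear 1 z) = (if 0 \<le> Im w then w else shear 1 w)"
      then have "shear 1 z = shear 1 w" by simp
      then have "unshear 1 (shear 1 z) = unshear 1 (shear 1 w)" by (rule arg_cong)
      then show "z = w" by simp
    qed
  qed (auto simp: open_halfspace_Im_lt intro!: smooth_on_linear[OF open_UNIV bounded_linear_ident] exI[of _ 1] DERIV_ident)
  have mem: "h s z \<in> plane_map 1 ` {z. Im z < 0}"
    using assms Lower plane_map_unshear[of 1 z]
    by (intro image_eqI[of _ _ "unshear 1 z"]) (auto simp: unshear_def complex_is_Real_iff)
  show ?thesis using ex by (elim exE) (rule exI, rule exI, rule conjI[OF mem])
qed

text \<open>\<open>GU\<close> and \<open>GL\<close> are the two welding functions in unscaled
  variables. Read in the plane through the shear with factor \<rho>'(x0), they have the same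
  derivative c at x0, so their combination is close to multiplication by c on both sides and across
  the axis, hence injective near x0.\<close>

lemma nice_chart_boundary: "\<exists>U \<phi>. h Upper (of_real x0) \<in> U \<and> nice_chart U \<phi>"
proof -
  define A where "A = rderiv \<rho> x0"
  have A: "A > 0" by (simp add: A_def \<rho>_derivative_pos)
  obtain \<epsilon> a b where \<epsilon>: "\<epsilon> > 0" and a: "rapid a" and b: "rapid b"
    and nz: "1 + exp_series cutoff_exp (\<lambda>n. \<i> * of_nat n * a n) 0 \<noteq> 0"
    and weld: "\<And>t s. \<bar>t\<bar> \<le> pi / 4 \<Longrightarrow> s = (\<rho> (x0 + \<epsilon> * t) - \<rho> x0) / (\<epsilon> * rderiv \<rho> x0) \<Longrightarrow>
       of_real t + exp_series cutoff_exp a (of_real t) = of_real s + exp_series cutoff_exp b (- of_real s)"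
    using local_welding[OF \<rho>_smooth \<rho>_derivative_pos] by blast
  define a' where "a' = exp_series cutoff_exp (\<lambda>n. \<i> * of_nat n * a n)"
  define b' where "b' = exp_series cutoff_exp (\<lambda>n. \<i> * of_nat n * b n)"
  define k where "k = (\<lambda>z. (z - of_real x0) * complex_of_real (1 / \<epsilon>))"
  define l where "l = (\<lambda>w. (w - of_real (\<rho> x0)) * complex_of_real (1 / (\<epsilon> * A)))"
  define GU where "GU = (\<lambda>z. k z + exp_series cutoff_exp a (k z))"
  define GL where "GL = (\<lambda>w. l w + exp_series cutoff_exp b (- l w))"
  define GU' where "GU' = (\<lambda>z. (1 + a' (k z)) * complex_of_real (1 / \<epsilon>))"
  define GL' where "GL' = (\<lambda>w. (1 - b' (- l w)) * complex_of_real (1 / (\<epsilon> * A)))"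
  note sm = smooth_on_exp_series[OF _ exp_profile_cutoff_exp]
  have smk: "smooth_on UNIV k" and sml: "smooth_on UNIV l" and sml': "smooth_on UNIV (\<lambda>w. - l w)"
    unfolding k_def l_def by (intro smooth_on_holomorphic holomorphic_intros open_UNIV)+
  have smGU: "smooth_on UNIV GU" and smGL: "smooth_on UNIV GL"
    unfolding GU_def GL_def
    by (intro smooth_on_add smk sml smooth_on_compose[OF _ _ _ smk sm[OF a]] smooth_on_compose[OF _ _ _ sml' sm[OF b]]; simp)+
  have smGU': "continuous_on UNIV GU'" and smGL': "continuous_on UNIV GL'"
  proof -
    have 1: "continuous_on UNIV (\<lambda>z. a' (k z))" and 2: "continuous_on UNIV (\<lambda>w. b' (- l w))"
      unfolding a'_def b'_def
      by (intro smooth_on_continuous smooth_on_compose[OF _ _ _ smk sm[OF rapid_mult_index[OF a]]]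
          smooth_on_compose[OF _ _ _ sml' sm[OF rapid_mult_index[OF b]]]; simp)+
    show "continuous_on UNIV GU'" "continuous_on UNIV GL'"
      unfolding GU'_def GL'_def by (intro continuous_intros 1 2)+
  qed
  have Imk: "Im (k z) = Im z / \<epsilon>" and Iml: "Im (l w) = Im w / (\<epsilon> * A)" for z w
    by (simp_all add: k_def l_def)
  have dGU: "(GU has_field_derivative GU' z) (at z)" if "Im z \<ge> 0" for z
  proof -
    have k: "(k has_field_derivative complex_of_real (1 / \<epsilon>)) (at z)"
      unfolding k_def using \<epsilon> by (auto intro!: derivative_eq_intros)
    have "(exp_series cutoff_exp a has_field_derivative a' (k z)) (at (k z))"
      unfolding a'_def by (rule exp_series_has_field_derivative[OF a]) (use that \<epsilon> in \<open>simp add: Imk\<close>)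
    from DERIV_add[OF k DERIV_chain2[OF this k]] show ?thesis
      by (simp add: GU_def GU'_def distrib_right add_divide_distrib)
  qed
  have dGL: "(GL has_field_derivative GL' w) (at w)" if "Im w \<le> 0" for w
  proof -
    have l: "(l has_field_derivative complex_of_real (1 / (\<epsilon> * A))) (at w)"
      unfolding l_def using \<epsilon> A by (auto intro!: derivative_eq_intros)
    have "(exp_series cutoff_exp b has_field_derivative b' (- l w)) (at (- l w))"
      unfolding b'_def by (rule exp_series_has_field_derivative[OF b]) (use that \<epsilon> A in \<open>simp add: Iml divide_nonpos_pos\<close>)
    from DERIV_add[OF l DERIV_chain2[OF this DERIV_minus[OF l]]] show ?thesis
      by (simp add: GL_def GL'_def left_diff_distrib diff_divide_distrib)
  qed
  have match: "GU (of_real x) = GL (of_real (\<rho> x))" if "\<bar>x - x0\<bar> \<le> \<epsilon> * (pi / 4)" for x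
  proof -
    define t where "t = (x - x0) / \<epsilon>"
    have "\<bar>t\<bar> \<le> pi / 4" using that \<epsilon> by (simp add: t_def abs_divide field_simps)
    moreover have "(\<rho> x - \<rho> x0) / (\<epsilon> * A) = (\<rho> (x0 + \<epsilon> * t) - \<rho> x0) / (\<epsilon> * rderiv \<rho> x0)"
      using \<epsilon> by (simp add: t_def A_def)
    moreover have "k (of_real x) = of_real t" "l (of_real (\<rho> x)) = of_real ((\<rho> x - \<rho> x0) / (\<epsilon> * A))"
      by (simp_all add: k_def l_def t_def)
    ultimately show ?thesis
      using weld[of t "(\<rho> x - \<rho> x0) / (\<epsilon> * A)"] by (simp add: GU_def GL_def)
  qed
  define c where "c = GU' (of_real x0)"
  have c: "c \<noteq> 0" using nz \<epsilon> by (simp add: c_def GU'_def k_def a'_def)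
  define H where "H = (\<lambda>z. GL (shear A z))"
  have smH: "smooth_on UNIV H"
    unfolding H_def by (rule smooth_on_compose[OF _ _ _ smooth_on_shear smGL]) auto
  have sh0: "shear A (of_real x) = of_real (\<rho> x)" for x by (simp add: shear_def complex_eq_iff)
  have dH: "(H has_field_derivative GL' (of_real (\<rho> x0)) * of_real A) (at (of_real x0))"
    unfolding H_def
    by (rule DERIV_chain2[OF _ shear_has_field_derivative[of x0, folded A_def]]) (simp add: sh0 dGL)
  \<comment> \<open>Both functions agree on the axis near x0, and a complex derivative is determined
    by its value along the axis.\<close>
  have cH: "c = GL' (of_real (\<rho> x0)) * of_real A"
  proof -
    have real_line: "((\<lambda>t. f (complex_of_real t)) has_vector_derivative d) (at x0)"
      if "(f has_field_derivative d) (at (of_real x0))" for f d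
    proof -
      have "(complex_of_real has_vector_derivative 1) (at x0)"
        using has_vector_derivative_of_real[OF DERIV_ident[of "at x0"]] by simp
      from field_vector_diff_chain_at[OF this that] show ?thesis by (simp add: o_def)
    qed
    have "((\<lambda>t. GU (complex_of_real t)) has_vector_derivative c) (at x0)"
      unfolding c_def by (rule real_line[OF dGU]) simp
    then have "((\<lambda>t. H (complex_of_real t)) has_vector_derivative c) (at x0)"
    proof (rule has_vector_derivative_transform_within_open)
      show "x0 \<in> ball x0 (\<epsilon> * (pi / 4))" using \<epsilon> by simp
      show "GU (of_real t) = H (of_real t)" if "t \<in> ball x0 (\<epsilon> * (pi / 4))" for t
        using match[of t] that by (simp add: H_def sh0 dist_real_def abs_minus_commute)
    qed simp
    then show ?thesis using vector_derivative_unique_at real_line[OF dH] by blast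
  qed
  obtain r1 where r1: "r1 > 0" "\<And>z w. z \<in> ball (of_real x0) r1 \<Longrightarrow> w \<in> ball (of_real x0) r1 \<Longrightarrow>
      norm (GU z - GU w - c * (z - w)) \<le> norm c / 2 * norm (z - w)"
  proof (rule strictly_differentiable[OF open_UNIV smGU UNIV_I])
    show "(GU has_field_derivative c) (at (of_real x0))" unfolding c_def by (rule dGU) simp
    show "0 < norm c / 2" using c by simp
  qed (use that in blast)
  obtain r2 where r2: "r2 > 0" "\<And>z w. z \<in> ball (of_real x0) r2 \<Longrightarrow> w \<in> ball (of_real x0) r2 \<Longrightarrow>
      norm (H z - H w - c * (z - w)) \<le> norm c / 2 * norm (z - w)"
  proof (rule strictly_differentiable[OF open_UNIV smH UNIV_I])
    show "(H has_field_derivative c) (at (of_real x0))" unfolding cH by (rule dH)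
    show "0 < norm c / 2" using c by simp
  qed (use that in blast)
  \<comment> \<open>The last term keeps the real points of the ball in the interval |x - x0| \<le>
    \<epsilon> pi/4, where the welding equation is available.\<close>
  define r where "r = min (min r1 r2) (\<epsilon> * (pi / 4))"
  have r: "r > 0" "r \<le> r1" "r \<le> r2" "r \<le> \<epsilon> * (pi / 4)" using r1(1) r2(1) \<epsilon> by (auto simp: r_def)
  let ?B = "ball (complex_of_real x0) r"
  have estU: "norm (GU z - GU w - c * (z - w)) \<le> norm c / 2 * norm (z - w)" if "z \<in> ?B" "w \<in> ?B" for z w
    using r1(2) that r(2) by simp
  have estH: "norm (H z - H w - c * (z - w)) \<le> norm c / 2 * norm (z - w)" if "z \<in> ?B" "w \<in> ?B" for z w
    using r2(2) that r(3) by simp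
  have matchB: "GU (of_real x) = GL (of_real (\<rho> x))" "GU (of_real x) = H (of_real x)" if "complex_of_real x \<in> ?B" for x
  proof -
    have "\<bar>x - x0\<bar> < r" using that by (simp add: dist_of_real dist_real_def abs_minus_commute)
    then show "GU (of_real x) = GL (of_real (\<rho> x))" using match[of x] r(4) by simp
    then show "GU (of_real x) = H (of_real x)" by (simp add: H_def sh0)
  qed
  \<comment> \<open>Both derivatives are nonzero at x0 and continuous; \<open>S\<close> is cut down
    to where they stay nonzero.\<close>
  define S where "S = ?B \<inter> GU' -` (- {0}) \<inter> (\<lambda>z. GL' (shear A z)) -` (- {0})"
  have "open S"
  proof -
    have "continuous_on UNIV (\<lambda>z. GL' (shear A z))"
      by (rule continuous_on_compose2[OF smGL' continuous_on_shear(1)]) auto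
    then have "open (GU' -` (- {0}))" "open ((\<lambda>z. GL' (shear A z)) -` (- {0}))"
      using continuous_open_preimage[OF smGU' open_UNIV, of "- {0}"]
        continuous_open_preimage[of UNIV "\<lambda>z. GL' (shear A z)" "- {0}"] by auto
    then show ?thesis unfolding S_def by (intro open_Int open_ball)
  qed
  have x0S: "of_real x0 \<in> S"
    using r(1) c cH by (auto simp: S_def c_def sh0)
  have ex: "\<exists>\<phi>. nice_chart (plane_map A ` S) \<phi>"
  proof (rule nice_chart_plane_map[where G = "\<lambda>s. case s of Upper \<Rightarrow> GU | Lower \<Rightarrow> GL", OF A \<open>open S\<close>])
    show "smooth_on UNIV (case s of Upper \<Rightarrow> GU | Lower \<Rightarrow> GL)" for s
      using smGU smGL by (cases s) auto
    show "\<exists>b. b \<noteq> 0 \<and> ((case Upper of Upper \<Rightarrow> GU | Lower \<Rightarrow> GL) has_field_derivative b) (at z)" if "z \<in> S" "0 \<le> Im z" for z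
      using dGU[OF that(2)] that(1) by (auto simp: S_def)
    show "\<exists>b. b \<noteq> 0 \<and> ((case Lower of Upper \<Rightarrow> GU | Lower \<Rightarrow> GL) has_field_derivative b) (at (shear A z))"
      if "z \<in> S" "Im z \<le> 0" for z
      using dGL[of "shear A z"] that A by (auto simp: S_def shear_def mult_nonneg_nonpos)
    show "(case Upper of Upper \<Rightarrow> GU | Lower \<Rightarrow> GL) (of_real x) = (case Lower of Upper \<Rightarrow> GU | Lower \<Rightarrow> GL) (of_real (\<rho> x))"
      if "complex_of_real x \<in> S" for x
      using matchB(1) that by (simp add: S_def)
    have "inj_on (\<lambda>z. if 0 \<le> Im z then GU z else H z) S"
    proof (rule strictly_differentiable_inj[of _ _ c "norm c / 2"])
      fix z w assume zw: "z \<in> S" "w \<in> S"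
      then have B: "z \<in> ?B" "w \<in> ?B" by (auto simp: S_def)
      have cross: "norm (GU u - H v - c * (u - v)) \<le> norm c / 2 * norm (u - v)"
        if "u \<in> ?B" "Im u \<ge> 0" "v \<in> ?B" "Im v \<le> 0" for u v
        by (rule cross_real_axis[where x = "of_real x0" and r = r, OF _ _ _ that])
           (erule (1) estU, erule (1) estH, erule matchB(2))
      consider "Im z \<ge> 0" "Im w \<ge> 0" | "Im z < 0" "Im w < 0" | "Im z \<ge> 0" "Im w < 0" | "Im z < 0" "Im w \<ge> 0"
        by linarith
      then show "norm ((if 0 \<le> Im z then GU z else H z) - (if 0 \<le> Im w then GU w else H w) - c * (z - w)) \<le> norm c / 2 * norm (z - w)"
      proof cases
        case 1
        then show ?thesis using estU[OF B] by simp
      next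
        case 2
        then show ?thesis using estH[OF B] by simp
      next
        case 3
        then show ?thesis using cross[OF B(1) _ B(2)] by simp
      next
        case 4
        then have "norm (GU w - H z - c * (w - z)) \<le> norm c / 2 * norm (w - z)"
          using cross[OF B(2) _ B(1)] by simp
        moreover have e: "H z - GU w - c * (z - w) = - (GU w - H z - c * (w - z))" by (simp add: algebra_simps)
        ultimately have "norm (H z - GU w - c * (z - w)) \<le> norm c / 2 * norm (z - w)"
          unfolding e norm_minus_cancel by (simp only: norm_minus_commute[of z w])
        then show ?thesis using 4 by simp
      qed
    qed (use c in simp)
    then show "inj_on (\<lambda>z. if 0 \<le> Im z then (case Upper of Upper \<Rightarrow> GU | Lower \<Rightarrow> GL) z
        else (case Lower of Upper \<Rightarrow> GU | Lower \<Rightarrow> GL) (shear A z)) S"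
      unfolding H_def side.case .
  qed
  have mem: "h Upper (of_real x0) \<in> plane_map A ` S"
    using x0S by (intro image_eqI[of _ _ "of_real x0"]) (auto simp: plane_map_def)
  show ?thesis using ex by (elim exE) (rule exI, rule exI, rule conjI[OF mem])
qed

lemma nice_chart_exists:
  assumes "p \<in> topspace X"
  shows "\<exists>U \<phi>. p \<in> U \<and> nice_chart U \<phi>"
proof -
  obtain s z where z: "p = h s z" "z \<in> half_plane s" using assms by (auto simp: topspace_glued)
  show ?thesis
  proof (cases "z \<in> \<real>")
    case False
    then show ?thesis using nice_chart_interior[OF z(2)] z(1) by blast
  next
    case True
    then obtain y where y: "z = of_real y" by (auto elim: Reals_cases)
    have "\<exists>x. p = h Upper (of_real x)"
    proof (cases s)
      case Lower
      then show ?thesis using z(1) y half_plane_map_real[of "inv \<rho> y"] by (metis \<rho>_inv(2))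
    qed (use z(1) y in blast)
    then show ?thesis using nice_chart_boundary by blast
  qed
qed

section \<open>The complex structure\<close>

lemma nice_chart_in_atlas: "nice_chart U \<phi> \<Longrightarrow> (U, \<phi>) \<in> smooth_atlas"
  by (simp add: nice_chart_def smooth_atlas_def)

text \<open>A chart of the atlas is not assumed to have nonzero one-sided derivatives. A reference
  chart circumvents this: the given chart is holomorphic in it, and injectivity makes the reverse
  transition holomorphic too.\<close>

lemma smooth_atlas_holomorphic:
  assumes c: "(U, \<phi>) \<in> smooth_atlas" and V: "openin X V" and f: "piecewise_analytic \<rho> V f"
  shows "(f \<circ> inv_into U \<phi>) holomorphic_on \<phi> ` (U \<inter> V)"
  unfolding holomorphic_on_def
proof
  fix y assume "y \<in> \<phi> ` (U \<inter> V)"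
  then obtain p where p: "p \<in> U" "p \<in> V" "y = \<phi> p" by blast
  have ch: "complex_chart X (U, \<phi>)" and PA: "piecewise_analytic \<rho> U \<phi>"
    using c by (auto simp: smooth_atlas_def)
  have "p \<in> topspace X" using p(1) chart_subset[OF ch] by blast
  then obtain U0 \<phi>0 where n: "p \<in> U0" "nice_chart U0 \<phi>0" using nice_chart_exists by blast
  have ch0: "complex_chart X (U0, \<phi>0)" using n(2) by (simp add: nice_chart_def)
  define N where "N = U \<inter> U0 \<inter> V"
  have "openin X N" using chart_openin[OF ch] chart_openin[OF ch0] V by (simp add: N_def openin_Int)
  then have oN: "open (\<phi> ` N)" using chart_open_image[OF ch, of N] by (simp add: N_def Int_assoc)
  have "(\<phi> \<circ> inv_into U0 \<phi>0) holomorphic_on \<phi>0 ` (U0 \<inter> U)"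
    by (rule nice_chart_holomorphic[OF n(2) chart_openin[OF ch] PA])
  then have "(\<phi>0 \<circ> inv_into U \<phi>) holomorphic_on \<phi> ` (U \<inter> U0)"
    by (rule injective_transition_inverse[OF ch ch0])
  then have 1: "(\<phi>0 \<circ> inv_into U \<phi>) holomorphic_on \<phi> ` N"
    by (rule holomorphic_on_subset) (auto simp: N_def)
  have eq: "inv_into U \<phi> (\<phi> q) = q" if "q \<in> N" for q
    using that inv_into_f_f[OF chart_inj[OF ch]] by (simp add: N_def)
  have eq0: "inv_into U0 \<phi>0 (\<phi>0 q) = q" if "q \<in> N" for q
    using that inv_into_f_f[OF chart_inj[OF ch0]] by (simp add: N_def)
  have "(\<phi>0 \<circ> inv_into U \<phi>) ` \<phi> ` N \<subseteq> \<phi>0 ` (U0 \<inter> V)"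
    using eq by (auto simp: N_def)
  from holomorphic_on_compose_gen[OF 1 nice_chart_holomorphic[OF n(2) V f] this]
  have "(f \<circ> inv_into U \<phi>) holomorphic_on \<phi> ` N"
    by (rule holomorphic_transform) (use eq eq0 in auto)
  moreover have "y \<in> \<phi> ` N" using p n(1) by (auto simp: N_def)
  ultimately have "(f \<circ> inv_into U \<phi>) field_differentiable at y"
    using oN holomorphic_on_imp_differentiable_at by blast
  then show "(f \<circ> inv_into U \<phi>) field_differentiable at y within \<phi> ` (U \<inter> V)"
    by (rule field_differentiable_at_within)
qed

text \<open>For maximality, reference charts suffice: compatibility with them makes a chart
  piecewise analytic near every point.\<close>

lemma smooth_atlas_complex_structure: "complex_structure X smooth_atlas"
  unfolding complex_structure_def
proof (intro conjI ballI allI impI)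
  show "complex_chart X c" if "c \<in> smooth_atlas" for c
    using that by (auto simp: smooth_atlas_def)
  show "\<Union> (fst ` smooth_atlas) = topspace X"
  proof (intro equalityI subsetI)
    fix p assume "p \<in> \<Union> (fst ` smooth_atlas)"
    then obtain U \<phi> where "(U, \<phi>) \<in> smooth_atlas" "p \<in> U" by auto
    then show "p \<in> topspace X" using chart_subset by (auto simp: smooth_atlas_def)
  next
    fix p assume "p \<in> topspace X"
    then obtain U \<phi> where "p \<in> U" "(U, \<phi>) \<in> smooth_atlas"
      using nice_chart_exists nice_chart_in_atlas by blast
    then show "p \<in> \<Union> (fst ` smooth_atlas)" by force
  qed
  show "compatible_charts c d" if "c \<in> smooth_atlas" "d \<in> smooth_atlas" for c d
  proof -
    obtain U \<phi> V \<psi> where cd: "c = (U, \<phi>)" "d = (V, \<psi>)" by (cases c, cases d)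
    have "openin X U" "piecewise_analytic \<rho> U \<phi>" "openin X V" "piecewise_analytic \<rho> V \<psi>"
      using that chart_openin by (auto simp: cd smooth_atlas_def)
    then show ?thesis
      using smooth_atlas_holomorphic[of U \<phi> V \<psi>] smooth_atlas_holomorphic[of V \<psi> U \<phi>] that
      by (simp add: cd compatible_charts_def Int_commute[of V U])
  qed
  fix c assume c: "complex_chart X c \<and> (\<forall>d\<in>smooth_atlas. compatible_charts c d)"
  obtain U \<phi> where [simp]: "c = (U, \<phi>)" by (cases c)
  have ch: "complex_chart X (U, \<phi>)" using c by simp
  have "piecewise_analytic \<rho> U \<phi>"
  proof (rule piecewise_analytic_local[OF chart_openin[OF ch]])
    fix p assume "p \<in> U"
    then have "p \<in> topspace X" using chart_subset[OF ch] by blast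
    then obtain U0 \<phi>0 where n: "p \<in> U0" "nice_chart U0 \<phi>0" using nice_chart_exists by blast
    then have "compatible_charts (U, \<phi>) (U0, \<phi>0)" using c nice_chart_in_atlas by simp
    then have "(\<phi> \<circ> inv_into U0 \<phi>0) holomorphic_on \<phi>0 ` (U0 \<inter> U)"
      by (simp add: compatible_charts_def Int_commute[of U0 U])
    then show "\<exists>U0 \<phi>0. p \<in> U0 \<and> complex_chart X (U0, \<phi>0) \<and> piecewise_analytic \<rho> U0 \<phi>0 \<and>
        (\<phi> \<circ> inv_into U0 \<phi>0) holomorphic_on \<phi>0 ` (U0 \<inter> U)"
      using n unfolding nice_chart_def by blast
  qed
  then show "c \<in> smooth_atlas" using ch by (simp add: smooth_atlas_def)
qed

lemma smooth_atlas_welding_structure: "welding_structure \<rho> smooth_atlas"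
  unfolding welding_structure_def
proof (intro conjI allI impI)
  show "complex_structure X smooth_atlas" by (rule smooth_atlas_complex_structure)
  fix V f assume V: "openin X V"
  show "analytic_wrt smooth_atlas V f \<longleftrightarrow> piecewise_analytic \<rho> V f"
  proof
    assume "piecewise_analytic \<rho> V f"
    then show "analytic_wrt smooth_atlas V f"
      unfolding analytic_wrt_def
      using smooth_atlas_holomorphic[OF _ V] by (auto simp: Int_commute[of V])
  next
    assume an: "analytic_wrt smooth_atlas V f"
    show "piecewise_analytic \<rho> V f"
    proof (rule piecewise_analytic_local[OF V])
      fix p assume "p \<in> V"
      then have "p \<in> topspace X" using openin_subset[OF V] by blast
      then obtain U \<phi> where n: "p \<in> U" "nice_chart U \<phi>" using nice_chart_exists by blast
      have "(f \<circ> inv_into U \<phi>) holomorphic_on \<phi> ` (V \<inter> U)"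
        using an nice_chart_in_atlas[OF n(2)] by (auto simp: analytic_wrt_def)
      then show "\<exists>U \<phi>. p \<in> U \<and> complex_chart X (U, \<phi>) \<and> piecewise_analytic \<rho> U \<phi> \<and>
          (f \<circ> inv_into U \<phi>) holomorphic_on \<phi> ` (U \<inter> V)"
        using n unfolding nice_chart_def by (metis Int_commute)
    qed
  qed
qed

text \<open>Near a point of the axis, the curve is the image of the real line under a smooth extension of the chart from the upper side.\<close>

lemma smooth_curve_real_axis:
  assumes c: "(U, \<phi>) \<in> smooth_atlas"
  shows "smooth_curve (\<phi> ` (U \<inter> real_axis \<rho>))"
  unfolding smooth_curve_def
proof
  fix y assume "y \<in> \<phi> ` (U \<inter> real_axis \<rho>)"
  then obtain x where x: "h Upper (of_real x) \<in> U" "y = \<phi> (h Upper (of_real x))"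
    by (auto simp: real_axis_def Reals_def)
  have ch: "complex_chart X (U, \<phi>)" and PA: "piecewise_analytic \<rho> U \<phi>"
    using c by (auto simp: smooth_atlas_def)
  note inj = chart_inj[OF ch] and oU = chart_openin[OF ch]
  have xU: "of_real x \<in> side_dom Upper U" using x(1) by (simp add: side_dom_def)
  have xh: "complex_of_real x \<in> half_plane Upper" by simp
  obtain W g where W: "open W" "of_real x \<in> W" "half_plane Upper \<inter> W \<subseteq> side_dom Upper U" "smooth_on W g"
    "\<And>\<zeta>. \<zeta> \<in> half_plane Upper \<inter> W \<Longrightarrow> g \<zeta> = \<phi> (h Upper \<zeta>)"
    "\<And>\<zeta>. \<zeta> \<in> half_plane Upper \<inter> W \<Longrightarrow> \<exists>b. (g has_field_derivative b) (at \<zeta>)"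
    using piecewise_analytic_extension[OF oU PA xU] by blast
  obtain b where b: "(g has_field_derivative b) (at (of_real x))"
    using W(2,6) xh by blast
  have gx: "g (of_real x) = y" using W(2,5) xh x(2) by simp
  \<comment> \<open>Otherwise a reference chart, being locally a holomorphic function of \<phi>,
    would have derivative 0 from the upper side.\<close>
  have "b \<noteq> 0"
  proof
    assume "b = 0"
    obtain U0 \<phi>0 where n: "h Upper (of_real x) \<in> U0" "nice_chart U0 \<phi>0"
      using nice_chart_boundary by blast
    have ch0: "complex_chart X (U0, \<phi>0)" and PA0: "piecewise_analytic \<rho> U0 \<phi>0"
      using n(2) by (auto simp: nice_chart_def)
    obtain a where a: "a \<noteq> 0" "((\<phi>0 \<circ> h Upper) has_field_derivative a) (at (of_real x) within half_plane Upper)"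
      using n xh unfolding nice_chart_def side_dom_def by blast
    let ?T = "\<phi>0 \<circ> inv_into U \<phi>" and ?N = "\<phi> ` (U \<inter> U0)"
    have hol: "?T holomorphic_on ?N"
      by (rule smooth_atlas_holomorphic[OF c chart_openin[OF ch0] PA0])
    have oN: "open ?N" by (rule chart_openI[OF ch chart_openin[OF ch0]])
    have yN: "g (of_real x) \<in> ?N" using gx x n(1) by auto
    have "((\<lambda>\<zeta>. ?T (g \<zeta>)) has_field_derivative deriv ?T (g (of_real x)) * b) (at (of_real x))"
      by (rule DERIV_chain2[OF holomorphic_derivI[OF hol oN yN] b])
    then have d0: "((\<lambda>\<zeta>. ?T (g \<zeta>)) has_field_derivative 0) (at (of_real x) within half_plane Upper)"
      using \<open>b = 0\<close> has_field_derivative_at_within by fastforce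
    obtain d where d: "d > 0" "ball (of_real x) d \<subseteq> W" using W(1,2) open_contains_ball by blast
    have "((\<phi>0 \<circ> h Upper) has_field_derivative 0) (at (of_real x) within half_plane Upper)"
    proof (rule has_field_derivative_transform_within[OF d0 d(1) xh])
      fix \<zeta> assume "\<zeta> \<in> half_plane Upper" "dist \<zeta> (of_real x) < d"
      then have z: "\<zeta> \<in> half_plane Upper \<inter> W" using d(2) by (auto simp: dist_commute)
      then have "h Upper \<zeta> \<in> U" using W(3) by (auto simp: side_dom_def)
      then show "?T (g \<zeta>) = (\<phi>0 \<circ> h Upper) \<zeta>"
        using W(5)[OF z] inv_into_f_f[OF inj] by simp
    qed
    then have "a = 0"
      using has_field_derivative_unique[OF a(2) _ at_half_plane_nontrivial[OF xh]] by blast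
    with a(1) show False ..
  qed
  obtain V \<Psi> where V: "open V" "of_real x \<in> V" "V \<subseteq> W" "inj_on g V"
    and V': "\<And>V'. open V' \<Longrightarrow> V' \<subseteq> V \<Longrightarrow> open (g ` V') \<and> homeomorphism V' (g ` V') g \<Psi> \<and> smooth_on (g ` V') \<Psi>"
    using smooth_local_inverse[OF W(1,4,2) b \<open>b \<noteq> 0\<close>] by blast
  \<comment> \<open>Other stretches of the axis must not enter the neighbourhood: \<open>P\<close>
    admits only points whose retraction to the upper half plane lies in V, where g is
    injective.\<close>
  define P where "P = U \<inter> {p \<in> topspace X. side_proj Upper p \<in> V}"
  have oP: "open (\<phi> ` P)"
    unfolding P_def by (rule chart_openI[OF ch openin_side_proj[OF V(1)]])
  define V1 where "V1 = V \<inter> g -` (\<phi> ` P)"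
  have cg: "continuous_on V g"
    by (rule continuous_on_subset[OF smooth_on_continuous[OF W(4)] V(3)])
  have V1: "open V1" "V1 \<subseteq> V"
    unfolding V1_def by (rule continuous_open_preimage[OF cg V(1) oP]) blast
  have "h Upper (of_real x) \<in> P"
    using x(1) V(2) chart_subset[OF ch] side_proj_half_plane_map[OF xh] by (auto simp: P_def)
  then have xV1: "of_real x \<in> V1"
    using V(2) gx x(2) by (auto simp: V1_def)
  have hom: "open (g ` V1)" "homeomorphism V1 (g ` V1) g \<Psi>" "smooth_on (g ` V1) \<Psi>"
    using V'[OF V1] by auto
  have \<Psi>g: "\<Psi> (g z) = z" if "z \<in> V1" for z
    using hom(2) that by (simp add: homeomorphism_def)
  have gW: "g (of_real t) = \<phi> (h Upper (of_real t)) \<and> h Upper (of_real t) \<in> U" if "complex_of_real t \<in> V" for t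
  proof -
    have z: "complex_of_real t \<in> half_plane Upper \<inter> W" using that V(3) by auto
    then show ?thesis using W(3) W(5)[OF z] unfolding side_dom_def by blast
  qed
  have img: "\<Psi> ` (\<phi> ` (U \<inter> real_axis \<rho>) \<inter> g ` V1) = V1 \<inter> \<real>"
  proof (intro equalityI subsetI)
    fix w assume "w \<in> \<Psi> ` (\<phi> ` (U \<inter> real_axis \<rho>) \<inter> g ` V1)"
    then obtain q z where q: "q \<in> U" "q \<in> real_axis \<rho>" "z \<in> V1" "\<phi> q = g z" "w = \<Psi> (g z)" by auto
    obtain t where t: "q = h Upper (of_real t)" using q(2) by (auto simp: real_axis_def Reals_def)
    have "g z \<in> \<phi> ` P" using q(3) by (simp add: V1_def)
    then obtain p where p: "p \<in> P" "\<phi> p = \<phi> q" using q(4) by auto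
    then have "p = q" using inj_onD[OF inj] q(1) by (auto simp: P_def)
    then have "side_proj Upper q \<in> V" using p(1) by (simp add: P_def)
    then have tV: "complex_of_real t \<in> V" using side_proj_half_plane_map[of "of_real t" Upper] t by simp
    then have "g (of_real t) = g z" using gW[OF tV] q(4) t by simp
    then have "of_real t = z" using inj_onD[OF V(4)] tV q(3) V1(2) by blast
    then show "w \<in> V1 \<inter> \<real>" using q(3,5) \<Psi>g[OF q(3)] by auto
  next
    fix w assume w: "w \<in> V1 \<inter> \<real>"
    then obtain t where t: "w = of_real t" by (auto elim: Reals_cases)
    have "g w \<in> \<phi> ` (U \<inter> real_axis \<rho>)"
      using gW[of t] w V1(2) t by (auto simp: real_axis_def)
    then have "g w \<in> \<phi> ` (U \<inter> real_axis \<rho>) \<inter> g ` V1" using w by blast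
    then show "w \<in> \<Psi> ` (\<phi> ` (U \<inter> real_axis \<rho>) \<inter> g ` V1)"
      using \<Psi>g[of w] w by (intro image_eqI[of _ _ "g w"]) auto
  qed
  have "homeomorphism (g ` V1) V1 \<Psi> g" using hom(2) by (rule homeomorphism_symD)
  moreover have "smooth_on V1 g"
    by (rule smooth_on_subset[OF W(4)]) (use V1(2) V(3) in blast)
  moreover have "y \<in> g ` V1" using xV1 gx by blast
  ultimately show "\<exists>W (W' :: complex set) \<Phi> \<Psi>. open W \<and> open W' \<and> y \<in> W \<and> homeomorphism W W' \<Phi> \<Psi> \<and>
      smooth_on W \<Phi> \<and> smooth_on W' \<Psi> \<and> \<Phi> ` (\<phi> ` (U \<inter> real_axis \<rho>) \<inter> W) = W' \<inter> \<real>"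
    using hom(1,3) V1(1) img
    by - (rule exI[of _ "g ` V1"], rule exI[of _ V1], rule exI[of _ \<Psi>], rule exI[of _ g], simp)
qed

end

theorem theoremB1:
  fixes \<rho> :: "real \<Rightarrow> real"
  assumes "strict_mono \<rho>"
    and "diffeomorphism_of_reals \<rho>"
    and "circle_diffeomorphism (circle_extension \<rho>)"
  shows "(\<exists>!\<A>. welding_structure \<rho> \<A>) \<and>
    (\<forall>\<A> U \<phi>. welding_structure \<rho> \<A> \<and> (U, \<phi>) \<in> \<A> \<longrightarrow> smooth_curve (\<phi> ` (U \<inter> real_axis \<rho>)))"
proof -
  interpret welding_map \<rho>
    using assms by unfold_locales
  have "\<exists>!\<A>. welding_structure \<rho> \<A>"
    using smooth_atlas_welding_structure unique_structure by (rule ex1I)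
  moreover have "smooth_curve (\<phi> ` (U \<inter> real_axis \<rho>))" if "welding_structure \<rho> \<A>" "(U, \<phi>) \<in> \<A>" for \<A> U \<phi>
    using smooth_curve_real_axis that unique_structure[OF that(1)] by simp
  ultimately show ?thesis by blast
qed

end
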